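(* Suppose $\rho(\phi^m)\in[\rho_1,\rho_2]$ in $\Omega$. Let $(\mathbf{u}^{m+1},p^{m+1},\phi^{m+1},\mu^{m+1})$ be any solution of the discrete scheme (S1)--(S4) (described in the context) for the data $(\mathbf{u}^m,\phi^m,\mu^m)$. Then the density of the mixture satisfies $$\rho(\phi^{m+1})\in[\rho_1,\rho_2]\quad\text{and}\quad\rho(\Pi^h_1\phi^{m+1})\in[\rho_1,\rho_2]\quad\text{in }\Omega .$$
   Context: **Constants and functions.** $\Omega\subset\mathbb{R}^d$ ($d\in\{2,3\}$) is a bounded polygonal (polyhedral) domain; $0<\rho_1<\rho_2$, $\lambda>0$, $\varepsilon>0$, $\Delta t>0$; $\eta\in C^0([-1,1])$ with $\eta\ge C>0$. For a real-valued function $v$, $v_\oplus=\max\{v,0\}$, $v_\ominus=-\min\{v,0\}$. Put $\rho_{\mathrm{avg}}=\frac{\rho_1+\rho_2}{2}$, $\rho_{\mathrm{dif}}=\frac{\rho_2-\rho_1}{2}$, $\rho(\phi)=\rho_{\mathrm{avg}}+\rho_{\mathrm{dif}}\phi$ (so $\rho(\phi)\in[\rho_1,\rho_2]$ is equivalent to $\phi\in[-1,1]$), $M(\phi)=(1-\phi^2)_\oplus$, and $f(\phi_1,\phi_0)=F_i'(\phi_1)+F_e'(\phi_0)$ with $F_i(\phi)=\phi^2+\frac14$, $F_e(\phi)=\frac14\phi^4-\frac32\phi^2$. $M^\uparrow(z)=M(z)$ if $z\le0$ and $M(0)$ if $z>0$; $M^\downarrow(z)=0$ if $z\le 0$ and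 $M(z)-M(0)$ if $z>0$. $\mathbf{D}\mathbf{u}=\frac12(\nabla\mathbf{u}+\nabla\mathbf{u}^t)$. $(\cdot,\cdot)$ is the $L^2(\Omega)$ scalar product (Frobenius product for tensors). $\delta_t v^{m+1}=(v^{m+1}-v^m)/\Delta t$. **Mesh.** $\mathcal{T}_h$ is a shape-regular simplicial mesh of $\overline\Omega$ such that for every interior edge (face) $e=K\cap L$ the line between the barycenters of $K$ and $L$ is orthogonal to $e$; $\mathcal{D}_e(\mathcal{T}_h)>0$ is the distance between these barycenters. $\mathcal{E}_h^{\mathrm i}$ is the set of interior edges (faces); each $e\in\mathcal{E}_h^{\mathrm i}$ has a fixed unit normal $\mathbf{n}_e$, and we write $e=K\cap L$ with $\mathbf{n}_e$ exterior to $K$ and pointing to $L$. On such $e$, $\{\!\{v\}\!\}=\frac{v_K+v_L}{2}$ and $[\![v]\!]=v_K-v_L$. **Spaces and projections.** $\mathbb{P}^{\mathrm{disc}}_k(\mathcal{T}_h)$ (resp. $\mathbb{P}^{\mathrm{cont}}_k(\mathcal{T}_h)$) is the space of discontinuous (resp. continuous) functions that are polynomials of degree at most $k$ on each $K\in\mathcal{T}_h$. $(\mathcal{U}_h,\mathcal{P}_h)$ is an inf-sup compatible (velocity, pressure) pair of finite-dimensional spaces with $\mathcal{U}_h\subset(C^0(\overline\Omega)\cap H^1_0(\Omega))^d$ and $\mathbb{P}^{\mathrm{disc}}_0(\mathcal{T}_h)\subset\mathcal{P}_h$. The mass-lumping product on $\mathbb{P}^{\mathrm{cont}}_1(\mathcal{T}_h)$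 is $(\varphi,\psi)_h=\frac1{d+1}\sum_{K}|K|\sum_{j=1}^{d+1}\varphi(x_{j,K})\psi(x_{j,K})$, $x_{j,K}$ being the vertices of $K$. For $g\in L^1(\Omega)$: $\Pi_0g\in\mathbb{P}^{\mathrm{disc}}_0(\mathcal{T}_h)$ with $(\Pi_0g,\overline w)=(g,\overline w)$ for all $\overline w\in\mathbb{P}^{\mathrm{disc}}_0(\mathcal{T}_h)$; $\Pi_1g\in\mathbb{P}^{\mathrm{cont}}_1(\mathcal{T}_h)$ with $(\Pi_1g,\overline v)=(g,\overline v)$ for all $\overline v\in\mathbb{P}^{\mathrm{cont}}_1(\mathcal{T}_h)$ (applied componentwise to vector fields); $\Pi^h_1g\in\mathbb{P}^{\mathrm{cont}}_1(\mathcal{T}_h)$ with $(\Pi^h_1g,\overline v)_h=(g,\overline v)$ for all $\overline v\in\mathbb{P}^{\mathrm{cont}}_1(\mathcal{T}_h)$. **Forms** (differential operators are taken elementwise where needed): - $c_h(\phi,\mu,\overline{\mathbf u})=-\int_\Omega\nabla\cdot(\phi\overline{\mathbf u})\mu-\sum_{e\in\mathcal{E}_h^{\mathrm i}}\int_e(\overline{\mathbf u}\cdot\mathbf{n}_e)\{\!\{\phi\}\!\}[\![\mu]\!]$; - $a_h^{\mathrm{upw}}(\mathbf u;\phi,\overline\phi)=\sum_{e\in\mathcal{E}_h^{\mathrm i},e=K\cap L}\int_e\big((\mathbf u\cdot\mathbf n_e)_\oplus\phi_K-(\mathbf u\cdot\mathbf n_e)_\ominus\phi_L\big)[\![\overline\phi]\!]$;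 - $b_h^{\mathrm{upw}}(-\nabla^0_{\mathbf n}\mu;M(\phi),\overline\phi)=\sum_{e\in\mathcal{E}_h^{\mathrm i},e=K\cap L}\frac1{\mathcal{D}_e(\mathcal{T}_h)}\int_e\big([\![\Pi_0\mu]\!]_\oplus(M^\uparrow(\phi_K)+M^\downarrow(\phi_L))_\oplus-[\![\Pi_0\mu]\!]_\ominus(M^\uparrow(\phi_L)+M^\downarrow(\phi_K))_\oplus\big)[\![\overline\phi]\!]$, where $\nabla^0_{\mathbf n}\mu|_e=-[\![\Pi_0\mu]\!]/\mathcal{D}_e(\mathcal{T}_h)$; - $s_h^1(\mathbf u_1,\mathbf u_0,\phi_1,\phi_0,\mu,\overline{\mathbf u})=\frac12\Big\{\big(\tfrac{\rho(\phi_1)-\rho(\phi_0)}{\Delta t},\mathbf u_1\cdot\overline{\mathbf u}\big)-\big(\rho(\phi_0)\mathbf u_0-\rho_{\mathrm{dif}}M(\phi_0)\Pi_1(\nabla\mu),\nabla(\mathbf u_1\cdot\overline{\mathbf u})\big)\Big\}$; - $s_h^2(\mathbf u,\phi,\mu,\overline{\mathbf u})=-\frac12\sum_{e\in\mathcal{E}_h^{\mathrm i}}\int_e(\overline{\mathbf u}\cdot\mathbf n_e)\,\mathrm{sign}(\mathbf u\cdot\mathbf n_e)[\![\phi]\!][\![\mu]\!]$. **Scheme (one time step).** Given $\mathbf u^m\in\mathcal{U}_h$, $\phi^m\in\mathbb{P}^{\mathrm{disc}}_0(\mathcal{T}_h)$ with values in $[-1,1]$, $\mu^m\in\mathbb{P}^{\mathrm{cont}}_1(\mathcal{T}_h)$,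 and $\mathbf J_h^m=\rho_{\mathrm{dif}}M(\Pi^h_1\phi^m)\Pi_1(\nabla\mu^m)$, find $\mathbf u^{m+1}\in\mathcal{U}_h$, $p^{m+1}\in\mathcal{P}_h$ with $\int_\Omega p^{m+1}=0$, $\phi^{m+1}\in\mathbb{P}^{\mathrm{disc}}_0(\mathcal{T}_h)$, $\mu^{m+1}\in\mathbb{P}^{\mathrm{cont}}_1(\mathcal{T}_h)$ such that, for all $\overline{\mathbf u}\in\mathcal{U}_h$, $\overline p\in\mathcal{P}_h$, $\overline\phi\in\mathbb{P}^{\mathrm{disc}}_0(\mathcal{T}_h)$, $\overline\mu\in\mathbb{P}^{\mathrm{cont}}_1(\mathcal{T}_h)$: (S1) $(\rho(\Pi^h_1\phi^m)\delta_t\mathbf u^{m+1},\overline{\mathbf u})+([(\rho(\Pi^h_1\phi^m)\mathbf u^m-\mathbf J^m_h)\cdot\nabla]\mathbf u^{m+1},\overline{\mathbf u})+2(\eta(\phi^m)\mathbf D\mathbf u^{m+1},\mathbf D\overline{\mathbf u})-(p^{m+1},\nabla\cdot\overline{\mathbf u})+c_h(\phi^{m+1},\Pi_0\mu^{m+1},\overline{\mathbf u})+s_h^1(\mathbf u^{m+1},\mathbf u^m,\Pi^h_1\phi^{m+1},\Pi^h_1\phi^m,\mu^m,\overline{\mathbf u})+s_h^2(\mathbf u^{m+1},\phi^{m+1},\Pi_0\mu^{m+1},\overline{\mathbf u})=0$; (S2) $(\nabla\cdot\mathbf u^{m+1},\overline p)=0$; (S3) $(\delta_t\phi^{m+1},\overline\phi)+a_h^{\mathrm{upw}}(\mathbf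 u^{m+1};\phi^{m+1},\overline\phi)+b_h^{\mathrm{upw}}(-\nabla^0_{\mathbf n}\mu^{m+1};M(\phi^{m+1}),\overline\phi)=0$; (S4) $\lambda\varepsilon(\nabla\Pi^h_1\phi^{m+1},\nabla\overline\mu)+\frac\lambda\varepsilon(f(\Pi^h_1\phi^{m+1},\Pi^h_1\phi^m),\overline\mu)-(\mu^{m+1},\overline\mu)_h=0$. *)

theory Defs
  imports "HOL-Analysis.Analysis"
begin

section \<open>Sobolev spaces\<close>

text \<open>
  Functions on a domain are total functions on \<^typ>\<open>real^'d\<close>; only their values on the domain
  (up to null sets, where the notion at hand is an \<open>L\<^sup>2\<close> notion) are ever used.
  As in Brezis' textbook, the test functions for weak derivatives and for
  \<open>H\<^sup>1\<^sub>0\<close> are the compactly supported \<open>C\<^sup>1\<close> functions.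
\<close>

definition L2_space :: "(real^'d) set \<Rightarrow> (real^'d \<Rightarrow> 'b::euclidean_space) set" where
  "L2_space S = {v. v \<in> borel_measurable (lebesgue_on S) \<and>
                    integrable (lebesgue_on S) (\<lambda>x. (norm (v x))\<^sup>2)}"

definition L2_prod :: "(real^'d) set \<Rightarrow> (real^'d \<Rightarrow> 'b::real_inner) \<Rightarrow> (real^'d \<Rightarrow> 'b) \<Rightarrow> real" where
  "L2_prod S v w = integral\<^sup>L (lebesgue_on S) (\<lambda>x. v x \<bullet> w x)"

definition classical_grad :: "(real^'d \<Rightarrow> real) \<Rightarrow> real^'d \<Rightarrow> real^'d" where
  "classical_grad v x = (\<chi> i. frechet_derivative v (at x) (axis i 1))"

definition test_functions :: "(real^'d) set \<Rightarrow> (real^'d \<Rightarrow> real) set" where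
  "test_functions S = {\<psi>. (\<forall>x. \<psi> differentiable at x) \<and> continuous_on UNIV (classical_grad \<psi>) \<and>
      compact (closure {x. \<psi> x \<noteq> 0}) \<and> closure {x. \<psi> x \<noteq> 0} \<subseteq> S}"

text \<open>\<open>v\<close> belongs to \<open>H\<^sup>1(S)\<close> and \<open>g\<close> is (a representative of) its weak gradient.\<close>

definition H1_with_grad :: "(real^'d) set \<Rightarrow> (real^'d \<Rightarrow> real) \<Rightarrow> (real^'d \<Rightarrow> real^'d) \<Rightarrow> bool" where
  "H1_with_grad S v g \<longleftrightarrow> v \<in> L2_space S \<and> g \<in> L2_space S \<and>
     (\<forall>\<psi>\<in>test_functions S. \<forall>i.
        integral\<^sup>L (lebesgue_on S) (\<lambda>x. v x * classical_grad \<psi> x $ i) =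
        - integral\<^sup>L (lebesgue_on S) (\<lambda>x. g x $ i * \<psi> x))"

text \<open>The closure of the test functions in the \<open>H\<^sup>1\<close> norm.\<close>

definition H10 :: "(real^'d) set \<Rightarrow> (real^'d \<Rightarrow> real) set" where
  "H10 S = {v. \<exists>g. H1_with_grad S v g \<and>
     (\<exists>\<psi>. (\<forall>n. \<psi> n \<in> test_functions S) \<and>
        (\<lambda>n::nat. integral\<^sup>L (lebesgue_on S)
            (\<lambda>x. (\<psi> n x - v x)\<^sup>2 + (norm (classical_grad (\<psi> n) x - g x))\<^sup>2)) \<longlonglongrightarrow> 0)}"


section \<open>Domain and mesh\<close>

definition polyhedral_domain :: "(real^'d) set \<Rightarrow> bool" where
  "polyhedral_domain \<Omega> \<longleftrightarrow> open \<Omega> \<and> connected \<Omega> \<and> bounded \<Omega> \<and> \<Omega> \<noteq> {} \<and>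
     (\<exists>F. finite F \<and> (\<forall>f\<in>F. polytope f \<and> aff_dim f = int CARD('d) - 1) \<and> frontier \<Omega> = \<Union>F)"

definition vertices :: "(real^'d) set \<Rightarrow> (real^'d) set" where
  "vertices K = {x. x extreme_point_of K}"

definition barycenter :: "(real^'d) set \<Rightarrow> real^'d" where
  "barycenter K = (1 / real (card (vertices K))) *\<^sub>R (\<Sum>x\<in>vertices K. x)"

definition vol :: "(real^'d) set \<Rightarrow> real" where
  "vol K = measure lebesgue K"

definition simplicial_mesh :: "(real^'d) set \<Rightarrow> (real^'d) set set \<Rightarrow> bool" where
  "simplicial_mesh \<Omega> T \<longleftrightarrow> triangulation T \<and> (\<forall>K\<in>T. int CARD('d) simplex K) \<and> \<Union>T = closure \<Omega>"

definition inradius :: "(real^'d) set \<Rightarrow> real" where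
  "inradius K = Sup {r. 0 \<le> r \<and> (\<exists>c. cball c r \<subseteq> K)}"

definition shape_regular :: "real \<Rightarrow> (real^'d) set set \<Rightarrow> bool" where
  "shape_regular \<sigma> T \<longleftrightarrow> (\<forall>K\<in>T. diameter K \<le> \<sigma> * inradius K)"

definition interior_edges :: "(real^'d) set set \<Rightarrow> (real^'d) set set" where
  "interior_edges T = {e. (int CARD('d) - 1) simplex e \<and> (\<exists>K\<in>T. \<exists>L\<in>T. K \<noteq> L \<and> e = K \<inter> L)}"

definition orthogonal_barycenters :: "(real^'d) set set \<Rightarrow> bool" where
  "orthogonal_barycenters T \<longleftrightarrow>
     (\<forall>K\<in>T. \<forall>L\<in>T. K \<noteq> L \<longrightarrow> K \<inter> L \<in> interior_edges T \<longrightarrow>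
        (\<forall>x\<in>K \<inter> L. \<forall>y\<in>K \<inter> L. (barycenter L - barycenter K) \<bullet> (x - y) = 0))"

definition edge_normals :: "(real^'d) set set \<Rightarrow> ((real^'d) set \<Rightarrow> real^'d) \<Rightarrow> bool" where
  "edge_normals T nrm \<longleftrightarrow>
     (\<forall>e\<in>interior_edges T. norm (nrm e) = 1 \<and> (\<forall>x\<in>e. \<forall>y\<in>e. nrm e \<bullet> (x - y) = 0))"

text \<open>For \<open>e = K \<inter> L\<close>, \<open>elem_K\<close> is the element to which \<open>nrm e\<close> is exterior and
  \<open>elem_L\<close> the one into which it points.\<close>

definition elem_K :: "(real^'d) set set \<Rightarrow> ((real^'d) set \<Rightarrow> real^'d) \<Rightarrow> (real^'d) set \<Rightarrow> (real^'d) set" where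
  "elem_K T nrm e = (THE K. K \<in> T \<and> e \<subseteq> K \<and> (\<forall>x\<in>K. \<forall>y\<in>e. nrm e \<bullet> (x - y) \<le> 0))"

definition elem_L :: "(real^'d) set set \<Rightarrow> ((real^'d) set \<Rightarrow> real^'d) \<Rightarrow> (real^'d) set \<Rightarrow> (real^'d) set" where
  "elem_L T nrm e = (THE L. L \<in> T \<and> e \<subseteq> L \<and> (\<forall>x\<in>L. \<forall>y\<in>e. nrm e \<bullet> (x - y) \<ge> 0))"

definition edge_dist :: "(real^'d) set set \<Rightarrow> ((real^'d) set \<Rightarrow> real^'d) \<Rightarrow> (real^'d) set \<Rightarrow> real" where
  "edge_dist T nrm e = dist (barycenter (elem_K T nrm e)) (barycenter (elem_L T nrm e))"

text \<open>
  Surface integral over the flat face \<open>e\<close> with unit normal \<open>n\<close>: by Fubini, the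
  \<open>(d-1)\<close>-dimensional surface measure of \<open>e\<close> is the image of Lebesgue measure on the right
  prism \<open>e + [0,1] n\<close> of height one under the orthogonal projection onto \<open>e\<close>
  (which on this prism is the closest-point map of \<open>e\<close>).
\<close>

definition face_integral :: "real^'d \<Rightarrow> (real^'d) set \<Rightarrow> (real^'d \<Rightarrow> real) \<Rightarrow> real" where
  "face_integral n e g =
     integral\<^sup>L (lebesgue_on {y + t *\<^sub>R n | y t. y \<in> e \<and> 0 \<le> t \<and> t \<le> 1}) (\<lambda>x. g (closest_point e x))"

text \<open>The trace on the boundary of \<open>K\<close> of the restriction of \<open>v\<close> to \<open>K\<close>.\<close>

definition trace_on :: "(real^'d) set \<Rightarrow> (real^'d \<Rightarrow> real) \<Rightarrow> real^'d \<Rightarrow> real" where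
  "trace_on K v x = Lim (at x within interior K) v"

definition edge_avg ::
  "(real^'d) set set \<Rightarrow> ((real^'d) set \<Rightarrow> real^'d) \<Rightarrow> (real^'d) set \<Rightarrow> (real^'d \<Rightarrow> real) \<Rightarrow> real^'d \<Rightarrow> real" where
  "edge_avg T nrm e v x = (trace_on (elem_K T nrm e) v x + trace_on (elem_L T nrm e) v x) / 2"

definition edge_jump ::
  "(real^'d) set set \<Rightarrow> ((real^'d) set \<Rightarrow> real^'d) \<Rightarrow> (real^'d) set \<Rightarrow> (real^'d \<Rightarrow> real) \<Rightarrow> real^'d \<Rightarrow> real" where
  "edge_jump T nrm e v x = trace_on (elem_K T nrm e) v x - trace_on (elem_L T nrm e) v x"


section \<open>Elementwise differential operators\<close>

text \<open>
  The elementwise gradient is the weak gradient on the union of the open elements. It is determined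
  up to a null set, agrees with the classical gradient of a piecewise polynomial and with the
  weak gradient of a function in \<open>H\<^sup>1(\<Omega>)\<close>, and only occurs under volume integrals.
\<close>

definition elem_grad :: "(real^'d) set set \<Rightarrow> (real^'d \<Rightarrow> real) \<Rightarrow> real^'d \<Rightarrow> real^'d" where
  "elem_grad T v = (SOME g. H1_with_grad (\<Union>K\<in>T. interior K) v g)"

text \<open>Row \<open>i\<close>, column \<open>j\<close> of \<open>elem_vgrad T u x\<close> is the \<open>j\<close>-th partial derivative of \<open>u\<^sub>i\<close>.\<close>

definition elem_vgrad :: "(real^'d) set set \<Rightarrow> (real^'d \<Rightarrow> real^'d) \<Rightarrow> real^'d \<Rightarrow> real^'d^'d" where
  "elem_vgrad T u x = (\<chi> i. elem_grad T (\<lambda>y. u y $ i) x)"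

definition elem_div :: "(real^'d) set set \<Rightarrow> (real^'d \<Rightarrow> real^'d) \<Rightarrow> real^'d \<Rightarrow> real" where
  "elem_div T u x = (\<Sum>i\<in>UNIV. elem_vgrad T u x $ i $ i)"

definition elem_symgrad :: "(real^'d) set set \<Rightarrow> (real^'d \<Rightarrow> real^'d) \<Rightarrow> real^'d \<Rightarrow> real^'d^'d" where
  "elem_symgrad T u x = (1/2) *\<^sub>R (elem_vgrad T u x + transpose (elem_vgrad T u x))"


section \<open>Discrete spaces and projections\<close>

definition polys :: "nat \<Rightarrow> (real^'d \<Rightarrow> real) set" where
  "polys k = {p. \<exists>c. p = (\<lambda>x. \<Sum>\<alpha>\<in>{\<alpha>::'d \<Rightarrow> nat. (\<Sum>i\<in>UNIV. \<alpha> i) \<le> k}. c \<alpha> * (\<Prod>i\<in>UNIV. x $ i ^ \<alpha> i))}"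

text \<open>The values of a discontinuous function on the mesh skeleton, a null set, are left free.\<close>

definition Pdisc :: "nat \<Rightarrow> (real^'d) set set \<Rightarrow> (real^'d \<Rightarrow> real) set" where
  "Pdisc k T = {v. \<forall>K\<in>T. \<exists>p\<in>polys k. \<forall>x\<in>interior K. v x = p x}"

definition Pcont :: "nat \<Rightarrow> (real^'d) set \<Rightarrow> (real^'d) set set \<Rightarrow> (real^'d \<Rightarrow> real) set" where
  "Pcont k \<Omega> T = {v \<in> Pdisc k T. continuous_on (closure \<Omega>) v}"

definition Pi0 :: "(real^'d) set \<Rightarrow> (real^'d) set set \<Rightarrow> (real^'d \<Rightarrow> real) \<Rightarrow> real^'d \<Rightarrow> real" where
  "Pi0 \<Omega> T g = (SOME v. v \<in> Pdisc 0 T \<and> (\<forall>w\<in>Pdisc 0 T. L2_prod \<Omega> v w = L2_prod \<Omega> g w))"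

definition Pi1 :: "(real^'d) set \<Rightarrow> (real^'d) set set \<Rightarrow> (real^'d \<Rightarrow> real) \<Rightarrow> real^'d \<Rightarrow> real" where
  "Pi1 \<Omega> T g = (SOME v. v \<in> Pcont 1 \<Omega> T \<and> (\<forall>w\<in>Pcont 1 \<Omega> T. L2_prod \<Omega> v w = L2_prod \<Omega> g w))"

definition Pi1_vec :: "(real^'d) set \<Rightarrow> (real^'d) set set \<Rightarrow> (real^'d \<Rightarrow> real^'d) \<Rightarrow> real^'d \<Rightarrow> real^'d" where
  "Pi1_vec \<Omega> T g x = (\<chi> i. Pi1 \<Omega> T (\<lambda>y. g y $ i) x)"

definition lumped_prod :: "(real^'d) set set \<Rightarrow> (real^'d \<Rightarrow> real) \<Rightarrow> (real^'d \<Rightarrow> real) \<Rightarrow> real" where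
  "lumped_prod T v w =
     1 / (real CARD('d) + 1) * (\<Sum>K\<in>T. vol K * (\<Sum>x\<in>vertices K. v x * w x))"

definition Pi1h :: "(real^'d) set \<Rightarrow> (real^'d) set set \<Rightarrow> (real^'d \<Rightarrow> real) \<Rightarrow> real^'d \<Rightarrow> real" where
  "Pi1h \<Omega> T g = (SOME v. v \<in> Pcont 1 \<Omega> T \<and> (\<forall>w\<in>Pcont 1 \<Omega> T. lumped_prod T v w = L2_prod \<Omega> g w))"

text \<open>
  Linear function spaces that are finite-dimensional up to equality almost everywhere; this is the
  dimension of the corresponding subspace of \<open>L\<^sup>2(\<Omega>)\<close>, and lets such a space contain all
  representatives of its members.
\<close>

definition fin_dim_space :: "(real^'d) set \<Rightarrow> (real^'d \<Rightarrow> 'b::real_vector) set \<Rightarrow> bool" where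
  "fin_dim_space \<Omega> V \<longleftrightarrow> (\<lambda>x. 0) \<in> V \<and> (\<forall>v\<in>V. \<forall>w\<in>V. (\<lambda>x. v x + w x) \<in> V) \<and>
     (\<forall>a. \<forall>v\<in>V. (\<lambda>x. a *\<^sub>R v x) \<in> V) \<and>
     (\<exists>B. finite B \<and> B \<subseteq> V \<and>
        (\<forall>v\<in>V. \<exists>c. AE x in lebesgue_on \<Omega>. v x = (\<Sum>b\<in>B. c b *\<^sub>R b x)))"

definition L2_norm :: "(real^'d) set \<Rightarrow> (real^'d \<Rightarrow> 'b::real_inner) \<Rightarrow> real" where
  "L2_norm S v = sqrt (L2_prod S v v)"

definition H1_norm_vec :: "(real^'d) set \<Rightarrow> (real^'d) set set \<Rightarrow> (real^'d \<Rightarrow> real^'d) \<Rightarrow> real" where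
  "H1_norm_vec \<Omega> T u = sqrt ((L2_norm \<Omega> u)\<^sup>2 + (L2_norm \<Omega> (elem_vgrad T u))\<^sup>2)"

definition inf_sup_compatible ::
  "(real^'d) set \<Rightarrow> (real^'d) set set \<Rightarrow> (real^'d \<Rightarrow> real^'d) set \<Rightarrow> (real^'d \<Rightarrow> real) set \<Rightarrow> bool" where
  "inf_sup_compatible \<Omega> T U P \<longleftrightarrow>
     (\<exists>\<beta>>0. \<forall>p\<in>P. integral\<^sup>L (lebesgue_on \<Omega>) p = 0 \<longrightarrow>
        ereal (\<beta> * L2_norm \<Omega> p) \<le>
        (SUP u\<in>{u\<in>U. H1_norm_vec \<Omega> T u \<noteq> 0}. ereal (L2_prod \<Omega> p (elem_div T u) / H1_norm_vec \<Omega> T u)))"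

definition velocity_pressure_pair ::
  "(real^'d) set \<Rightarrow> (real^'d) set set \<Rightarrow> (real^'d \<Rightarrow> real^'d) set \<Rightarrow> (real^'d \<Rightarrow> real) set \<Rightarrow> bool" where
  "velocity_pressure_pair \<Omega> T U P \<longleftrightarrow>
     fin_dim_space \<Omega> U \<and> (\<forall>u\<in>U. continuous_on (closure \<Omega>) u \<and> (\<forall>i. (\<lambda>x. u x $ i) \<in> H10 \<Omega>)) \<and>
     fin_dim_space \<Omega> P \<and> P \<subseteq> L2_space \<Omega> \<and> Pdisc 0 T \<subseteq> P \<and>
     inf_sup_compatible \<Omega> T U P"


section \<open>Nonlinearities\<close>

definition pos_part :: "real \<Rightarrow> real" where
  "pos_part v = max v 0"

definition neg_part :: "real \<Rightarrow> real" where
  "neg_part v = - min v 0"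

definition rho_dif :: "real \<Rightarrow> real \<Rightarrow> real" where
  "rho_dif \<rho>1 \<rho>2 = (\<rho>2 - \<rho>1) / 2"

definition rho :: "real \<Rightarrow> real \<Rightarrow> real \<Rightarrow> real" where
  "rho \<rho>1 \<rho>2 \<phi> = (\<rho>1 + \<rho>2) / 2 + rho_dif \<rho>1 \<rho>2 * \<phi>"

definition mob :: "real \<Rightarrow> real" where
  "mob \<phi> = pos_part (1 - \<phi>\<^sup>2)"

definition mob_up :: "real \<Rightarrow> real" where
  "mob_up z = (if z \<le> 0 then mob z else mob 0)"

definition mob_down :: "real \<Rightarrow> real" where
  "mob_down z = (if z \<le> 0 then 0 else mob z - mob 0)"

definition F_i :: "real \<Rightarrow> real" where
  "F_i \<phi> = \<phi>\<^sup>2 + 1/4"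

definition F_e :: "real \<Rightarrow> real" where
  "F_e \<phi> = 1/4 * \<phi>^4 - 3/2 * \<phi>\<^sup>2"

definition f_pot :: "real \<Rightarrow> real \<Rightarrow> real" where
  "f_pot \<phi>1 \<phi>0 = deriv F_i \<phi>1 + deriv F_e \<phi>0"


section \<open>Forms\<close>

definition c_h where
  "c_h \<Omega> T nrm \<phi> \<mu> (v :: real^'d \<Rightarrow> real^'d) =
     - L2_prod \<Omega> (elem_div T (\<lambda>x. \<phi> x *\<^sub>R v x)) \<mu>
     - (\<Sum>e\<in>interior_edges T. face_integral (nrm e) e
          (\<lambda>x. (v x \<bullet> nrm e) * edge_avg T nrm e \<phi> x * edge_jump T nrm e \<mu> x))"

definition a_upw where
  "a_upw T nrm (u :: real^'d \<Rightarrow> real^'d) \<phi> \<psi> =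
     (\<Sum>e\<in>interior_edges T. face_integral (nrm e) e
        (\<lambda>x. (pos_part (u x \<bullet> nrm e) * trace_on (elem_K T nrm e) \<phi> x
              - neg_part (u x \<bullet> nrm e) * trace_on (elem_L T nrm e) \<phi> x) * edge_jump T nrm e \<psi> x))"

text \<open>\<open>b_upw \<Omega> T nrm \<mu> \<phi> \<psi>\<close> is the form with flux \<open>-\<nabla>\<^sup>0\<^sub>n \<mu>\<close>, mobility \<open>M(\<phi>)\<close> and
  test function \<open>\<psi>\<close>.\<close>

definition b_upw where
  "b_upw \<Omega> T nrm \<mu> (\<phi> :: real^'d \<Rightarrow> real) \<psi> =
     (\<Sum>e\<in>interior_edges T. 1 / edge_dist T nrm e * face_integral (nrm e) e
        (\<lambda>x. let j = edge_jump T nrm e (Pi0 \<Omega> T \<mu>) x;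
                 \<phi>K = trace_on (elem_K T nrm e) \<phi> x;
                 \<phi>L = trace_on (elem_L T nrm e) \<phi> x
             in (pos_part j * pos_part (mob_up \<phi>K + mob_down \<phi>L)
                 - neg_part j * pos_part (mob_up \<phi>L + mob_down \<phi>K)) * edge_jump T nrm e \<psi> x))"

definition s1_h where
  "s1_h \<rho>1 \<rho>2 \<Delta>t \<Omega> T (u1 :: real^'d \<Rightarrow> real^'d) u0 \<phi>1 \<phi>0 \<mu> v =
     1/2 * (L2_prod \<Omega> (\<lambda>x. (rho \<rho>1 \<rho>2 (\<phi>1 x) - rho \<rho>1 \<rho>2 (\<phi>0 x)) / \<Delta>t) (\<lambda>x. u1 x \<bullet> v x)
            - L2_prod \<Omega>
                (\<lambda>x. rho \<rho>1 \<rho>2 (\<phi>0 x) *\<^sub>R u0 x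
                     - (rho_dif \<rho>1 \<rho>2 * mob (\<phi>0 x)) *\<^sub>R Pi1_vec \<Omega> T (elem_grad T \<mu>) x)
                (elem_grad T (\<lambda>x. u1 x \<bullet> v x)))"

definition s2_h where
  "s2_h T nrm (u :: real^'d \<Rightarrow> real^'d) \<phi> \<mu> v =
     - 1/2 * (\<Sum>e\<in>interior_edges T. face_integral (nrm e) e
        (\<lambda>x. (v x \<bullet> nrm e) * sgn (u x \<bullet> nrm e) * edge_jump T nrm e \<phi> x * edge_jump T nrm e \<mu> x))"


section \<open>One time step of the scheme\<close>

text \<open>
  Superscript-free names: \<open>u0, \<phi>0, \<mu>0\<close> are the data at time level \<open>m\<close> and
  \<open>u1, p1, \<phi>1, \<mu>1\<close> the unknowns at level \<open>m+1\<close>.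
\<close>

definition momentum_eq where
  "momentum_eq \<rho>1 \<rho>2 \<Delta>t \<eta> \<Omega> T nrm U u0 \<phi>0 \<mu>0 (u1 :: real^'d \<Rightarrow> real^'d) p1 \<phi>1 \<mu>1 \<longleftrightarrow>
     (let \<Phi>0 = Pi1h \<Omega> T \<phi>0; \<Phi>1 = Pi1h \<Omega> T \<phi>1;
          J = (\<lambda>x. (rho_dif \<rho>1 \<rho>2 * mob (\<Phi>0 x)) *\<^sub>R Pi1_vec \<Omega> T (elem_grad T \<mu>0) x)
      in \<forall>v\<in>U.
        L2_prod \<Omega> (\<lambda>x. rho \<rho>1 \<rho>2 (\<Phi>0 x) *\<^sub>R ((u1 x - u0 x) /\<^sub>R \<Delta>t)) v
        + L2_prod \<Omega> (\<lambda>x. elem_vgrad T u1 x *v (rho \<rho>1 \<rho>2 (\<Phi>0 x) *\<^sub>R u0 x - J x)) v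
        + 2 * L2_prod \<Omega> (\<lambda>x. \<eta> (\<phi>0 x) *\<^sub>R elem_symgrad T u1 x) (elem_symgrad T v)
        - L2_prod \<Omega> p1 (elem_div T v)
        + c_h \<Omega> T nrm \<phi>1 (Pi0 \<Omega> T \<mu>1) v
        + s1_h \<rho>1 \<rho>2 \<Delta>t \<Omega> T u1 u0 \<Phi>1 \<Phi>0 \<mu>0 v
        + s2_h T nrm u1 \<phi>1 (Pi0 \<Omega> T \<mu>1) v = 0)"

definition incompressibility_eq where
  "incompressibility_eq \<Omega> T P (u1 :: real^'d \<Rightarrow> real^'d) \<longleftrightarrow>
     (\<forall>q\<in>P. L2_prod \<Omega> (elem_div T u1) q = 0)"

definition phase_eq where
  "phase_eq \<Delta>t \<Omega> T nrm \<phi>0 (u1 :: real^'d \<Rightarrow> real^'d) \<phi>1 \<mu>1 \<longleftrightarrow>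
     (\<forall>\<psi>\<in>Pdisc 0 T.
        L2_prod \<Omega> (\<lambda>x. (\<phi>1 x - \<phi>0 x) / \<Delta>t) \<psi> + a_upw T nrm u1 \<phi>1 \<psi> + b_upw \<Omega> T nrm \<mu>1 \<phi>1 \<psi> = 0)"

definition potential_eq where
  "potential_eq lam \<epsilon> \<Omega> T (\<phi>0 :: real^'d \<Rightarrow> real) \<phi>1 \<mu>1 \<longleftrightarrow>
     (\<forall>w\<in>Pcont 1 \<Omega> T.
        lam * \<epsilon> * L2_prod \<Omega> (elem_grad T (Pi1h \<Omega> T \<phi>1)) (elem_grad T w)
        + lam / \<epsilon> * L2_prod \<Omega> (\<lambda>x. f_pot (Pi1h \<Omega> T \<phi>1 x) (Pi1h \<Omega> T \<phi>0 x)) w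
        - lumped_prod T \<mu>1 w = 0)"

definition scheme_solution ::
  "real \<Rightarrow> real \<Rightarrow> real \<Rightarrow> real \<Rightarrow> real \<Rightarrow> (real \<Rightarrow> real) \<Rightarrow>
   (real^'d) set \<Rightarrow> (real^'d) set set \<Rightarrow> ((real^'d) set \<Rightarrow> real^'d) \<Rightarrow>
   (real^'d \<Rightarrow> real^'d) set \<Rightarrow> (real^'d \<Rightarrow> real) set \<Rightarrow>
   (real^'d \<Rightarrow> real^'d) \<Rightarrow> (real^'d \<Rightarrow> real) \<Rightarrow> (real^'d \<Rightarrow> real) \<Rightarrow>
   (real^'d \<Rightarrow> real^'d) \<Rightarrow> (real^'d \<Rightarrow> real) \<Rightarrow> (real^'d \<Rightarrow> real) \<Rightarrow> (real^'d \<Rightarrow> real) \<Rightarrow> bool" where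
  "scheme_solution \<rho>1 \<rho>2 lam \<epsilon> \<Delta>t \<eta> \<Omega> T nrm U P u0 \<phi>0 \<mu>0 u1 p1 \<phi>1 \<mu>1 \<longleftrightarrow>
     u1 \<in> U \<and> p1 \<in> P \<and> integral\<^sup>L (lebesgue_on \<Omega>) p1 = 0 \<and> \<phi>1 \<in> Pdisc 0 T \<and> \<mu>1 \<in> Pcont 1 \<Omega> T \<and>
     momentum_eq \<rho>1 \<rho>2 \<Delta>t \<eta> \<Omega> T nrm U u0 \<phi>0 \<mu>0 u1 p1 \<phi>1 \<mu>1 \<and>
     incompressibility_eq \<Omega> T P u1 \<and>
     phase_eq \<Delta>t \<Omega> T nrm \<phi>0 u1 \<phi>1 \<mu>1 \<and>
     potential_eq lam \<epsilon> \<Omega> T \<phi>0 \<phi>1 \<mu>1"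

end

theory Submission
  imports Defs "HOL-Real_Asymp.Real_Asymp"
begin

text \<open>
  Test the transport equation with the indicator of the element \<open>K\<close> on which the piecewise constant
  \<open>\<phi>\<close> is largest, and suppose that its value there exceeds \<open>1\<close>. The upwind convection term is at
  least the value on \<open>K\<close> times the flux of the velocity through the interior faces of \<open>K\<close>, which
  vanishes by discrete incompressibility; the mobility term is nonnegative since its degenerate upwind
  mobility switches off the inflow. Hence the value on \<open>K\<close> does not exceed its value at the previous
  time, a contradiction; the minimum is treated alike. The mass-lumped projection has weighted averages of
  \<open>\<phi>\<close> as nodal values, so it inherits the bounds.

  The analytic core is the divergence theorem on a simplex for a continuous function in \<open>H\<^sup>1\<^sub>0(\<Omega>)\<close>.
  For each vertex \<open>c\<close> the field \<open>x - c\<close> is tangential to the facets through \<open>c\<close>, so differentiating the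
  dilations about \<open>c\<close> expresses the integral over the opposite facet by integrals over the
  simplex that are continuous in \<open>H\<^sup>1\<close>. A constant field is a combination of the fields \<open>x - c\<close>, with the
  gradients of the barycentric coordinates as coefficients.
\<close>


section \<open>Barycentric coordinates\<close>

text \<open>The velocity is merely continuous with components in \<open>H10\<close>, and convergence
  of gradients in L2 does not by itself control surface integrals. The limit is therefore never
  taken in a flux: the volume functional attached to the field x - c passes to the limit, and only
  then is it converted into a facet integral of the continuous limit. As
  \<open>face_integral\<close> is defined by a prism of height one, this conversion compares a thin
  layer of the simplex with that prism. No boundary values of the velocity are ever evaluated. A
  facet outside \<open>interior_edges T\<close> turns out to be disjoint from \<Omega>, so every
  approximating test function vanishes near it, and its contribution is zero before the limit is
  taken. \<open>elem_grad\<close> is an arbitrary representative on the union of the open elements,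
  which agrees with \<Omega> only up to a null set. Gradients are therefore compared solely through
  their integrals over one element.\<close>

locale full_simplex =
  fixes C :: "'a::euclidean_space set"
  assumes indep: "\<not> affine_dependent C" and card_C: "card C = DIM('a) + 1"
begin

lemma finite_C [simp]: "finite C"
  using indep aff_independent_finite by blast

lemma affine_hull_C: "affine hull C = UNIV"
proof -
  have "aff_dim C = int DIM('a)"
    using aff_dim_affine_independent[OF indep] card_C by simp
  then show ?thesis by (simp add: aff_dim_eq_full)
qed

text \<open>The differences to one fixed vertex are linearly independent, so the prescribed values
  extend to a linear functional, which is then represented by an inner product.\<close>

lemma bary_exists:
  fixes h :: "'a \<Rightarrow> real"
  shows "\<exists>g b. \<forall>v\<in>C. g \<bullet> v + b = h v"
proof -
  obtain a where a: "a \<in> C" using card_C by fastforce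
  have "\<not> affine_dependent (insert a (C - {a}))" using indep a by (simp add: insert_absorb)
  then have "\<not> dependent ((\<lambda>x. - a + x) ` (C - {a}))"
    using affine_dependent_iff_dependent[of a "C - {a}"] by blast
  then obtain f where f: "linear f"
      "\<forall>v\<in>(\<lambda>x. - a + x) ` (C - {a}). f v = h (v + a) - h a"
    using linear_independent_extend[where f = "\<lambda>v. h (v + a) - h a"] by blast
  define g where "g = (\<Sum>b\<in>Basis. f b *\<^sub>R b)"
  have gf: "g \<bullet> x = f x" for x
  proof -
    have "f x = f (\<Sum>b\<in>Basis. (x \<bullet> b) *\<^sub>R b)" by (simp add: euclidean_representation)
    also have "\<dots> = (\<Sum>b\<in>Basis. (x \<bullet> b) * f b)"
      by (simp add: linear_sum[OF f(1)] linear_cmul[OF f(1)])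
    also have "\<dots> = g \<bullet> x"
      unfolding g_def inner_sum_left by (simp add: inner_commute[of _ x] mult.commute)
    finally show ?thesis by simp
  qed
  have "g \<bullet> v + (h a - g \<bullet> a) = h v" if "v \<in> C" for v
  proof (cases "v = a")
    case False
    then have "- a + v \<in> (\<lambda>x. - a + x) ` (C - {a})" using that by blast
    then have "f (v - a) = h v - h a" using bspec[OF f(2)] by fastforce
    then have "g \<bullet> (v - a) = h v - h a" by (simp only: gf)
    then show ?thesis by (simp add: inner_diff_right)
  qed simp
  then show ?thesis by blast
qed

text \<open>The constant gradient of the barycentric coordinate of \<open>c\<close>. The matching
  offset is selected afterwards, in \<open>bary\<close>.\<close>

definition bgrad :: "'a \<Rightarrow> 'a" where
  "bgrad c = (SOME g. \<exists>b. \<forall>v\<in>C. g \<bullet> v + b = (if v = c then 1 else 0))"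

definition bary :: "'a \<Rightarrow> 'a \<Rightarrow> real" where
  "bary c x = bgrad c \<bullet> x + (SOME b. \<forall>v\<in>C. bgrad c \<bullet> v + b = (if v = c then 1 else 0))"

lemma bary_vertex: "v \<in> C \<Longrightarrow> bary c v = (if v = c then 1 else 0)"
proof -
  have "\<exists>g b. \<forall>v\<in>C. g \<bullet> v + b = (if v = c then 1 else 0)" by (rule bary_exists)
  then have "\<exists>b. \<forall>v\<in>C. bgrad c \<bullet> v + b = (if v = c then 1 else 0)"
    unfolding bgrad_def by (rule someI_ex)
  then have "\<forall>v\<in>C. bgrad c \<bullet> v + (SOME b. \<forall>v\<in>C. bgrad c \<bullet> v + b = (if v = c then 1 else 0))
      = (if v = c then 1 else 0)" by (rule someI_ex)
  then show "v \<in> C \<Longrightarrow> ?thesis" by (simp add: bary_def)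
qed

lemma bary_diff: "bary c x - bary c y = bgrad c \<bullet> (x - y)"
  by (simp add: bary_def inner_diff_right)

lemma bary_add: "bary c (x + v) = bary c x + bgrad c \<bullet> v"
  by (simp add: bary_def inner_add_right)

lemma bary_affine: "sum u S = 1 \<Longrightarrow> bary c (\<Sum>v\<in>S. u v *\<^sub>R v) = (\<Sum>v\<in>S. u v * bary c v)"
  by (simp add: bary_def inner_sum_right algebra_simps sum.distrib flip: sum_distrib_right)

lemma bary_unique:
  assumes "sum u C = 1" "c \<in> C"
  shows "bary c (\<Sum>v\<in>C. u v *\<^sub>R v) = u c"
proof -
  have "bary c (\<Sum>v\<in>C. u v *\<^sub>R v) = (\<Sum>v\<in>C. if v = c then u v else 0)"
    unfolding bary_affine[OF assms(1)] by (rule sum.cong) (auto simp: bary_vertex)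
  then show ?thesis using assms(2) by simp
qed

text \<open>Affine independence together with the maximal number of vertices makes the affine hull
  the whole space, so every point is an affine combination of the vertices.\<close>

lemma bary_representation:
  shows sum_bary: "(\<Sum>c\<in>C. bary c x) = 1" and bary_combination: "(\<Sum>c\<in>C. bary c x *\<^sub>R c) = x"
proof -
  obtain u where u: "sum u C = 1" "(\<Sum>v\<in>C. u v *\<^sub>R v) = x"
    using affine_hull_finite[OF finite_C] affine_hull_C by blast
  have "bary c x = u c" if "c \<in> C" for c using bary_unique[OF u(1) that] u(2) by simp
  then show "(\<Sum>c\<in>C. bary c x) = 1" "(\<Sum>c\<in>C. bary c x *\<^sub>R c) = x" using u by auto
qed

lemma sum_bgrad: "(\<Sum>c\<in>C. bgrad c \<bullet> v) = 0"
  using sum_bary[of v] sum_bary[of 0] unfolding bary_def by (simp add: sum.distrib)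

text \<open>The linear part of \<open>bary_combination\<close>. As the coefficients sum to zero by
  \<open>sum_bgrad\<close>, each \<open>c\<close> may be replaced by c - x, which expresses a
  constant field through the fields tangential to the facets at \<open>c\<close>.\<close>

lemma bgrad_combination: "(\<Sum>c\<in>C. (bgrad c \<bullet> v) *\<^sub>R c) = v"
  using bary_combination[of v] bary_combination[of 0] unfolding bary_def
  by (simp add: sum.distrib scaleR_left_distrib)

lemma mem_hull_iff: "x \<in> convex hull C \<longleftrightarrow> (\<forall>c\<in>C. 0 \<le> bary c x)"
proof
  assume "x \<in> convex hull C"
  then obtain u where u: "\<forall>v\<in>C. 0 \<le> u v" "sum u C = 1" "(\<Sum>v\<in>C. u v *\<^sub>R v) = x"
    unfolding convex_hull_finite[OF finite_C] by blast
  then show "\<forall>c\<in>C. 0 \<le> bary c x" using bary_unique[OF u(2)] by auto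
next
  assume "\<forall>c\<in>C. 0 \<le> bary c x"
  then show "x \<in> convex hull C"
    unfolding convex_hull_finite[OF finite_C] using bary_representation[of x]
    by (intro CollectI exI[of _ "\<lambda>c. bary c x"]) simp
qed

lemma mem_interior_hull_iff: "x \<in> interior (convex hull C) \<longleftrightarrow> (\<forall>c\<in>C. 0 < bary c x)"
proof -
  have eq: "interior (convex hull C) =
     {y. \<exists>u. (\<forall>x\<in>C. 0 < u x) \<and> sum u C = 1 \<and> (\<Sum>x\<in>C. u x *\<^sub>R x) = y}"
    using interior_convex_hull_explicit_minimal[OF indep] card_C by simp
  show ?thesis
  proof
    assume "x \<in> interior (convex hull C)"
    then obtain u where u: "\<forall>v\<in>C. 0 < u v" "sum u C = 1" "(\<Sum>v\<in>C. u v *\<^sub>R v) = x"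
      unfolding eq by blast
    then show "\<forall>c\<in>C. 0 < bary c x" using bary_unique[OF u(2)] by auto
  next
    assume "\<forall>c\<in>C. 0 < bary c x"
    then show "x \<in> interior (convex hull C)"
      unfolding eq using bary_representation[of x]
      by (intro CollectI exI[of _ "\<lambda>c. bary c x"]) simp
  qed
qed

lemma bary_le_1: "x \<in> convex hull C \<Longrightarrow> c \<in> C \<Longrightarrow> bary c x \<le> 1"
  using sum_bary[of x] member_le_sum[of c C "\<lambda>c. bary c x"] by (auto simp: mem_hull_iff)

lemma other_vertex: "\<exists>v\<in>C. v \<noteq> c"
proof (rule ccontr)
  assume "\<not> ?thesis"
  then have "card C \<le> card {c}" by (intro card_mono) auto
  then show False using card_C DIM_positive[where 'a='a] by simp
qed

lemma bgrad_nonzero: "c \<in> C \<Longrightarrow> bgrad c \<noteq> 0"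
proof
  assume c: "c \<in> C" "bgrad c = 0"
  obtain v where "v \<in> C" "v \<noteq> c" using other_vertex by blast
  then show False using bary_vertex[of c c] bary_vertex[of v c] c by (simp add: bary_def)
qed

lemma continuous_on_bary [continuous_intros]: "continuous_on S f \<Longrightarrow> continuous_on S (\<lambda>x. bary c (f x))"
  unfolding bary_def by (intro continuous_intros)

lemma borel_measurable_bary [measurable]: "bary c \<in> borel_measurable borel"
  by (intro borel_measurable_continuous_onI continuous_intros)

lemma compact_hull: "compact (convex hull C)"
  by (simp add: finite_imp_compact_convex_hull)

definition facet :: "'a \<Rightarrow> 'a set" where
  "facet c = convex hull (C - {c})"

lemma mem_facet_iff:
  assumes "c \<in> C"
  shows "x \<in> facet c \<longleftrightarrow> x \<in> convex hull C \<and> bary c x = 0"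
proof
  assume "x \<in> facet c"
  then have x: "x \<in> convex hull (C - {c})" by (simp add: facet_def)
  then obtain u where u: "sum u (C - {c}) = 1" "(\<Sum>v\<in>C-{c}. u v *\<^sub>R v) = x"
    using convex_hull_finite[of "C - {c}"] by auto
  have "bary c x = (\<Sum>v\<in>C-{c}. u v * bary c v)" using bary_affine[OF u(1)] u(2) by simp
  also have "\<dots> = 0" by (intro sum.neutral) (auto simp: bary_vertex)
  finally show "x \<in> convex hull C \<and> bary c x = 0"
    using x hull_mono[of "C - {c}" C convex] by auto
next
  assume x: "x \<in> convex hull C \<and> bary c x = 0"
  have "(\<Sum>v\<in>C-{c}. bary v x) = 1" "(\<Sum>v\<in>C-{c}. bary v x *\<^sub>R v) = x"
    using sum_bary[of x] bary_combination[of x] assms x by (simp_all add: sum_diff1)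
  then show "x \<in> facet c"
    using x unfolding facet_def convex_hull_finite[OF finite_Diff[OF finite_C]] mem_hull_iff
    by (intro CollectI exI[of _ "\<lambda>v. bary v x"]) simp
qed

lemma facet_subset: "facet c \<subseteq> convex hull C"
  unfolding facet_def by (intro hull_mono) auto

lemma compact_facet: "compact (facet c)" and convex_facet: "convex (facet c)"
  unfolding facet_def by (simp_all add: finite_imp_compact_convex_hull)

lemma facet_nonempty: "facet c \<noteq> {}"
  unfolding facet_def using other_vertex by auto

end

lemma simplex_full_simplex:
  assumes "int DIM('a::euclidean_space) simplex (K :: 'a set)"
  obtains C where "full_simplex C" "K = convex hull C"
proof -
  obtain C where "\<not> affine_dependent C" "int (card C) = int DIM('a) + 1" "K = convex hull C"
    using assms by (auto simp: simplex_def)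
  then show ?thesis using that[of C] by (simp add: full_simplex_def)
qed


section \<open>Dilations of a simplex\<close>

lemma lborel_integral_dilation:
  fixes f :: "'a::euclidean_space \<Rightarrow> real"
  assumes [measurable]: "f \<in> borel_measurable borel" and s: "s > 0"
  shows "(\<integral>x. f (c + s *\<^sub>R (x - c)) \<partial>lborel) = (\<integral>x. f x \<partial>lborel) / s ^ DIM('a)"
proof -
  have "(\<integral>x. f x \<partial>lborel)
      = (\<integral>x. f x \<partial>density (distr lborel borel (\<lambda>x. (c - s *\<^sub>R c) + s *\<^sub>R x)) (\<lambda>_. \<bar>s\<bar> ^ DIM('a)))"
    using lborel_affine[of s "c - s *\<^sub>R c"] s by simp
  also have "\<dots> = s ^ DIM('a) * (\<integral>x. f ((c - s *\<^sub>R c) + s *\<^sub>R x) \<partial>lborel)"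
    using s by (subst integral_density) (auto simp: integral_distr)
  finally show ?thesis
    using s by (simp add: field_simps scaleR_diff_right)
qed

lemma lborel_integral_translation:
  fixes f :: "'a::euclidean_space \<Rightarrow> real"
  assumes [measurable]: "f \<in> borel_measurable borel"
  shows "(\<integral>x. f (x + v) \<partial>lborel) = (\<integral>x. f x \<partial>lborel)"
proof -
  have "(\<integral>x. f x \<partial>lborel) = (\<integral>x. f x \<partial>distr lborel borel (\<lambda>x. v + x))"
    by (subst lborel_distr_plus) (rule refl)
  then show ?thesis by (simp add: integral_distr add.commute)
qed

section \<open>Bounds, cut-offs and difference quotients\<close>

lemma lborel_integrable_bounded:
  fixes f :: "'a::euclidean_space \<Rightarrow> real"
  assumes "f \<in> borel_measurable borel" "bounded S" "\<And>x. x \<notin> S \<Longrightarrow> f x = 0" "\<And>x. x \<in> S \<Longrightarrow> \<bar>f x\<bar> \<le> B"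
  shows "integrable lborel f"
proof -
  obtain a b where ab: "S \<subseteq> cbox a b" using bounded_subset_cbox_symmetric[OF assms(2)] by blast
  have "integrable lborel (\<lambda>x. indicator (cbox a b) x *\<^sub>R \<bar>B\<bar>)"
    by (intro integrable_scaleR_left integrable_real_indicator emeasure_lborel_cbox_finite) simp_all
  then show ?thesis
  proof (rule Bochner_Integration.integrable_bound)
    show "f \<in> borel_measurable lborel" using assms(1) by simp
    show "AE x in lborel. norm (f x) \<le> norm (indicator (cbox a b) x *\<^sub>R \<bar>B\<bar>)"
    proof (rule AE_I2)
      fix x show "norm (f x) \<le> norm (indicator (cbox a b) x *\<^sub>R \<bar>B\<bar>)"
        using ab assms(3,4)[of x] by (cases "x \<in> S") (auto simp: indicator_def)
    qed
  qed
qed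

lemma continuous_on_compact_abs_bound:
  fixes f :: "'a::topological_space \<Rightarrow> real"
  assumes "compact S" "continuous_on S f"
  obtains B where "\<And>x. x \<in> S \<Longrightarrow> \<bar>f x\<bar> \<le> B"
proof -
  have "bounded (f ` S)" using compact_continuous_image[OF assms(2,1)] compact_imp_bounded by blast
  then obtain B where "\<forall>y\<in>f ` S. norm y \<le> B" unfolding bounded_iff by blast
  then show ?thesis using that by (simp add: image_iff) blast
qed

lemma gradient_continuous_on:
  assumes "\<And>x. (\<psi> has_derivative (\<lambda>h. g x \<bullet> h)) (at x)"
  shows "continuous_on S \<psi>"
  using assms by (meson continuous_at_imp_continuous_on has_derivative_continuous)

text \<open>The mean value inequality on a convex ball. It supplies the dominating functions for the
  difference quotients in \<open>cone_identity\<close> and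
  \<open>integral_gradient_compact_support\<close>.\<close>

lemma gradient_lipschitz_on_ball:
  fixes \<psi> :: "'a::euclidean_space \<Rightarrow> real"
  assumes der: "\<And>x. (\<psi> has_derivative (\<lambda>h. g x \<bullet> h)) (at x)" and cont: "continuous_on UNIV g"
  obtains L where "0 \<le> L"
    "\<And>x y. x \<in> cball a R \<Longrightarrow> y \<in> cball a R \<Longrightarrow> \<bar>\<psi> x - \<psi> y\<bar> \<le> L * norm (x - y)"
proof -
  have "continuous_on (cball a R) (\<lambda>x. norm (g x))"
    by (intro continuous_intros continuous_on_subset[OF cont]) auto
  then obtain L where "\<And>x. x \<in> cball a R \<Longrightarrow> \<bar>norm (g x)\<bar> \<le> L"
    using continuous_on_compact_abs_bound[OF compact_cball] by blast
  then have L: "\<And>x. x \<in> cball a R \<Longrightarrow> norm (g x) \<le> L" by simp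
  show ?thesis
  proof
    show "\<bar>\<psi> x - \<psi> y\<bar> \<le> \<bar>L\<bar> * norm (x - y)" if "x \<in> cball a R" "y \<in> cball a R" for x y
    proof -
      have "norm (\<psi> x - \<psi> y) \<le> \<bar>L\<bar> * norm (x - y)"
      proof (rule differentiable_bound[OF convex_cball[of a R]])
        show "(\<psi> has_derivative (\<lambda>h. g x \<bullet> h)) (at x within cball a R)" for x
          using der has_derivative_at_withinI by blast
        show "onorm (\<lambda>h. g x \<bullet> h) \<le> \<bar>L\<bar>" if "x \<in> cball a R" for x
        proof (rule onorm_le)
          show "norm (g x \<bullet> h) \<le> \<bar>L\<bar> * norm h" for h
            using order_trans[OF Cauchy_Schwarz_ineq2[of "g x" h] mult_right_mono[of "norm (g x)" "\<bar>L\<bar>" "norm h"]]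
              L[OF that] by simp
        qed
      qed (use that in auto)
      then show ?thesis by simp
    qed
  qed simp
qed

text \<open>Applied to \<open>bary c x / \<delta>\<close> this is a Lipschitz cut-off that vanishes
  on the facet opposite \<open>c\<close> and equals one from barycentric depth \<delta> on.\<close>

definition clamp01 :: "real \<Rightarrow> real" where
  "clamp01 r = max 0 (min 1 r)"

lemma clamp01_lipschitz: "\<bar>clamp01 a - clamp01 b\<bar> \<le> \<bar>a - b\<bar>"
  by (auto simp: clamp01_def)

lemma clamp01_bounds: "0 \<le> clamp01 a" "clamp01 a \<le> 1"
  by (auto simp: clamp01_def)

lemma continuous_on_clamp01 [continuous_intros]:
  "continuous_on S f \<Longrightarrow> continuous_on S (\<lambda>x. clamp01 (f x))"
  unfolding clamp01_def by (intro continuous_intros)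

lemma borel_measurable_clamp01 [measurable]: "clamp01 \<in> borel_measurable borel"
  by (intro borel_measurable_continuous_onI continuous_intros)

lemma clamp01_deriv:
  assumes "0 < r" "r \<noteq> 1"
  shows "(clamp01 has_real_derivative (if r < 1 then 1 else 0)) (at r)"
proof (cases "r < 1")
  case True
  have "(clamp01 has_real_derivative 1) (at r)"
    by (rule has_field_derivative_transform_within_open[of "\<lambda>r. r" 1 r "{0<..<1}"])
       (use True assms in \<open>auto simp: clamp01_def\<close>)
  then show ?thesis using True by simp
next
  case False
  have "(clamp01 has_real_derivative 0) (at r)"
    by (rule has_field_derivative_transform_within_open[of "\<lambda>r. 1" 0 r "{1<..}"])
       (use False assms in \<open>auto simp: clamp01_def\<close>)
  then show ?thesis using False by simp
qed

lemma deriv_imp_difference_quotients: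
  fixes F :: "real \<Rightarrow> real"
  assumes "(F has_real_derivative D) (at a)"
  shows "(\<lambda>n. (F (a + 1 / real (Suc n)) - F a) * real (Suc n)) \<longlonglongrightarrow> D"
proof -
  have 1: "((\<lambda>h. (F (a + h) - F a) / h) \<longlongrightarrow> D) (at 0)" using assms by (simp add: DERIV_def)
  have "filterlim (\<lambda>n. 1 / real (Suc n)) (at 0) sequentially"
    unfolding filterlim_at using LIMSEQ_inverse_real_of_nat
    by (auto simp: inverse_eq_divide eventually_sequentially)
  from filterlim_compose[OF 1 this] show ?thesis by simp
qed

context full_simplex begin

text \<open>Level sets of a nonconstant affine function are hyperplanes. Discarding two of them
  removes the corners of the cut-off and the facet itself.\<close>

lemma AE_bary_ne:
  assumes "c \<in> C"
  shows "AE x in lborel. bary c x \<noteq> r"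
proof -
  obtain b where b: "\<And>x. bary c x = bgrad c \<bullet> x + b" unfolding bary_def by blast
  have "negligible {x. bgrad c \<bullet> x = r - b}"
    using bgrad_nonzero[OF assms] negligible_hyperplane by blast
  then have "{x. bgrad c \<bullet> x = r - b} \<in> null_sets lebesgue" using negligible_iff_null_sets by blast
  moreover have "{x. bary c x \<noteq> r} \<in> sets borel" by measurable
  ultimately have "AE x in lebesgue. bary c x \<noteq> r"
    by (intro AE_I'[of "{x. bgrad c \<bullet> x = r - b}"]) (auto simp: b)
  then show ?thesis by (subst (asm) AE_completion_iff) auto
qed

lemma bary_dilation:
  assumes "c \<in> C" "v \<in> C"
  shows "bary v (c + s *\<^sub>R (x - c)) = s * bary v x + (1 - s) * (if v = c then 1 else 0)"
proof -
  have "bary v (c + s *\<^sub>R (x - c)) = bary v c + s * (bary v x - bary v c)"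
    by (simp add: bary_add bary_diff)
  then show ?thesis using bary_vertex[OF assms(1), of v] by (auto simp: algebra_simps)
qed

text \<open>The field \<open>x - c\<close> is tangential to all facets through \<open>c\<close>. The identity is the derivative at
  \<open>s = 1\<close> of the scaling law of the integral of \<open>\<psi>\<close>, cut off at the opposite facet, under the
  dilation by \<open>s\<close> about \<open>c\<close>.\<close>

lemma cone_identity:
  fixes \<psi> :: "'a \<Rightarrow> real" and g :: "'a \<Rightarrow> 'a"
  assumes der: "\<And>x. (\<psi> has_derivative (\<lambda>h. g x \<bullet> h)) (at x)" and cont: "continuous_on UNIV g"
    and c: "c \<in> C" and \<delta>: "0 < \<delta>"
  defines "K \<equiv> convex hull C"
  shows "(\<integral>x. indicator K x * (clamp01 (bary c x / \<delta>) * (g x \<bullet> (x - c) + DIM('a) * \<psi> x)) \<partial>lborel)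
       = (1 / \<delta>) * (\<integral>x. indicator {x \<in> K. bary c x < \<delta>} x * ((1 - bary c x) * \<psi> x) \<partial>lborel)"
proof -
  have K: "compact K" unfolding K_def by (rule compact_hull)
  have [measurable]: "K \<in> sets borel" using K by (simp add: borel_compact)
  have cont\<psi>: "continuous_on S \<psi>" for S using gradient_continuous_on[OF der] .
  have [measurable]: "\<psi> \<in> borel_measurable borel" by (intro borel_measurable_continuous_onI cont\<psi>)
  have [measurable]: "g \<in> borel_measurable borel" by (intro borel_measurable_continuous_onI cont)
  obtain R where R: "0 < R" "K \<subseteq> cball c R"
    using bounded_subset_ballD[OF compact_imp_bounded[OF K], of c] ball_subset_cball by blast
  \<comment> \<open>The dilation factors used below are at most 2, so the dilated simplex stays in
    this ball.\<close>
  define B where "B = cball c (2 * R)"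
  obtain L where L: "0 \<le> L" "\<And>x y. x \<in> B \<Longrightarrow> y \<in> B \<Longrightarrow> \<bar>\<psi> x - \<psi> y\<bar> \<le> L * norm (x - y)"
    using gradient_lipschitz_on_ball[OF der cont] unfolding B_def by metis
  have "compact B" by (simp add: B_def)
  obtain P where P: "\<And>x. x \<in> B \<Longrightarrow> \<bar>\<psi> x\<bar> \<le> P"
    using continuous_on_compact_abs_bound[OF \<open>compact B\<close> cont\<psi>] by blast
  have "continuous_on B (\<lambda>x. g x \<bullet> (x - c))"
    by (intro continuous_intros continuous_on_subset[OF cont]) auto
  then obtain Q where Q: "\<And>x. x \<in> B \<Longrightarrow> \<bar>g x \<bullet> (x - c)\<bar> \<le> Q"
    using continuous_on_compact_abs_bound[OF \<open>compact B\<close>] by blast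
  have KB: "K \<subseteq> B" using R unfolding B_def by force
  have P0: "0 \<le> P" using P[of c] R by (auto simp: B_def)
  define \<theta> where "\<theta> x = clamp01 (bary c x / \<delta>)" for x
  have \<theta>m [measurable]: "\<theta> \<in> borel_measurable borel" unfolding \<theta>_def by measurable
  have \<theta>1: "0 \<le> \<theta> x" "\<theta> x \<le> 1" for x by (auto simp: \<theta>_def clamp01_bounds)
  \<comment> \<open>A dilation about \<open>c\<close> crosses the boundary of \<open>K\<close> only
    at the opposite facet. There \<theta> vanishes, which makes the jump of the indicator
    harmless.\<close>
  define \<Phi> where "\<Phi> x = indicator K x * (\<psi> x * \<theta> x)" for x
  have \<Phi>m [measurable]: "\<Phi> \<in> borel_measurable borel" unfolding \<Phi>_def by measurable
  have \<Phi>i: "integrable lborel \<Phi>"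
  proof (rule lborel_integrable_bounded[of _ K P])
    show "\<bar>\<Phi> x\<bar> \<le> P" if "x \<in> K" for x
    proof -
      have "\<bar>\<psi> x\<bar> * \<theta> x \<le> P * 1" using P KB that \<theta>1[of x] P0 by (intro mult_mono) auto
      then show ?thesis using that \<theta>1[of x] by (simp add: \<Phi>_def abs_mult)
    qed
  qed (use K compact_imp_bounded in \<open>auto simp: \<Phi>_def\<close>)
  \<comment> \<open>Only expanding dilations are used: they keep points outside \<open>K\<close>
    outside, so the difference quotients are supported in \<open>K\<close>.\<close>
  define s where "s n = 1 + 1 / real (Suc n)" for n
  define y where "y n x = c + s n *\<^sub>R (x - c)" for n x
  have s1: "1 \<le> s n" "s n \<le> 2" for n by (auto simp: s_def)
  have ym [measurable]: "y n \<in> borel_measurable borel" for n unfolding y_def by measurable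
  define q where "q n x = (\<Phi> (y n x) - \<Phi> x) * real (Suc n)" for n x
  have notin: "y n x \<notin> K" if "x \<notin> K" for n x
  proof
    assume y: "y n x \<in> K"
    have "0 \<le> bary v x" if v: "v \<in> C" for v
    proof (cases "v = c")
      case True
      have "0 \<le> s n * bary c x + (1 - s n)"
        using y c bary_dilation[OF c c, of "s n" x] by (auto simp: K_def mem_hull_iff y_def)
      then have "0 \<le> s n * bary c x" using s1[of n] by linarith
      then show ?thesis using True s1[of n] by (simp add: zero_le_mult_iff)
    next
      case False
      have "0 \<le> s n * bary v x"
        using y v False bary_dilation[OF c v, of "s n" x] by (auto simp: K_def mem_hull_iff y_def)
      then show ?thesis using s1[of n] by (simp add: zero_le_mult_iff)
    qed
    then show False using that by (simp add: K_def mem_hull_iff)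
  qed
  \<comment> \<open>A point of \<open>K\<close> can leave only through the facet opposite
    \<open>c\<close>. Then its coordinate for \<open>c\<close> is negative and \<theta> is zero, so
    the indicator may be dropped.\<close>
  have \<Phi>y: "\<Phi> (y n x) = \<psi> (y n x) * \<theta> (y n x)" if x: "x \<in> K" for n x
  proof (cases "y n x \<in> K")
    case False
    have "0 \<le> bary v (y n x)" if "v \<in> C" "v \<noteq> c" for v
      using x that s1[of n] bary_dilation[OF c that(1), of "s n" x]
      by (auto simp: K_def mem_hull_iff y_def)
    then have "bary c (y n x) < 0" using False by (force simp: K_def mem_hull_iff)
    then have "\<theta> (y n x) = 0" using \<delta> by (simp add: \<theta>_def clamp01_def divide_nonpos_pos)
    then show ?thesis by (simp add: \<Phi>_def)
  qed (simp add: \<Phi>_def)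
  \<comment> \<open>The derivative at s = 1 by the product rule. The cut-off has slope 1/\<delta>
    exactly in the layer of depth \<delta>, and the coordinate of \<open>c\<close> changes at the
    rate \<open>bary c x - 1\<close>.\<close>
  define f where "f x = indicator K x * (\<theta> x * (g x \<bullet> (x - c)))
      - (1 / \<delta>) * (indicator {x \<in> K. bary c x < \<delta>} x * ((1 - bary c x) * \<psi> x))" for x
  have [measurable]: "f \<in> borel_measurable borel" unfolding f_def by measurable
  have lim: "AE x in lborel. (\<lambda>n. q n x) \<longlonglongrightarrow> f x"
    using AE_bary_ne[OF c, of 0] AE_bary_ne[OF c, of \<delta>]
  proof eventually_elim
    case (elim x)
    show ?case
    proof (cases "x \<in> K")
      case False
      then show ?thesis using notin[OF False] by (simp add: q_def \<Phi>_def f_def)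
    next
      case True
      have b0: "0 < bary c x" using True c elim by (auto simp: K_def mem_hull_iff less_le)
      define F where "F t = \<psi> (c + t *\<^sub>R (x - c)) * clamp01 ((t * bary c x + (1 - t)) / \<delta>)" for t
      have d1: "((\<lambda>t. \<psi> (c + t *\<^sub>R (x - c))) has_real_derivative (g x \<bullet> (x - c))) (at 1)"
      proof -
        have "((\<lambda>t. c + t *\<^sub>R (x - c)) has_derivative (\<lambda>t. t *\<^sub>R (x - c))) (at 1)"
          by (auto intro!: derivative_eq_intros)
        moreover have "(\<psi> has_derivative (\<lambda>h. g x \<bullet> h)) (at (c + 1 *\<^sub>R (x - c)))" using der by simp
        ultimately have "((\<lambda>t. \<psi> (c + t *\<^sub>R (x - c))) has_derivative (\<lambda>t. g x \<bullet> (t *\<^sub>R (x - c)))) (at 1)"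
          by (rule has_derivative_compose)
        then show ?thesis by (simp add: has_field_derivative_def mult_commute_abs)
      qed
      have d2: "((\<lambda>t. clamp01 ((t * bary c x + (1 - t)) / \<delta>)) has_real_derivative
          (if bary c x < \<delta> then 1 else 0) * ((bary c x - 1) / \<delta>)) (at 1)"
      proof (rule DERIV_chain2[where f = clamp01 and g = "\<lambda>t. (t * bary c x + (1 - t)) / \<delta>"])
        show "(clamp01 has_real_derivative (if bary c x < \<delta> then 1 else 0)) (at ((1 * bary c x + (1 - 1)) / \<delta>))"
          using clamp01_deriv[of "bary c x / \<delta>"] b0 elim \<delta> by (simp add: less_imp_neq[THEN not_sym])
        show "((\<lambda>t. (t * bary c x + (1 - t)) / \<delta>) has_real_derivative (bary c x - 1) / \<delta>) (at 1)"
        proof -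
          have "((\<lambda>t. t * bary c x + (1 - t)) has_real_derivative (1 * bary c x + (0 - 1))) (at 1)"
            by (intro DERIV_add DERIV_cmult_right DERIV_diff DERIV_const DERIV_ident)
          from DERIV_cdivide[OF this, of \<delta>] show ?thesis by simp
        qed
      qed
      have "(F has_real_derivative f x) (at 1)"
      proof -
        have "f x = \<psi> (c + 1 *\<^sub>R (x - c)) * ((if bary c x < \<delta> then 1 else 0) * ((bary c x - 1) / \<delta>))
            + (g x \<bullet> (x - c)) * clamp01 ((1 * bary c x + (1 - 1)) / \<delta>)"
          using True by (simp add: f_def \<theta>_def diff_divide_distrib left_diff_distrib right_diff_distrib)
        then show ?thesis
          unfolding F_def using DERIV_mult'[OF d1 d2] by simp
      qed
      from deriv_imp_difference_quotients[OF this]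
      have "(\<lambda>n. (F (s n) - F 1) * real (Suc n)) \<longlonglongrightarrow> f x" by (simp add: s_def)
      moreover have "q n x = (F (s n) - F 1) * real (Suc n)" for n
      proof -
        have "\<Phi> (y n x) = F (s n)"
          unfolding \<Phi>y[OF True] F_def \<theta>_def using bary_dilation[OF c c, of "s n" x] by (simp add: y_def)
        moreover have "\<Phi> x = F 1" using True by (simp add: \<Phi>_def F_def \<theta>_def)
        ultimately show ?thesis by (simp only: q_def)
      qed
      ultimately show ?thesis by (simp only:)
    qed
  qed
  \<comment> \<open>The point moves by at most R/(n+1), which costs L R, while the coordinate moves
    by at most 1/(n+1), which costs P/\<delta> through the slope of the cut-off.\<close>
  have bnd: "\<bar>q n x\<bar> \<le> indicator K x * (L * R + P / \<delta>)" for n x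
  proof (cases "x \<in> K")
    case False
    then show ?thesis using notin[OF False] by (simp add: q_def \<Phi>_def)
  next
    case True
    have xc: "norm (x - c) \<le> R" using True R by (auto simp: dist_norm norm_minus_commute)
    have yx: "y n x - x = (1 / real (Suc n)) *\<^sub>R (x - c)" by (simp add: y_def s_def algebra_simps)
    have yB: "y n x \<in> B"
    proof -
      have "norm (s n *\<^sub>R (x - c)) \<le> 2 * R" using s1[of n] xc by (auto intro!: mult_mono)
      then show ?thesis by (simp add: B_def y_def dist_norm)
    qed
    have "\<bar>\<psi> (y n x) - \<psi> x\<bar> \<le> L * norm (y n x - x)" using L(2)[OF yB] True KB by blast
    also have "\<dots> \<le> L * R / real (Suc n)" unfolding yx using xc L(1)
      by (simp add: divide_simps mult_left_mono)
    finally have 1: "\<bar>\<psi> (y n x) - \<psi> x\<bar> \<le> L * R / real (Suc n)" .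
    have "\<bar>\<theta> (y n x) - \<theta> x\<bar> \<le> \<bar>bary c (y n x) / \<delta> - bary c x / \<delta>\<bar>"
      unfolding \<theta>_def by (rule clamp01_lipschitz)
    also have "\<dots> = \<bar>(bary c x - 1) / real (Suc n)\<bar> / \<delta>"
    proof -
      have "bary c (y n x) = s n * bary c x + (1 - s n)"
        unfolding y_def using bary_dilation[OF c c, of "s n" x] by simp
      also have "\<dots> = bary c x + (bary c x - 1) / real (Suc n)"
        unfolding s_def by (simp add: ring_distribs diff_divide_distrib)
      finally have "bary c (y n x) / \<delta> - bary c x / \<delta> = (bary c x - 1) / real (Suc n) / \<delta>"
        by (simp add: add_divide_distrib)
      then show ?thesis using \<delta> by (simp add: abs_divide)
    qed
    also have "\<dots> \<le> (1 / real (Suc n)) / \<delta>"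
    proof -
      have "\<bar>bary c x - 1\<bar> \<le> 1"
        using True c bary_le_1[of x c] by (auto simp: K_def mem_hull_iff)
      then show ?thesis using \<delta> by (intro divide_right_mono) (auto simp: abs_divide divide_right_mono)
    qed
    finally have 2: "\<bar>\<theta> (y n x) - \<theta> x\<bar> \<le> (1 / real (Suc n)) / \<delta>" .
    have "\<bar>\<Phi> (y n x) - \<Phi> x\<bar> = \<bar>(\<psi> (y n x) - \<psi> x) * \<theta> (y n x) + \<psi> x * (\<theta> (y n x) - \<theta> x)\<bar>"
    proof -
      have "\<Phi> x = \<psi> x * \<theta> x" using True by (simp add: \<Phi>_def)
      then show ?thesis unfolding \<Phi>y[OF True] by (simp add: algebra_simps)
    qed
    also have "\<dots> \<le> \<bar>\<psi> (y n x) - \<psi> x\<bar> * \<theta> (y n x) + \<bar>\<psi> x\<bar> * \<bar>\<theta> (y n x) - \<theta> x\<bar>"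
      using \<theta>1[of "y n x"] by (intro order_trans[OF abs_triangle_ineq]) (simp add: abs_mult)
    also have "\<dots> \<le> L * R / real (Suc n) * 1 + P * ((1 / real (Suc n)) / \<delta>)"
      using 1 2 \<theta>1[of "y n x"] P[of x] True KB P0 L(1) R \<delta> by (intro add_mono mult_mono) auto
    also have "\<dots> = (L * R + P / \<delta>) / real (Suc n)"
      by (simp add: add_divide_distrib divide_divide_eq_left mult.commute)
    finally show ?thesis
      using True by (simp add: q_def abs_mult pos_le_divide_eq del: of_nat_Suc)
  qed
  have "(\<lambda>n. \<integral>x. q n x \<partial>lborel) \<longlonglongrightarrow> (\<integral>x. f x \<partial>lborel)"
  proof (rule integral_dominated_convergence[where w="\<lambda>x. indicator K x * (L * R + P / \<delta>)"])
    show "q n \<in> borel_measurable lborel" for n unfolding q_def by measurable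
    show "integrable lborel (\<lambda>x. indicator K x * (L * R + P / \<delta>))"
      by (rule lborel_integrable_bounded[of _ K "\<bar>L * R + P / \<delta>\<bar>"]) (use K compact_imp_bounded in auto)
  qed (use lim bnd in auto)
  \<comment> \<open>The scaling law turns the integral into a difference quotient of s^(-d) at 1,
    whose limit is -d. The subtracted power of 1 is kept so that this form is visible.\<close>
  moreover have "(\<integral>x. q n x \<partial>lborel) = (\<integral>x. \<Phi> x \<partial>lborel) * (((s n) powi (- int DIM('a)) - 1 powi (- int DIM('a))) * real (Suc n))" for n
  proof -
    have "integrable lborel (\<lambda>x. \<Phi> (y n x))"
    proof (rule Bochner_Integration.integrable_bound)
      have "integrable lborel (\<lambda>x. indicator K x * (L * R + P / \<delta>))"
        by (rule lborel_integrable_bounded[of _ K "\<bar>L * R + P / \<delta>\<bar>"]) (use K compact_imp_bounded in auto)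
      then show "integrable lborel (\<lambda>x. indicator K x * (L * R + P / \<delta>) + \<bar>\<Phi> x\<bar>)"
        using \<Phi>i by (intro Bochner_Integration.integrable_add integrable_abs)
      show "(\<lambda>x. \<Phi> (y n x)) \<in> borel_measurable lborel" by measurable
      have "\<bar>\<Phi> (y n x)\<bar> \<le> indicator K x * (L * R + P / \<delta>) + \<bar>\<Phi> x\<bar>" for x
      proof -
        have "\<bar>\<Phi> (y n x) - \<Phi> x\<bar> \<le> \<bar>q n x\<bar>" by (simp add: q_def abs_mult mult_le_cancel_left1)
        then show ?thesis using bnd[of n x] by linarith
      qed
      then show "AE x in lborel. norm (\<Phi> (y n x)) \<le> norm (indicator K x * (L * R + P / \<delta>) + \<bar>\<Phi> x\<bar>)"
        by (intro AE_I2) (metis real_norm_def abs_ge_self order_trans)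
    qed
    moreover have "(\<integral>x. \<Phi> (y n x) \<partial>lborel) = (\<integral>x. \<Phi> x \<partial>lborel) / s n ^ DIM('a)"
      unfolding y_def using s1[of n] by (intro lborel_integral_dilation) auto
    ultimately show ?thesis
      using \<Phi>i by (simp add: q_def power_int_minus divide_inverse algebra_simps)
  qed
  ultimately have "(\<lambda>n. (\<integral>x. \<Phi> x \<partial>lborel) * (((s n) powi (- int DIM('a)) - 1 powi (- int DIM('a))) * real (Suc n))) \<longlonglongrightarrow> (\<integral>x. f x \<partial>lborel)"
    by simp
  moreover have "(\<lambda>n. (\<integral>x. \<Phi> x \<partial>lborel) * (((s n) powi (- int DIM('a)) - 1 powi (- int DIM('a))) * real (Suc n))) \<longlonglongrightarrow> (\<integral>x. \<Phi> x \<partial>lborel) * (- real DIM('a))"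
  proof (rule tendsto_mult_left)
    have "((\<lambda>t. t powi (- int DIM('a))) has_real_derivative - real DIM('a)) (at 1)"
      by (auto intro!: derivative_eq_intros)
    from deriv_imp_difference_quotients[OF this]
    show "(\<lambda>n. ((s n) powi (- int DIM('a)) - 1 powi (- int DIM('a))) * real (Suc n)) \<longlonglongrightarrow> - real DIM('a)"
      by (simp only: s_def)
  qed
  ultimately have eq: "(\<integral>x. f x \<partial>lborel) = - real DIM('a) * (\<integral>x. \<Phi> x \<partial>lborel)"
    using LIMSEQ_unique by fastforce
  have i1: "integrable lborel (\<lambda>x. indicator K x * (\<theta> x * (g x \<bullet> (x - c))))"
  proof (rule lborel_integrable_bounded[of _ K Q])
    show "\<bar>indicator K x * (\<theta> x * (g x \<bullet> (x - c)))\<bar> \<le> Q" if "x \<in> K" for x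
    proof -
      have "\<theta> x * \<bar>g x \<bullet> (x - c)\<bar> \<le> 1 * Q" using Q KB that \<theta>1[of x] by (intro mult_mono) auto
      then show ?thesis using that \<theta>1[of x] by (simp add: abs_mult)
    qed
  qed (use K compact_imp_bounded in auto)
  have i2: "integrable lborel (\<lambda>x. indicator {x \<in> K. bary c x < \<delta>} x * ((1 - bary c x) * \<psi> x))"
  proof (rule lborel_integrable_bounded[of _ K P])
    show "\<bar>indicator {x \<in> K. bary c x < \<delta>} x * ((1 - bary c x) * \<psi> x)\<bar> \<le> P" if "x \<in> K" for x
    proof -
      have "\<bar>1 - bary c x\<bar> \<le> 1"
        using that c bary_le_1[of x c] by (auto simp: K_def mem_hull_iff)
      then have "\<bar>1 - bary c x\<bar> * \<bar>\<psi> x\<bar> \<le> 1 * P" using P KB that by (intro mult_mono) auto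
      then show ?thesis using P0 by (auto simp: abs_mult indicator_def)
    qed
  qed (use K compact_imp_bounded in auto)
  have "(\<integral>x. f x \<partial>lborel) = (\<integral>x. indicator K x * (\<theta> x * (g x \<bullet> (x - c))) \<partial>lborel)
     - (1 / \<delta>) * (\<integral>x. indicator {x \<in> K. bary c x < \<delta>} x * ((1 - bary c x) * \<psi> x) \<partial>lborel)"
    unfolding f_def using i1 i2 by simp
  moreover have "(\<integral>x. indicator K x * (\<theta> x * (g x \<bullet> (x - c) + DIM('a) * \<psi> x)) \<partial>lborel)
     = (\<integral>x. indicator K x * (\<theta> x * (g x \<bullet> (x - c))) + DIM('a) * \<Phi> x \<partial>lborel)"
    by (rule Bochner_Integration.integral_cong) (auto simp: \<Phi>_def algebra_simps)
  moreover have "\<dots> = (\<integral>x. indicator K x * (\<theta> x * (g x \<bullet> (x - c))) \<partial>lborel) + DIM('a) * (\<integral>x. \<Phi> x \<partial>lborel)"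
    using i1 \<Phi>i by simp
  ultimately show ?thesis using eq by (simp add: \<theta>_def)
qed

text \<open>For \<psi> = 1 and \<delta> = 1 the cut-off is the coordinate itself, and
  \<open>cone_identity\<close> reads d I = |K| - I for the integral I.\<close>

lemma integral_bary:
  assumes "c \<in> C"
  shows "(\<integral>x. indicator (convex hull C) x * bary c x \<partial>lborel)
       = measure lborel (convex hull C) / (real DIM('a) + 1)"
proof -
  let ?K = "convex hull C"
  have [measurable]: "?K \<in> sets borel" using compact_hull by (simp add: borel_compact)
  have i1: "integrable lborel (\<lambda>x. indicator ?K x * bary c x)"
  proof (rule lborel_integrable_bounded[of _ ?K 1])
    show "\<bar>indicator ?K x * bary c x\<bar> \<le> 1" if "x \<in> ?K" for x
      using that bary_le_1[OF that assms] assms by (auto simp: mem_hull_iff)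
  qed (use compact_hull compact_imp_bounded in auto)
  have i2: "integrable lborel (\<lambda>x. indicator ?K x :: real)"
    by (rule lborel_integrable_bounded[of _ ?K 1]) (use compact_hull compact_imp_bounded in auto)
  have "(\<integral>x. indicator ?K x * (clamp01 (bary c x / 1) * (0 \<bullet> (x - c) + real DIM('a) * 1)) \<partial>lborel)
     = (1 / 1) * (\<integral>x. indicator {x \<in> ?K. bary c x < 1} x * ((1 - bary c x) * 1) \<partial>lborel)"
    by (rule cone_identity[where \<psi>="\<lambda>_. 1" and g="\<lambda>_. 0", OF _ _ assms]) simp_all
  moreover have "(\<integral>x. indicator ?K x * (clamp01 (bary c x / 1) * (0 \<bullet> (x - c) + real DIM('a) * 1)) \<partial>lborel)
     = (\<integral>x. DIM('a) * (indicator ?K x * bary c x) \<partial>lborel)"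
  proof (rule Bochner_Integration.integral_cong)
    fix x show "indicator ?K x * (clamp01 (bary c x / 1) * (0 \<bullet> (x - c) + real DIM('a) * 1))
        = DIM('a) * (indicator ?K x * bary c x)"
      using bary_le_1[OF _ assms, of x] assms
      by (cases "x \<in> ?K") (auto simp: clamp01_def mem_hull_iff)
  qed simp
  moreover have "(\<integral>x. indicator {x \<in> ?K. bary c x < 1} x * ((1 - bary c x) * 1) \<partial>lborel)
     = (\<integral>x. indicator ?K x - indicator ?K x * bary c x \<partial>lborel)"
    using bary_le_1[OF _ assms] assms
    by (intro Bochner_Integration.integral_cong) (force simp: indicator_def)+
  ultimately have "real DIM('a) * (\<integral>x. indicator ?K x * bary c x \<partial>lborel)
      = measure lborel ?K - (\<integral>x. indicator ?K x * bary c x \<partial>lborel)"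
    using i1 i2 by simp
  then show ?thesis by (simp add: field_simps)
qed

end


section \<open>Integrals over facets\<close>

lemma integrable_indicator_cball:
  "integrable lborel (\<lambda>x::'a::euclidean_space. indicator (cball a R) x * (W::real))"
  using borel_integrable_compact[OF compact_cball continuous_on_const, of a R W] by simp

definition prism :: "'a::euclidean_space \<Rightarrow> 'a set \<Rightarrow> 'a set" where
  "prism n e = {y + t *\<^sub>R n | y t. y \<in> e \<and> 0 \<le> t \<and> t \<le> 1}"

lemma compact_prism: "compact e \<Longrightarrow> compact (prism n e)"
proof -
  assume "compact e"
  then have "compact ((\<lambda>(y, t). y + t *\<^sub>R n) ` (e \<times> {0..1}))"
    by (intro compact_continuous_image compact_Times) (auto intro!: continuous_intros simp: case_prod_unfold)
  moreover have "(\<lambda>(y, t). y + t *\<^sub>R n) ` (e \<times> {0..1}) = prism n e"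
    by (fastforce simp: prism_def)
  ultimately show ?thesis by simp
qed

text \<open>By Pythagoras. It identifies the closest-point map in \<open>face_integral\<close> with
  the projection along the normal, for positive and negative heights alike.\<close>

lemma closest_point_normal:
  fixes e :: "'a::euclidean_space set"
  assumes "convex e" "closed e" "y \<in> e" "\<And>x y. x \<in> e \<Longrightarrow> y \<in> e \<Longrightarrow> n \<bullet> (x - y) = 0"
  shows "closest_point e (y + t *\<^sub>R n) = y"
proof -
  have "dist (y + t *\<^sub>R n) y \<le> dist (y + t *\<^sub>R n) z" if "z \<in> e" for z
  proof -
    have 0: "n \<bullet> (y - z) = 0" using assms(3,4) that by blast
    have "(norm (y + t *\<^sub>R n - z))\<^sup>2 = (norm (y - z))\<^sup>2 + (norm (t *\<^sub>R n))\<^sup>2"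
      using norm_add_Pythagorean[of "y - z" "t *\<^sub>R n"] 0
      by (simp add: orthogonal_def inner_commute algebra_simps)
    then have "(norm (t *\<^sub>R n))\<^sup>2 \<le> (norm (y + t *\<^sub>R n - z))\<^sup>2" by simp
    then have "norm (t *\<^sub>R n) \<le> norm (y + t *\<^sub>R n - z)" by (rule power2_le_imp_le) simp
    then show ?thesis by (simp add: dist_norm)
  qed
  then show ?thesis using closest_point_unique[OF assms(1,2,3)] by metis
qed

text \<open>On the compact prism the integrand is continuous, because the closest-point map is. The
  Borel form allows translations and Borel measurability arguments.\<close>

lemma face_integral_lborel:
  fixes e :: "(real^'d) set"
  assumes e: "compact e" "convex e" "e \<noteq> {}" and g: "continuous_on e g"
  shows "face_integral n e g = (\<integral>x. indicator (prism n e) x * g (closest_point e x) \<partial>lborel)"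
    and "integrable lborel (\<lambda>x. indicator (prism n e) x * g (closest_point e x))"
    and "integrable (lebesgue_on (prism n e)) (\<lambda>x. g (closest_point e x))"
proof -
  have p: "compact (prism n e)" by (rule compact_prism[OF e(1)])
  have cont: "continuous_on (prism n e) (\<lambda>x. g (closest_point e x))"
    by (rule continuous_on_compose2[OF g continuous_on_closest_point])
       (use e compact_imp_closed closest_point_in_set in auto)
  show i: "integrable lborel (\<lambda>x. indicator (prism n e) x * g (closest_point e x))"
    using borel_integrable_compact[OF p cont] by simp
  then have i': "integrable lebesgue (\<lambda>x. indicator (prism n e) x * g (closest_point e x))"
    using integrable_completion borel_measurable_integrable by blast
  have s: "prism n e \<in> sets lebesgue" using p by (simp add: borel_compact)
  then show "integrable (lebesgue_on (prism n e)) (\<lambda>x. g (closest_point e x))"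
    using i' by (simp add: integrable_restrict_space)
  show "face_integral n e g = (\<integral>x. indicator (prism n e) x * g (closest_point e x) \<partial>lborel)"
    unfolding face_integral_def prism_def[symmetric]
    using s integral_completion[OF borel_measurable_integrable[OF i]]
    by (simp add: integral_restrict_space)
qed

lemma face_integral_nonneg:
  assumes "closed e" "e \<noteq> {}" "\<And>x. x \<in> e \<Longrightarrow> 0 \<le> g x"
  shows "0 \<le> face_integral n e g"
  unfolding face_integral_def using assms closest_point_in_set by (intro Bochner_Integration.integral_nonneg) blast

lemma face_integral_cong:
  assumes "closed e" "e \<noteq> {}" "\<And>x. x \<in> e \<Longrightarrow> g x = h x"
  shows "face_integral n e g = face_integral n e h"
  unfolding face_integral_def using assms closest_point_in_set
  by (intro Bochner_Integration.integral_cong) auto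

lemma face_integral_mono:
  assumes "compact e" "convex e" "e \<noteq> {}" "continuous_on e g" "continuous_on e h"
    "\<And>x. x \<in> e \<Longrightarrow> g x \<le> h x"
  shows "face_integral n e g \<le> face_integral n e h"
  unfolding face_integral_def prism_def[symmetric]
  using assms closest_point_in_set[OF compact_imp_closed]
  by (intro integral_mono face_integral_lborel(3)) auto

lemma face_integral_cmult: "face_integral n e (\<lambda>x. a * g x) = a * face_integral n e g"
  unfolding face_integral_def by simp

lemma face_integral_sum:
  assumes "compact e" "convex e" "e \<noteq> {}" "\<And>i. i \<in> I \<Longrightarrow> continuous_on e (g i)"
  shows "face_integral n e (\<lambda>x. \<Sum>i\<in>I. g i x) = (\<Sum>i\<in>I. face_integral n e (g i))"
  unfolding face_integral_def prism_def[symmetric]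
  using assms by (intro Bochner_Integration.integral_sum face_integral_lborel(3)) auto

text \<open>The two prisms erected on opposite sides of the face differ by a translation.\<close>

lemma face_integral_minus_normal:
  fixes e :: "(real^'d) set"
  assumes e: "compact e" "convex e" "e \<noteq> {}" and g: "continuous_on e g"
    and n: "\<And>x y. x \<in> e \<Longrightarrow> y \<in> e \<Longrightarrow> n \<bullet> (x - y) = 0"
  shows "face_integral (- n) e g = face_integral n e g"
proof -
  let ?f = "\<lambda>x. indicator (prism n e) x * g (closest_point e x)"
  have "indicator (prism (- n) e) x * g (closest_point e x) = ?f (x + n)" for x
  proof -
    have "x \<in> prism (- n) e \<longleftrightarrow> x + n \<in> prism n e"
    proof
      assume "x \<in> prism (- n) e"
      then obtain y t where "y \<in> e" "0 \<le> t" "t \<le> 1" "x = y + t *\<^sub>R (- n)" by (auto simp: prism_def)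
      then show "x + n \<in> prism n e"
        \<comment> \<open>Translation by \<open>n\<close> carries height t below the face to height
          1 - t above it.\<close>
        unfolding prism_def by (intro CollectI exI[of _ y] exI[of _ "1 - t"]) (auto simp: algebra_simps)
    next
      assume "x + n \<in> prism n e"
      then obtain y t where "y \<in> e" "0 \<le> t" "t \<le> 1" "x + n = y + t *\<^sub>R n" by (auto simp: prism_def)
      then show "x \<in> prism (- n) e"
        unfolding prism_def by (intro CollectI exI[of _ y] exI[of _ "1 - t"]) (auto simp: algebra_simps)
    qed
    moreover have "closest_point e x = closest_point e (x + n)" if p: "x + n \<in> prism n e"
    proof -
      obtain y t where y: "y \<in> e" "x + n = y + t *\<^sub>R n" using p unfolding prism_def by blast
      have "x = (x + n) - n" by simp
      also have "\<dots> = y + (t - 1) *\<^sub>R n" unfolding y(2) by (simp add: algebra_simps)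
      finally have "x = y + (t - 1) *\<^sub>R n" .
      then show ?thesis
        using y closest_point_normal[OF e(2) compact_imp_closed[OF e(1)] y(1) n] by metis
    qed
    ultimately show ?thesis by (auto simp: indicator_def)
  qed
  then have "face_integral (- n) e g = (\<integral>x. ?f (x + n) \<partial>lborel)"
    unfolding face_integral_lborel(1)[OF e g] by (rule Bochner_Integration.integral_cong[OF refl])
  also have "\<dots> = (\<integral>x. ?f x \<partial>lborel)"
    by (rule lborel_integral_translation) (use borel_measurable_integrable[OF face_integral_lborel(2)[OF e g]] in simp)
  finally show ?thesis unfolding face_integral_lborel(1)[OF e g] .
qed

context full_simplex begin

lemma bgrad_orthogonal_facet:
  assumes "c \<in> C" "x \<in> facet c" "y \<in> facet c"
  shows "bgrad c \<bullet> (x - y) = 0"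
  using assms by (simp add: mem_facet_iff flip: bary_diff)

end

text \<open>The layer of thickness \<open>1/m\<close> is compared with the prism of height one by cutting the latter
  into \<open>m\<close> layers and translating each of them onto the first; translation by the integer part
  pushes the points of the prism towards their projection onto the facet.\<close>

lemma slab_limit:
  fixes C :: "(real^'d) set" and w :: "real^'d \<Rightarrow> real"
  assumes "full_simplex C" and c: "c \<in> C" and w: "continuous_on (convex hull C) w"
  defines "G \<equiv> full_simplex.bgrad C c"
  defines "\<delta> \<equiv> \<lambda>m::nat. norm G / real (Suc m)"
  shows "(\<lambda>m. 1 / \<delta> m * (\<integral>x. indicator {x \<in> convex hull C. full_simplex.bary C c x < \<delta> m} x * w x \<partial>lborel))
     \<longlonglongrightarrow> face_integral (G /\<^sub>R norm G) (full_simplex.facet C c) w / norm G"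
proof -
  interpret full_simplex C by fact
  define K where "K = convex hull C"
  define F where "F = facet c"
  define n where "n = G /\<^sub>R norm G"
  have G0: "G \<noteq> 0" unfolding G_def by (rule bgrad_nonzero[OF c])
  then have Gp: "0 < norm G" by simp
  \<comment> \<open>The signed Euclidean distance to the hyperplane of the facet, positive on the
    side of \<open>c\<close>. The layer of depth \<open>\<delta> m\<close> is exactly that of height
    1/(m+1).\<close>
  define t where "t x = bary c x / norm G" for x
  have Gn: "G \<bullet> n = norm G" using G0 by (simp add: n_def power2_norm_eq_inner[symmetric] power2_eq_square)
  have nn: "norm n = 1" using G0 by (simp add: n_def)
  have t_add: "t (x + r *\<^sub>R n) = t x + r" for x r
    using Gn Gp by (simp add: t_def bary_add add_divide_distrib flip: G_def)
  have t_diff: "t (x - r *\<^sub>R n) = t x - r" for x r using t_add[of x "- r"] by simp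
  have tm [measurable]: "t \<in> borel_measurable borel" unfolding t_def by measurable
  have K: "compact K" "closed K" unfolding K_def using compact_hull compact_imp_closed by blast+
  have [measurable]: "K \<in> sets borel" using K by (simp add: borel_compact)
  have F: "compact F" "closed F" "convex F" "F \<noteq> {}"
    unfolding F_def using compact_facet compact_imp_closed convex_facet facet_nonempty by blast+
  have [measurable]: "F \<in> sets borel" using F by (simp add: borel_compact)
  have FK: "x \<in> F \<longleftrightarrow> x \<in> K \<and> t x = 0" for x
    unfolding F_def K_def t_def using mem_facet_iff[OF c] Gp by simp
  define k where "k x = indicator K x * w x" for x
  have km [measurable]: "k \<in> borel_measurable borel"
    unfolding k_def using borel_measurable_continuous_on_indicator[OF \<open>K \<in> sets borel\<close> w[folded K_def]] by simp
  obtain W where W0: "\<And>x. x \<in> K \<Longrightarrow> \<bar>w x\<bar> \<le> W"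
    using continuous_on_compact_abs_bound[OF K(1)] w K_def by metis
  have "K \<noteq> {}" using FK F by blast
  then have Wp: "0 \<le> W" using W0 abs_ge_zero order_trans by blast
  have W: "\<bar>k x\<bar> \<le> W" for x using W0 Wp by (simp add: k_def indicator_def)
  obtain R where R: "\<And>x. x \<in> K \<Longrightarrow> norm x \<le> R"
    using compact_imp_bounded[OF K(1)] bounded_iff by metis
  \<comment> \<open>The orthogonal projection onto the hyperplane of the facet.\<close>
  define P where "P x = x - t x *\<^sub>R n" for x
  have Pm [measurable]: "P \<in> borel_measurable borel" unfolding P_def by measurable
  have tP: "t (P x) = 0" for x by (simp add: P_def t_diff)
  define J where "J = {x. 0 \<le> t x \<and> t x < 1}"
  have Jm [measurable]: "J \<in> sets borel" unfolding J_def by measurable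
  \<comment> \<open>The height is rounded down to a multiple of 1/(m+1) and this multiple removed,
    so x lands in the first layer over the same projection.\<close>
  define z where "z m x = x - (real_of_int \<lfloor>real (Suc m) * t x\<rfloor> / real (Suc m)) *\<^sub>R n" for m x
  have zm [measurable]: "z m \<in> borel_measurable borel" for m unfolding z_def by measurable
  have tz: "0 \<le> t (z m x)" "t (z m x) < 1 / real (Suc m)" for m x
  proof -
    have "real_of_int \<lfloor>real (Suc m) * t x\<rfloor> \<le> real (Suc m) * t x"
         "real (Suc m) * t x < real_of_int \<lfloor>real (Suc m) * t x\<rfloor> + 1" by linarith+
    then show "0 \<le> t (z m x)" "t (z m x) < 1 / real (Suc m)"
      unfolding z_def t_diff
      by (simp_all add: pos_divide_le_eq diff_less_eq pos_less_divide_eq mult.commute add.commute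
          flip: add_divide_distrib del: of_nat_Suc)
  qed
  have zP: "z m x = P x + t (z m x) *\<^sub>R n" for m x
    by (simp add: z_def P_def t_diff algebra_simps)
  have zlim: "(\<lambda>m. z m x) \<longlonglongrightarrow> P x" for x
  proof -
    have "(\<lambda>m. t (z m x)) \<longlonglongrightarrow> 0"
      by (rule tendsto_sandwich[OF _ _ tendsto_const LIMSEQ_inverse_real_of_nat])
         (use tz in \<open>auto simp: inverse_eq_divide intro!: always_eventually less_imp_le simp del: of_nat_Suc\<close>)
    then have "(\<lambda>m. P x + t (z m x) *\<^sub>R n) \<longlonglongrightarrow> P x + 0 *\<^sub>R n" by (intro tendsto_intros)
    then show ?thesis by (simp flip: zP)
  qed
  \<comment> \<open>The slab \<open>J\<close> of height one is cut into m+1 layers, each a translate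
    of the first. The factor \<open>real (Suc m)\<close> counts them.\<close>
  have cells: "(\<integral>x. indicator J x * k (z m x) \<partial>lborel)
      = real (Suc m) * (\<integral>x. indicator {x. 0 \<le> t x \<and> t x < 1 / real (Suc m)} x * k x \<partial>lborel)" for m
  proof -
    let ?M = "real (Suc m)"
    have Mp: "0 < ?M" by simp
    define f where "f x = indicator {x. 0 \<le> t x \<and> t x < 1 / ?M} x * k x" for x
    have fm [measurable]: "f \<in> borel_measurable borel" unfolding f_def by measurable
    have fi: "integrable lborel (\<lambda>x. f (x + v))" for v
    proof (rule lborel_integrable_bounded[of _ "cball (- v) R" W])
      show "f (x + v) = 0" if "x \<notin> cball (- v) R" for x
      proof -
        have "x + v \<notin> K" using that R[of "x + v"] by (auto simp: dist_norm norm_minus_commute add.commute)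
        then show ?thesis by (simp add: f_def k_def)
      qed
      show "\<bar>f (x + v)\<bar> \<le> W" for x using W[of "x + v"] Wp by (simp add: f_def indicator_def)
    qed auto
    have "indicator J x * k (z m x) = (\<Sum>i<Suc m. f (x + (- (real i / ?M)) *\<^sub>R n))" for x
    proof -
      define j where "j = \<lfloor>?M * t x\<rfloor>"
      have j: "real_of_int j \<le> ?M * t x" "?M * t x < real_of_int j + 1" unfolding j_def by linarith+
      \<comment> \<open>Half-open layers are disjoint, so exactly one index i, the rounded height j,
        can contribute.\<close>
      have iff: "0 \<le> t (x + (- (real i / ?M)) *\<^sub>R n) \<and> t (x + (- (real i / ?M)) *\<^sub>R n) < 1 / ?M \<longleftrightarrow> int i = j" for i
      proof -
        have "0 \<le> t (x + (- (real i / ?M)) *\<^sub>R n) \<and> t (x + (- (real i / ?M)) *\<^sub>R n) < 1 / ?M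
           \<longleftrightarrow> real i \<le> ?M * t x \<and> ?M * t x < real i + 1"
          unfolding t_add
          by (simp add: pos_divide_le_eq diff_less_eq pos_less_divide_eq mult.commute add.commute
              flip: add_divide_distrib del: of_nat_Suc)
        also have "\<dots> \<longleftrightarrow> int i = j" unfolding j_def by linarith
        finally show ?thesis .
      qed
      have f: "f (x + (- (real i / ?M)) *\<^sub>R n) = (if int i = j then k (x - (real i / ?M) *\<^sub>R n) else 0)" for i
        unfolding f_def indicator_def mem_Collect_eq iff by simp
      show ?thesis
      proof (cases "x \<in> J")
        case True
        then have t01: "0 \<le> t x" "t x < 1" by (auto simp: J_def)
        have "0 \<le> ?M * t x" using t01(1) Mp by (intro mult_nonneg_nonneg) auto
        moreover have "?M * t x < ?M * 1" using t01(2) Mp by (rule mult_strict_left_mono)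
        ultimately
        have j0: "0 \<le> j" "j < int (Suc m)"
          unfolding j_def zero_le_floor floor_less_iff by simp_all
        have "(\<Sum>i<Suc m. f (x + (- (real i / ?M)) *\<^sub>R n))
            = (\<Sum>i<Suc m. if i = nat j then k (x - (real i / ?M) *\<^sub>R n) else 0)"
          unfolding f using j0 by (intro sum.cong) auto
        also have "\<dots> = k (x - (real (nat j) / ?M) *\<^sub>R n)" using j0 by auto
        also have "\<dots> = k (z m x)" using j0 by (simp add: z_def j_def)
        finally show ?thesis using True by simp
      next
        case False
        have "f (x + (- (real i / ?M)) *\<^sub>R n) = 0" if "i < Suc m" for i
        proof (cases "int i = j")
          case True
          then have ij: "real i \<le> ?M * t x" "?M * t x < real i + 1" using j by auto
          have "0 \<le> ?M * t x" using ij(1) by (rule order_trans[rotated]) simp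
          moreover have "?M * t x < ?M * 1" using ij(2) by (rule order_less_le_trans) (use that in simp)
          ultimately
          have "x \<in> J"
            unfolding J_def using zero_le_mult_iff[of ?M "t x"] mult_less_cancel_left_pos[OF Mp, of "t x" 1] Mp
            by (simp del: of_nat_Suc)
          then show ?thesis using False by simp
        qed (unfold f, simp)
        then show ?thesis using False by simp
      qed
    qed
    then have "(\<integral>x. indicator J x * k (z m x) \<partial>lborel)
        = (\<integral>x. (\<Sum>i<Suc m. f (x + (- (real i / ?M)) *\<^sub>R n)) \<partial>lborel)" by simp
    also have "\<dots> = (\<Sum>i<Suc m. (\<integral>x. f (x + (- (real i / ?M)) *\<^sub>R n) \<partial>lborel))"
      by (intro Bochner_Integration.integral_sum fi)
    also have "\<dots> = (\<Sum>i<Suc m. (\<integral>x. f x \<partial>lborel))"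
      by (intro sum.cong refl lborel_integral_translation fm)
    finally show ?thesis by (simp add: f_def)
  qed
  define h where "h x = indicator F (P x) * w (P x)" for x
  have hm [measurable]: "h \<in> borel_measurable borel"
  proof -
    have "(\<lambda>x. indicator F x * w x) \<in> borel_measurable borel"
      using borel_measurable_continuous_on_indicator[OF \<open>F \<in> sets borel\<close>
        continuous_on_subset[OF w[folded K_def], of F]] FK by auto
    then show ?thesis unfolding h_def by measurable
  qed
  have AE1: "AE x in lborel. (\<lambda>m. indicator J x * k (z m x)) \<longlonglongrightarrow> indicator J x * h x"
  proof -
    \<comment> \<open>Points projecting onto the relative boundary of the facet are excluded: over
      them \<open>z m x\<close> may stay outside \<open>K\<close> although the limit lies in
      \<open>K\<close>.\<close>
    have "AE x in lborel. \<forall>v\<in>C - {c}. bary v (P x) \<noteq> 0"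
    proof (rule AE_finite_allI)
      fix v assume v: "v \<in> C - {c}"
      define a where "a = bgrad v - ((bgrad v \<bullet> n) / norm G) *\<^sub>R G"
      obtain b0 where b0: "\<And>x. bary c x = G \<bullet> x + b0" unfolding bary_def G_def by blast
      obtain b1 where b1: "\<And>x. bary v x = bgrad v \<bullet> x + b1" unfolding bary_def by blast
      have eq: "bary v (P x) = a \<bullet> x + (b1 - (bgrad v \<bullet> n) / norm G * b0)" for x
        unfolding b1 P_def t_def b0 a_def by (simp add: inner_diff_right inner_diff_left algebra_simps add_divide_distrib)
      show "AE x in lborel. bary v (P x) \<noteq> 0"
      proof (cases "a = 0")
        \<comment> \<open>The coordinate is then constant along the projection. Since
          \<open>P v = v\<close>, the constant is the value 1 at its own vertex.\<close>
        case True
        have "P v = v" using bary_vertex[of v c] v by (simp add: P_def t_def)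
        then have "bary v (P x) = 1" for x using eq[of x] eq[of v] True bary_vertex[of v v] v by simp
        then show ?thesis by simp
      next
        case False
        then have "negligible {x. a \<bullet> x = - (b1 - (bgrad v \<bullet> n) / norm G * b0)}"
        using negligible_hyperplane by blast
      then have "{x. a \<bullet> x = - (b1 - (bgrad v \<bullet> n) / norm G * b0)} \<in> null_sets lebesgue"
        using negligible_iff_null_sets by blast
      then have "AE x in lebesgue. bary v (P x) \<noteq> 0"
        by (rule AE_I') (auto simp: eq)
        then show ?thesis
          by (subst (asm) AE_completion_iff) auto
      qed
    qed simp
    then show ?thesis
    proof eventually_elim
      case (elim x)
      have "(\<lambda>m. k (z m x)) \<longlonglongrightarrow> h x"
      proof (cases "P x \<in> F")
        case True
        then have PK: "P x \<in> K" using FK by blast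
        \<comment> \<open>All other coordinates are positive in the limit and the height is never
          negative, so \<open>z m x\<close> eventually lies in \<open>K\<close>.\<close>
        have pos: "0 < bary v (P x)" if "v \<in> C" "v \<noteq> c" for v
          using elim that PK by (auto simp: K_def mem_hull_iff less_le)
        have ev: "\<forall>\<^sub>F m in sequentially. \<forall>v\<in>C - {c}. 0 < bary v (z m x)"
        proof (rule eventually_ball_finite)
          show "\<forall>v\<in>C - {c}. \<forall>\<^sub>F m in sequentially. 0 < bary v (z m x)"
          proof
            fix v assume v: "v \<in> C - {c}"
            have "(\<lambda>m. bary v (z m x)) \<longlonglongrightarrow> bary v (P x)"
              unfolding bary_def by (intro tendsto_intros zlim)
            then show "\<forall>\<^sub>F m in sequentially. 0 < bary v (z m x)"
              by (rule order_tendstoD(1)) (use pos v in auto)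
          qed
        qed simp
        then have evK: "\<forall>\<^sub>F m in sequentially. z m x \<in> K"
        proof eventually_elim
          case (elim m)
          have "0 \<le> bary c (z m x)" using tz(1)[of m x] Gp by (simp add: t_def zero_le_divide_iff)
          then show ?case using elim by (force simp: K_def mem_hull_iff less_le)
        qed
        have "(\<lambda>m. w (z m x)) \<longlonglongrightarrow> w (P x)"
          using continuous_on_tendsto_compose[OF w[folded K_def] zlim PK evK] .
        then have "(\<lambda>m. w (z m x)) \<longlonglongrightarrow> h x" using True by (simp add: h_def)
        then show ?thesis
          by (rule Lim_transform_eventually) (use evK in eventually_elim, simp add: k_def)
      next
        case False
        have "\<forall>\<^sub>F m in sequentially. z m x \<notin> K"
        proof -
          have "P x \<in> - K" using False FK tP by blast
          then show ?thesis using topological_tendstoD[OF zlim, of "- K"] K by (simp add: open_Compl)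
        qed
        then have "\<forall>\<^sub>F m in sequentially. k (z m x) = 0" by eventually_elim (simp add: k_def)
        then show ?thesis using False by (simp add: h_def tendsto_eventually)
      qed
      then show ?case by (intro tendsto_mult_left)
    qed
  qed
  have lim: "(\<lambda>m. \<integral>x. indicator J x * k (z m x) \<partial>lborel) \<longlonglongrightarrow> (\<integral>x. indicator J x * h x \<partial>lborel)"
  proof (rule integral_dominated_convergence[where w="\<lambda>x. indicator (cball 0 (R + 1)) x * W"])
    show "integrable lborel (\<lambda>x::real^'d. indicator (cball 0 (R + 1)) x * W)"
      by (rule integrable_indicator_cball)
    \<comment> \<open>On \<open>J\<close> the shift has length at most one, so the integrand lives
      in the ball that contains \<open>K\<close>, enlarged by one.\<close>
    show "AE x in lborel. norm (indicator J x * k (z m x)) \<le> indicator (cball 0 (R + 1)) x * W" for m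
    proof (rule AE_I2)
      fix x
      show "norm (indicator J x * k (z m x)) \<le> indicator (cball 0 (R + 1)) x * W"
      proof (cases "x \<in> J \<and> z m x \<in> K")
        case True
        have "z m x + (t x - t (z m x)) *\<^sub>R n = P x + t (z m x) *\<^sub>R n + (t x - t (z m x)) *\<^sub>R n"
          by (rule arg_cong[OF zP])
        also have "\<dots> = P x + t x *\<^sub>R n" by (simp add: scaleR_left_diff_distrib)
        also have "\<dots> = x" by (simp add: P_def)
        finally have "x = z m x + (t x - t (z m x)) *\<^sub>R n" by (rule sym)
        then have "norm x \<le> norm (z m x) + norm ((t x - t (z m x)) *\<^sub>R n)" by (metis norm_triangle_ineq)
        moreover have "\<bar>t x - t (z m x)\<bar> \<le> 1"
        proof -
          have "1 / real (Suc m) \<le> 1" by simp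
          then have "t (z m x) < 1" using tz(2)[of m x] by (rule order_less_le_trans[rotated])
          then show ?thesis using True tz(1)[of m x] by (simp add: J_def abs_le_iff)
        qed
        ultimately have "norm x \<le> R + 1" using R[of "z m x"] True nn by simp
        then show ?thesis using W[of "z m x"] Wp by (simp add: indicator_def)
      qed (use Wp in \<open>auto simp: k_def\<close>)
    qed
  qed (use AE1 in auto)
  have "(\<integral>x. indicator J x * h x \<partial>lborel) = face_integral n F w"
  proof -
    have cw: "continuous_on F w" using w continuous_on_subset FK K_def by blast
    have orth: "n \<bullet> (x - y) = 0" if "x \<in> F" "y \<in> F" for x y
      using bgrad_orthogonal_facet[OF c] that by (simp add: n_def F_def G_def)
    have mem: "x \<in> prism n F \<longleftrightarrow> P x \<in> F \<and> 0 \<le> t x \<and> t x \<le> 1" for x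
    proof
      assume "x \<in> prism n F"
      then obtain y r where y: "y \<in> F" "0 \<le> r" "r \<le> 1" "x = y + r *\<^sub>R n" by (auto simp: prism_def)
      then have "t x = r" using FK t_add by simp
      then show "P x \<in> F \<and> 0 \<le> t x \<and> t x \<le> 1" using y by (simp add: P_def)
    next
      assume "P x \<in> F \<and> 0 \<le> t x \<and> t x \<le> 1"
      then show "x \<in> prism n F"
        unfolding prism_def by (intro CollectI exI[of _ "P x"] exI[of _ "t x"]) (auto simp: P_def)
    qed
    have cp: "closest_point F x = P x" if "P x \<in> F" for x
    proof -
      have "closest_point F (P x + t x *\<^sub>R n) = P x"
        by (rule closest_point_normal[OF F(3,2) that orth])
      then show ?thesis by (simp add: P_def)
    qed
    \<comment> \<open>The slab is half-open while the prism is closed. They differ only at height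
      one, where \<open>bary c x = norm G\<close>.\<close>
    have "AE x in lborel. indicator J x * h x = indicator (prism n F) x * w (closest_point F x)"
      using AE_bary_ne[OF c, of "norm G"]
    proof eventually_elim
      case (elim x)
      then have "t x \<noteq> 1" using Gp by (simp add: t_def)
      then show ?case using cp[of x] by (auto simp: h_def J_def mem indicator_def)
    qed
    moreover have "(\<lambda>x. indicator (prism n F) x * w (closest_point F x)) \<in> borel_measurable lborel"
      using face_integral_lborel(2)[OF F(1,3,4) cw] by blast
    ultimately show ?thesis
      unfolding face_integral_lborel(1)[OF F(1,3,4) cw] by (intro integral_cong_AE) auto
  qed
  with lim cells have "(\<lambda>m. real (Suc m) * (\<integral>x. indicator {x. 0 \<le> t x \<and> t x < 1 / real (Suc m)} x * k x \<partial>lborel))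
      \<longlonglongrightarrow> face_integral n F w" by simp
  moreover have "indicator {x. 0 \<le> t x \<and> t x < 1 / real (Suc m)} x * k x
      = indicator {x \<in> convex hull C. bary c x < \<delta> m} x * w x" for m x
  proof -
    have "0 \<le> t x" if "x \<in> K" using that c Gp by (simp add: t_def K_def mem_hull_iff)
    moreover have "t x < 1 / real (Suc m) \<longleftrightarrow> bary c x < \<delta> m" using Gp by (simp add: t_def \<delta>_def field_simps)
    ultimately show ?thesis by (auto simp: k_def K_def indicator_def)
  qed
  ultimately have "(\<lambda>m. real (Suc m) * (\<integral>x. indicator {x \<in> convex hull C. bary c x < \<delta> m} x * w x \<partial>lborel))
      \<longlonglongrightarrow> face_integral n F w" by simp
  from tendsto_divide[OF this tendsto_const[of "norm G"]] Gp
  show ?thesis by (simp add: \<delta>_def n_def F_def)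
qed


section \<open>Test functions\<close>

lemma tendsto_integral_L1:
  fixes f :: "nat \<Rightarrow> 'a \<Rightarrow> real"
  assumes "\<And>n. integrable M (f n)" "integrable M g"
    and "(\<lambda>n. \<integral>x. \<bar>f n x - g x\<bar> \<partial>M) \<longlonglongrightarrow> 0"
  shows "(\<lambda>n. \<integral>x. f n x \<partial>M) \<longlonglongrightarrow> (\<integral>x. g x \<partial>M)"
proof (rule Lim_transform2[OF tendsto_const])
  show "(\<lambda>n. (\<integral>x. g x \<partial>M) - (\<integral>x. f n x \<partial>M)) \<longlonglongrightarrow> 0"
  proof (rule Lim_null_comparison[OF _ assms(3)], rule always_eventually, rule allI)
    fix n
    have "(\<integral>x. g x \<partial>M) - (\<integral>x. f n x \<partial>M) = (\<integral>x. g x - f n x \<partial>M)"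
      using assms by simp
    also have "norm \<dots> \<le> (\<integral>x. norm (g x - f n x) \<partial>M)" by (rule integral_norm_bound)
    finally show "norm ((\<integral>x. g x \<partial>M) - (\<integral>x. f n x \<partial>M)) \<le> (\<integral>x. \<bar>f n x - g x\<bar> \<partial>M)"
      by (simp add: abs_minus_commute)
  qed
qed

text \<open>The elementary bound |f| \<le> e + f^2/e replaces the Cauchy-Schwarz inequality;
  finiteness of the measure controls the constant e.\<close>

lemma (in finite_measure) L2_null_imp_L1_null:
  fixes f h :: "nat \<Rightarrow> 'a \<Rightarrow> real"
  assumes m: "\<And>n. f n \<in> borel_measurable M" and h: "\<And>n. integrable M (h n)"
    and fh: "\<And>n x. (f n x)\<^sup>2 \<le> h n x" and lim: "(\<lambda>n. \<integral>x. h n x \<partial>M) \<longlonglongrightarrow> 0"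
  shows "integrable M (f n)" and "(\<lambda>n. \<integral>x. \<bar>f n x\<bar> \<partial>M) \<longlonglongrightarrow> 0"
proof -
  have bnd: "\<bar>f n x\<bar> \<le> e + h n x / e" if "e > 0" for e n x
  proof -
    have "\<bar>f n x\<bar> * e \<le> e\<^sup>2 + h n x"
    proof (cases "\<bar>f n x\<bar> \<le> e")
      case True
      then have "\<bar>f n x\<bar> * e \<le> e * e" using that by (intro mult_right_mono) auto
      moreover have "0 \<le> h n x" using fh[of n x] zero_le_power2 order_trans by blast
      ultimately show ?thesis by (simp add: power2_eq_square)
    next
      case False
      then have "\<bar>f n x\<bar> * e \<le> \<bar>f n x\<bar> * \<bar>f n x\<bar>" by (intro mult_left_mono) auto
      also have "\<dots> \<le> h n x" using fh[of n x] by (simp add: power2_eq_square abs_mult_self_eq)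
      finally show ?thesis using zero_le_power2[of e] by linarith
    qed
    then show ?thesis using that by (simp add: field_simps power2_eq_square)
  qed
  have int: "integrable M (\<lambda>x. e + h n x / e)" for e n using h by simp
  have intf: "integrable M (f n)" for n
    by (rule Bochner_Integration.integrable_bound[OF int[of 1 n] m]) (use bnd[of 1 n] in \<open>auto intro!: AE_I2 order_trans[OF _ abs_ge_self]\<close>)
  then show "integrable M (f n)" .
  show "(\<lambda>n. \<integral>x. \<bar>f n x\<bar> \<partial>M) \<longlonglongrightarrow> 0"
  proof (rule LIMSEQ_I)
    fix r :: real assume r: "0 < r"
    define \<mu> where "\<mu> = measure M (space M)"
    have \<mu>0: "0 \<le> \<mu>" by (simp add: \<mu>_def)
    \<comment> \<open>With this choice e \<mu> is at most r/2; the summand 1 avoids division by zero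
      when the measure vanishes.\<close>
    define e where "e = r / (2 * (\<mu> + 1))"
    have e: "0 < e" using r \<mu>0 by (simp add: e_def)
    have "0 < e * r / 2" using e r by simp
    then obtain N where N: "\<And>n. n \<ge> N \<Longrightarrow> norm ((\<integral>x. h n x \<partial>M) - 0) < e * r / 2"
      using LIMSEQ_D[OF lim] by metis
    have "norm ((\<integral>x. \<bar>f n x\<bar> \<partial>M) - 0) < r" if "n \<ge> N" for n
    proof -
      have "(\<integral>x. \<bar>f n x\<bar> \<partial>M) \<le> (\<integral>x. e + h n x / e \<partial>M)"
        by (rule integral_mono) (use intf int bnd[OF e] in auto)
      also have "\<dots> = e * \<mu> + (\<integral>x. h n x \<partial>M) / e" using h by (simp add: \<mu>_def)
      also have "\<dots> < e * \<mu> + r / 2"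
        using N[OF that] e by (simp add: pos_divide_less_eq mult.commute)
      also have "e * \<mu> \<le> r / 2"
      proof -
        have "e * \<mu> \<le> e * (\<mu> + 1)" using e by (intro mult_left_mono) auto
        also have "\<dots> = r / 2" using \<mu>0 unfolding e_def by (simp add: divide_simps)
        finally show ?thesis .
      qed
      finally have "(\<integral>x. \<bar>f n x\<bar> \<partial>M) < r" by simp
      moreover have "0 \<le> (\<integral>x. \<bar>f n x\<bar> \<partial>M)" by simp
      ultimately show ?thesis by simp
    qed
    then show "\<exists>N. \<forall>n\<ge>N. norm ((\<integral>x. \<bar>f n x\<bar> \<partial>M) - 0) < r" by blast
  qed
qed

section \<open>Classical gradients and compactly supported functions\<close>

lemma classical_gradI:
  assumes "(f has_derivative (\<lambda>h. g \<bullet> h)) (at x)"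
  shows "classical_grad f x = g"
  unfolding classical_grad_def frechet_derivative_at[OF assms, symmetric]
  by (simp add: vec_eq_iff inner_axis)

lemma classical_grad_derivative:
  fixes f :: "real^'d \<Rightarrow> real"
  assumes "f differentiable at x"
  shows "(f has_derivative (\<lambda>h. classical_grad f x \<bullet> h)) (at x)"
proof -
  let ?D = "frechet_derivative f (at x)"
  have D: "(f has_derivative ?D) (at x)" using assms frechet_derivative_works by blast
  then have lin: "linear ?D" using has_derivative_linear by blast
  have "?D h = classical_grad f x \<bullet> h" for h
  proof -
    have "?D h = ?D (\<Sum>i\<in>UNIV. h $ i *\<^sub>R axis i 1)"
      using basis_expansion[of h] by (simp add: scalar_mult_eq_scaleR)
    also have "\<dots> = (\<Sum>i\<in>UNIV. h $ i * ?D (axis i 1))"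
      by (simp add: linear_sum[OF lin] linear_cmul[OF lin])
    also have "\<dots> = classical_grad f x \<bullet> h"
      by (simp add: classical_grad_def inner_vec_def mult.commute)
    finally show ?thesis .
  qed
  then show ?thesis using D by (metis (no_types, lifting) ext)
qed

lemma test_functionsI:
  assumes "\<And>x. (\<psi> has_derivative (\<lambda>h. g x \<bullet> h)) (at x)" "continuous_on UNIV g"
    and "closed K" "K \<subseteq> S" "bounded K" "\<And>x. x \<notin> K \<Longrightarrow> \<psi> x = 0"
  shows "\<psi> \<in> test_functions S"
proof -
  have "classical_grad \<psi> = g" using classical_gradI[OF assms(1)] by blast
  have K: "closure {x. \<psi> x \<noteq> 0} \<subseteq> K"
  proof (rule closure_minimal[OF _ assms(3)])
    show "{x. \<psi> x \<noteq> 0} \<subseteq> K" using assms(6) by blast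
  qed
  have "compact (closure {x. \<psi> x \<noteq> 0})"
    using bounded_subset[OF assms(5) K] by (simp add: compact_eq_bounded_closed)
  moreover have "\<psi> differentiable at x" for x using assms(1) differentiableI by blast
  ultimately show ?thesis
    using K assms(2,4) \<open>classical_grad \<psi> = g\<close> unfolding test_functions_def by blast
qed

lemma test_functionsD:
  assumes "\<psi> \<in> test_functions S"
  shows "(\<psi> has_derivative (\<lambda>h. classical_grad \<psi> x \<bullet> h)) (at x)"
    and "continuous_on UNIV (classical_grad \<psi>)" and "continuous_on A \<psi>"
    and "compact (closure {x. \<psi> x \<noteq> 0})" and "closure {x. \<psi> x \<noteq> 0} \<subseteq> S"
proof -
  show "(\<psi> has_derivative (\<lambda>h. classical_grad \<psi> x \<bullet> h)) (at x)" for x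
    using assms classical_grad_derivative by (auto simp: test_functions_def)
  then show "continuous_on A \<psi>" by (rule gradient_continuous_on)
qed (use assms in \<open>auto simp: test_functions_def\<close>)

lemma classical_grad_outside_support:
  assumes "\<psi> \<in> test_functions S" "x \<notin> closure {x. \<psi> x \<noteq> 0}"
  shows "classical_grad \<psi> x = 0"
proof (rule classical_gradI)
  show "(\<psi> has_derivative (\<lambda>h. 0 \<bullet> h)) (at x)"
  proof (rule has_derivative_transform_within_open[of "\<lambda>_. 0" _ x UNIV "- closure {x. \<psi> x \<noteq> 0}"])
    show "0 = \<psi> y" if "y \<in> - closure {x. \<psi> x \<noteq> 0}" for y
      using that closure_subset[of "{x. \<psi> x \<noteq> 0}"] by auto
    show "x \<in> - closure {x. \<psi> x \<noteq> 0}" using assms(2) by simp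
    show "open (- closure {x. \<psi> x \<noteq> 0})" by (rule open_Compl[OF closed_closure])
  qed simp
qed

text \<open>By translation invariance the difference quotients in direction \<open>v\<close> have integral zero.\<close>

lemma integral_gradient_compact_support:
  fixes \<phi> :: "'a::euclidean_space \<Rightarrow> real"
  assumes der: "\<And>x. (\<phi> has_derivative (\<lambda>h. g x \<bullet> h)) (at x)" and cont: "continuous_on UNIV g"
    and supp: "\<And>x. R < norm x \<Longrightarrow> \<phi> x = 0"
  shows "(\<integral>x. g x \<bullet> v \<partial>lborel) = 0"
proof -
  \<comment> \<open>The shifts are no longer than \<open>v\<close>, so this ball contains the
    supports of all difference quotients.\<close>
  define R' where "R' = \<bar>R\<bar> + norm v"
  obtain L where L: "0 \<le> L" "\<And>x y. x \<in> cball 0 (R' + norm v) \<Longrightarrow> y \<in> cball 0 (R' + norm v) \<Longrightarrow> \<bar>\<phi> x - \<phi> y\<bar> \<le> L * norm (x - y)"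
    using gradient_lipschitz_on_ball[OF der cont, of 0 "R' + norm v"] by metis
  have cont\<phi>: "continuous_on S \<phi>" for S using gradient_continuous_on[OF der] .
  have [measurable]: "\<phi> \<in> borel_measurable borel" by (intro borel_measurable_continuous_onI cont\<phi>)
  have [measurable]: "g \<in> borel_measurable borel" by (intro borel_measurable_continuous_onI cont)
  obtain P where P: "\<And>x. x \<in> cball 0 R' \<Longrightarrow> \<bar>\<phi> x\<bar> \<le> P"
    using continuous_on_compact_abs_bound[OF compact_cball cont\<phi>] by metis
  have supp': "\<phi> x = 0" if "x \<notin> cball 0 R'" for x
  proof (rule supp)
    have "R' < norm x" using that by simp
    then show "R < norm x" using norm_ge_zero[of v] unfolding R'_def by linarith
  qed
  have i0: "integrable lborel \<phi>"
    by (rule lborel_integrable_bounded[OF _ bounded_cball supp' P]) measurable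
  define q where "q n x = (\<phi> (x + (1 / real (Suc n)) *\<^sub>R v) - \<phi> x) * real (Suc n)" for n x
  have sm: "norm ((1 / real (Suc n)) *\<^sub>R v) \<le> norm v" for n
    by (simp add: divide_le_eq mult_le_cancel_left1)
  have "(\<lambda>n. \<integral>x. q n x \<partial>lborel) \<longlonglongrightarrow> (\<integral>x. g x \<bullet> v \<partial>lborel)"
  proof (rule integral_dominated_convergence[where w="\<lambda>x. indicator (cball 0 R') x * (L * norm v)"])
    show "integrable lborel (\<lambda>x::'a. indicator (cball 0 R') x * (L * norm v))"
      by (rule integrable_indicator_cball)
    show "AE x in lborel. (\<lambda>n. q n x) \<longlonglongrightarrow> g x \<bullet> v"
    proof (rule AE_I2)
      fix x
      have "((\<lambda>t. x + t *\<^sub>R v) has_derivative (\<lambda>t. t *\<^sub>R v)) (at 0)"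
        by (auto intro!: derivative_eq_intros)
      moreover have "(\<phi> has_derivative (\<lambda>h. g x \<bullet> h)) (at (x + 0 *\<^sub>R v))" using der by simp
      ultimately have "((\<lambda>t. \<phi> (x + t *\<^sub>R v)) has_derivative (\<lambda>t. g x \<bullet> (t *\<^sub>R v))) (at 0)"
        by (rule has_derivative_compose)
      then have "((\<lambda>t. \<phi> (x + t *\<^sub>R v)) has_real_derivative g x \<bullet> v) (at 0)"
        by (simp add: has_field_derivative_def mult_commute_abs)
      from deriv_imp_difference_quotients[OF this]
      show "(\<lambda>n. q n x) \<longlonglongrightarrow> g x \<bullet> v" by (simp add: q_def del: of_nat_Suc)
    qed
    show "AE x in lborel. norm (q n x) \<le> indicator (cball 0 R') x * (L * norm v)" for n
    proof (rule AE_I2)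
      fix x :: 'a
      let ?y = "x + (1 / real (Suc n)) *\<^sub>R v"
      have "norm ?y \<le> norm x + norm ((1 / real (Suc n)) *\<^sub>R v)" by (rule norm_triangle_ineq)
      moreover have "norm (?y - (1 / real (Suc n)) *\<^sub>R v) \<le> norm ?y + norm ((1 / real (Suc n)) *\<^sub>R v)"
        by (rule norm_triangle_ineq4)
      moreover have "?y - (1 / real (Suc n)) *\<^sub>R v = x" by simp
      ultimately have nx: "norm ?y \<le> norm x + norm v" "norm x \<le> norm ?y + norm v"
        using sm[of n] by simp_all
      show "norm (q n x) \<le> indicator (cball 0 R') x * (L * norm v)"
      proof (cases "x \<in> cball 0 R'")
        case True
        have "\<bar>\<phi> ?y - \<phi> x\<bar> \<le> L * norm (?y - x)"
          using True nx by (intro L(2)) auto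
        then have "\<bar>\<phi> ?y - \<phi> x\<bar> \<le> L * norm v / real (Suc n)" by simp
        then show ?thesis using True by (simp add: q_def abs_mult pos_le_divide_eq del: of_nat_Suc)
      next
        case False
        then have "\<bar>R\<bar> + norm v < norm x" by (simp add: R'_def)
        then have "R < norm x" "R < norm ?y" using nx norm_ge_zero[of v] by linarith+
        then have "q n x = 0" unfolding q_def using supp by simp
        then show ?thesis using False by simp
      qed
    qed
  next
    show "q n \<in> borel_measurable lborel" for n unfolding q_def by measurable
  qed measurable
  moreover have "(\<integral>x. q n x \<partial>lborel) = 0" for n
  proof -
    have "integrable lborel (\<lambda>x. \<phi> (x + (1 / real (Suc n)) *\<^sub>R v))"
    proof (rule lborel_integrable_bounded[OF _ bounded_cball[of 0 "R' + norm v"]])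
      show "\<phi> (x + (1 / real (Suc n)) *\<^sub>R v) = 0" if "x \<notin> cball 0 (R' + norm v)" for x
      proof (rule supp')
        let ?y = "x + (1 / real (Suc n)) *\<^sub>R v"
        have "norm (?y - (1 / real (Suc n)) *\<^sub>R v) \<le> norm ?y + norm ((1 / real (Suc n)) *\<^sub>R v)"
          by (rule norm_triangle_ineq4)
        then have "norm x \<le> norm ?y + norm v" using sm[of n] by (simp del: of_nat_Suc)
        moreover have "R' + norm v < norm x" using that by simp
        ultimately have "R' < norm ?y" by linarith
        then show "?y \<notin> cball 0 R'" by simp
      qed
      show "\<bar>\<phi> (x + (1 / real (Suc n)) *\<^sub>R v)\<bar> \<le> max P 0" for x
        using P[of "x + (1 / real (Suc n)) *\<^sub>R v"] supp'[of "x + (1 / real (Suc n)) *\<^sub>R v"]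
        by (cases "x + (1 / real (Suc n)) *\<^sub>R v \<in> cball 0 R'") (auto simp del: of_nat_Suc)
    qed measurable
    moreover have "(\<integral>x. \<phi> (x + (1 / real (Suc n)) *\<^sub>R v) \<partial>lborel) = (\<integral>x. \<phi> x \<partial>lborel)"
      by (rule lborel_integral_translation) measurable
    ultimately show ?thesis using i0 by (simp add: q_def)
  qed
  ultimately show ?thesis by (simp add: LIMSEQ_const_iff)
qed

lemma integrable_compact_support:
  fixes f :: "'a::euclidean_space \<Rightarrow> real"
  assumes f: "continuous_on UNIV f" and Z: "compact Z" and f0: "\<And>x. x \<notin> Z \<Longrightarrow> f x = 0"
  shows "integrable lborel f"
proof -
  have "continuous_on Z f" using f continuous_on_subset by blast
  then obtain B where B: "\<And>x. x \<in> Z \<Longrightarrow> \<bar>f x\<bar> \<le> B"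
    using continuous_on_compact_abs_bound[OF Z] by blast
  show ?thesis
    by (rule lborel_integrable_bounded[OF borel_measurable_continuous_onI[OF f] compact_imp_bounded[OF Z] f0 B])
qed

text \<open>The product \<psi> \<zeta> inherits the compact support of \<zeta>, so the integral of
  its gradient vanishes.\<close>

lemma test_function_integration_by_parts:
  fixes \<psi> \<zeta> :: "real^'d \<Rightarrow> real"
  assumes \<psi>: "\<And>x. \<psi> differentiable at x" "continuous_on UNIV (classical_grad \<psi>)"
    and \<zeta>: "\<zeta> \<in> test_functions S"
  shows "(\<integral>x. \<psi> x * classical_grad \<zeta> x $ i \<partial>lborel) = - (\<integral>x. classical_grad \<psi> x $ i * \<zeta> x \<partial>lborel)"
proof -
  define S0 where "S0 = closure {x. \<zeta> x \<noteq> 0}"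
  note d\<zeta> = test_functionsD[OF \<zeta>, folded S0_def]
  have d\<psi>: "(\<psi> has_derivative (\<lambda>h. classical_grad \<psi> x \<bullet> h)) (at x)" for x
    by (rule classical_grad_derivative[OF \<psi>(1)])
  have c\<psi>: "continuous_on A \<psi>" for A by (rule gradient_continuous_on[OF d\<psi>])
  have out: "\<zeta> x = 0" if "x \<notin> S0" for x using that closure_subset[of "{x. \<zeta> x \<noteq> 0}"] unfolding S0_def by auto
  obtain R where R: "\<And>x. x \<in> S0 \<Longrightarrow> norm x \<le> R"
    using compact_imp_bounded[OF d\<zeta>(4)] unfolding bounded_iff by blast
  define g where "g x = \<psi> x *\<^sub>R classical_grad \<zeta> x + \<zeta> x *\<^sub>R classical_grad \<psi> x" for x
  note int = integrable_compact_support[OF _ d\<zeta>(4)]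
  have 0: "(\<integral>x. g x \<bullet> axis i 1 \<partial>lborel) = 0"
  proof (rule integral_gradient_compact_support[of "\<lambda>x. \<psi> x * \<zeta> x" g R])
    show "((\<lambda>x. \<psi> x * \<zeta> x) has_derivative (\<lambda>h. g x \<bullet> h)) (at x)" for x
    proof -
      have "((\<lambda>x. \<psi> x * \<zeta> x) has_derivative
          (\<lambda>h. \<psi> x * (classical_grad \<zeta> x \<bullet> h) + (classical_grad \<psi> x \<bullet> h) * \<zeta> x)) (at x)"
        by (rule has_derivative_mult[OF d\<psi> d\<zeta>(1)])
      moreover have "(\<lambda>h. \<psi> x * (classical_grad \<zeta> x \<bullet> h) + (classical_grad \<psi> x \<bullet> h) * \<zeta> x)
          = (\<lambda>h. g x \<bullet> h)"
        by (rule ext) (simp add: g_def inner_add_left mult.commute)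
      ultimately show ?thesis by (simp only:)
    qed
    show "continuous_on UNIV g"
      unfolding g_def
      by (intro continuous_on_add continuous_on_scaleR c\<psi> d\<zeta>(2,3) \<psi>(2))
    show "\<psi> x * \<zeta> x = 0" if "R < norm x" for x
    proof -
      have "x \<notin> S0" using R[of x] that by auto
      then show ?thesis using out by simp
    qed
  qed
  have eq: "(\<integral>x. g x \<bullet> axis i 1 \<partial>lborel)
      = (\<integral>x. \<psi> x * classical_grad \<zeta> x $ i + classical_grad \<psi> x $ i * \<zeta> x \<partial>lborel)"
    by (rule Bochner_Integration.integral_cong) (simp_all add: g_def inner_axis mult.commute)
  have i1: "integrable lborel (\<lambda>x. \<psi> x * classical_grad \<zeta> x $ i)"
    by (rule int[OF continuous_on_mult[OF c\<psi> continuous_on_component[OF d\<zeta>(2)]]])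
       (simp add: classical_grad_outside_support[OF \<zeta>, folded S0_def])
  have i2: "integrable lborel (\<lambda>x. classical_grad \<psi> x $ i * \<zeta> x)"
    by (rule int[OF continuous_on_mult[OF continuous_on_component[OF \<psi>(2)] d\<zeta>(3)]])
       (simp add: out)
  show ?thesis
    using 0 unfolding eq Bochner_Integration.integral_add[OF i1 i2] by linarith
qed


section \<open>Limits of test functions\<close>

lemma borel_measurable_lebesgue_on:
  "f \<in> borel_measurable borel \<Longrightarrow> f \<in> borel_measurable (lebesgue_on S)"
  by (intro measurable_restrict_space1 measurable_completion) simp

text \<open>Restrictions to two different sets are compared through extensions by zero, which makes
  \<Omega> and the union of the open elements interchangeable.\<close>

lemma lebesgue_on_cong_AE:
  fixes f g :: "'a::euclidean_space \<Rightarrow> 'b::euclidean_space"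
  assumes A: "A \<in> sets lebesgue" and B: "B \<in> sets lebesgue" and f: "f \<in> borel_measurable (lebesgue_on A)"
    and AE: "AE x in lebesgue. indicator A x *\<^sub>R f x = indicator B x *\<^sub>R g x"
  shows "g \<in> borel_measurable (lebesgue_on B)"
    and "integrable (lebesgue_on A) f \<longleftrightarrow> integrable (lebesgue_on B) g"
    and "integral\<^sup>L (lebesgue_on A) f = integral\<^sup>L (lebesgue_on B) g"
proof -
  have mA: "(\<lambda>x. indicator A x *\<^sub>R f x) \<in> borel_measurable lebesgue"
    using f A by (simp add: borel_measurable_restrict_space_iff)
  have mB: "(\<lambda>x. indicator B x *\<^sub>R g x) \<in> borel_measurable lebesgue"
    by (rule borel_measurable_AE[OF mA AE])
  then show "g \<in> borel_measurable (lebesgue_on B)"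
    using B by (simp add: borel_measurable_restrict_space_iff)
  show "integrable (lebesgue_on A) f \<longleftrightarrow> integrable (lebesgue_on B) g"
    using A B integrable_cong_AE[OF mA mB AE] by (simp add: integrable_restrict_space)
  show "integral\<^sup>L (lebesgue_on A) f = integral\<^sup>L (lebesgue_on B) g"
    using A B integral_cong_AE[OF mA mB AE] by (simp add: integral_restrict_space)
qed

lemma lebesgue_on_AE_eq:
  fixes f :: "'a::euclidean_space \<Rightarrow> 'b::euclidean_space"
  assumes A: "A \<in> sets lebesgue" and B: "B \<in> sets lebesgue"
    and AE: "AE x in lebesgue. x \<in> A \<longleftrightarrow> x \<in> B"
    and f: "f \<in> borel_measurable (lebesgue_on A)"
  shows "f \<in> borel_measurable (lebesgue_on B)"
    and "integrable (lebesgue_on A) f \<longleftrightarrow> integrable (lebesgue_on B) f"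
    and "integral\<^sup>L (lebesgue_on A) f = integral\<^sup>L (lebesgue_on B) f"
proof -
  have "AE x in lebesgue. indicator A x *\<^sub>R f x = indicator B x *\<^sub>R f x"
    using AE by eventually_elim (simp add: indicator_def)
  note cong = lebesgue_on_cong_AE[OF A B f this]
  show "f \<in> borel_measurable (lebesgue_on B)" by (rule cong(1))
  show "integrable (lebesgue_on A) f \<longleftrightarrow> integrable (lebesgue_on B) f" by (rule cong(2))
  show "integral\<^sup>L (lebesgue_on A) f = integral\<^sup>L (lebesgue_on B) f" by (rule cong(3))
qed

lemma integral_lebesgue_on_borel:
  fixes f :: "'a::euclidean_space \<Rightarrow> real"
  assumes A: "A \<in> sets lebesgue" and f: "f \<in> borel_measurable borel"
    and AE: "AE x in lebesgue. x \<notin> A \<longrightarrow> f x = 0"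
  shows "(\<integral>x. f x \<partial>lebesgue_on A) = (\<integral>x. f x \<partial>lborel)"
proof -
  have m: "f \<in> borel_measurable lebesgue" using f by (intro measurable_completion) simp
  have m': "(\<lambda>x. indicator A x *\<^sub>R f x) \<in> borel_measurable lebesgue"
    using m A by (intro borel_measurable_scaleR borel_measurable_indicator)
  have "(\<integral>x. f x \<partial>lebesgue_on A) = (\<integral>x. indicator A x *\<^sub>R f x \<partial>lebesgue)"
    using A by (simp add: integral_restrict_space)
  also have "\<dots> = (\<integral>x. f x \<partial>lebesgue)"
    by (rule integral_cong_AE[OF m' m]) (use AE in eventually_elim, auto simp: indicator_def)
  also have "\<dots> = (\<integral>x. f x \<partial>lborel)" using f by (intro integral_completion) simp
  finally show ?thesis .
qed

lemma open_bounded_lmeasurable: "open S \<Longrightarrow> bounded S \<Longrightarrow> S \<in> lmeasurable"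
  for S :: "'a::euclidean_space set"
  by (rule lmeasurable_open)

lemma L2_space_integrable:
  assumes "S \<in> lmeasurable" "v \<in> L2_space S"
  shows "integrable (lebesgue_on S) v"
proof -
  interpret finite_measure "lebesgue_on S" by (rule finite_measure_lebesgue_on[OF assms(1)])
  have v: "v \<in> borel_measurable (lebesgue_on S)" "integrable (lebesgue_on S) (\<lambda>x. (norm (v x))\<^sup>2)"
    using assms(2) by (auto simp: L2_space_def)
  have "norm (v x) \<le> norm (1 + (norm (v x))\<^sup>2)" for x
  proof -
    have "0 \<le> (norm (v x) - 1)\<^sup>2" by simp
    then have "2 * norm (v x) \<le> 1 + (norm (v x))\<^sup>2" by (simp add: power2_eq_square algebra_simps)
    then show ?thesis using norm_ge_zero[of "v x"] by (simp del: norm_ge_zero)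
  qed
  then have AE: "AE x in lebesgue_on S. norm (v x) \<le> norm (1 + (norm (v x))\<^sup>2)"
    by (intro AE_I2)
  have "integrable (lebesgue_on S) (\<lambda>x. 1 + (norm (v x))\<^sup>2)" using v(2) by simp
  then show ?thesis by (rule Bochner_Integration.integrable_bound[OF _ v(1) AE])
qed

lemma L2_space_AE_eq:
  fixes v :: "real^'d \<Rightarrow> 'b::euclidean_space"
  assumes "A \<in> sets lebesgue" "B \<in> sets lebesgue" "AE x in lebesgue. x \<in> A \<longleftrightarrow> x \<in> B"
    and v: "v \<in> L2_space A"
  shows "v \<in> L2_space B"
proof -
  have m: "v \<in> borel_measurable (lebesgue_on A)"
    and i: "integrable (lebesgue_on A) (\<lambda>x. (norm (v x))\<^sup>2)"
    using v unfolding L2_space_def by blast+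
  have "v \<in> borel_measurable (lebesgue_on B)"
    by (rule lebesgue_on_AE_eq(1)[OF assms(1-3) m])
  moreover have "integrable (lebesgue_on B) (\<lambda>x. (norm (v x))\<^sup>2)"
    by (rule iffD1[OF lebesgue_on_AE_eq(2)[OF assms(1-3) borel_measurable_integrable[OF i]] i])
  ultimately show ?thesis unfolding L2_space_def by blast
qed

text \<open>Convergence is recorded only in L1, since every functional used later has bounded
  coefficients. Integrability is stated separately because the integral of a non-integrable function
  is 0 by convention, and the limits alone would carry no information.\<close>

definition H1_limit ::
  "(real^'d) set \<Rightarrow> (real^'d \<Rightarrow> real) \<Rightarrow> (real^'d \<Rightarrow> real^'d) \<Rightarrow> (nat \<Rightarrow> real^'d \<Rightarrow> real) \<Rightarrow> bool" where
  "H1_limit \<Omega> v g \<psi> \<longleftrightarrow> v \<in> L2_space \<Omega> \<and> g \<in> L2_space \<Omega> \<and> (\<forall>n. \<psi> n \<in> test_functions \<Omega>) \<and>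
     (\<forall>n. integrable (lebesgue_on \<Omega>) (\<lambda>x. \<psi> n x - v x)) \<and>
     (\<forall>n. integrable (lebesgue_on \<Omega>) (\<lambda>x. norm (classical_grad (\<psi> n) x - g x))) \<and>
     (\<lambda>n. \<integral>x. \<bar>\<psi> n x - v x\<bar> \<partial>lebesgue_on \<Omega>) \<longlonglongrightarrow> 0 \<and>
     (\<lambda>n. \<integral>x. norm (classical_grad (\<psi> n) x - g x) \<partial>lebesgue_on \<Omega>) \<longlonglongrightarrow> 0"

lemma test_function_borel:
  assumes "\<psi> \<in> test_functions S"
  shows "\<psi> \<in> borel_measurable borel" "classical_grad \<psi> \<in> borel_measurable borel"
  by (intro borel_measurable_continuous_onI test_functionsD[OF assms])+

text \<open>The limit in \<open>H10\<close> becomes meaningful once its integrand is known to be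
  integrable. Then convergence in L2 gives convergence in L1 on the bounded set.\<close>

lemma H10_H1_limit:
  fixes \<Omega> :: "(real^'d) set"
  assumes v: "v \<in> H10 \<Omega>" and \<Omega>: "open \<Omega>" "bounded \<Omega>"
  obtains \<psi> g where "H1_limit \<Omega> v g \<psi>"
proof -
  obtain g \<psi> where g: "H1_with_grad \<Omega> v g" and \<psi>: "\<And>n. \<psi> n \<in> test_functions \<Omega>"
    and lim: "(\<lambda>n::nat. integral\<^sup>L (lebesgue_on \<Omega>)
            (\<lambda>x. (\<psi> n x - v x)\<^sup>2 + (norm (classical_grad (\<psi> n) x - g x))\<^sup>2)) \<longlonglongrightarrow> 0"
    using v unfolding H10_def by blast
  let ?M = "lebesgue_on \<Omega>"
  interpret finite_measure ?M
    by (rule finite_measure_lebesgue_on[OF open_bounded_lmeasurable[OF \<Omega>]])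
  have L2: "v \<in> L2_space \<Omega>" "g \<in> L2_space \<Omega>" using g by (auto simp: H1_with_grad_def)
  have vm: "v \<in> borel_measurable ?M" "g \<in> borel_measurable ?M"
    and v2: "integrable ?M (\<lambda>x. (norm (v x))\<^sup>2)" "integrable ?M (\<lambda>x. (norm (g x))\<^sup>2)"
    using L2 by (auto simp: L2_space_def)
  have \<psi>m: "\<psi> n \<in> borel_measurable ?M" "classical_grad (\<psi> n) \<in> borel_measurable ?M" for n
    by (rule borel_measurable_lebesgue_on[OF test_function_borel(1)[OF \<psi>]],
        rule borel_measurable_lebesgue_on[OF test_function_borel(2)[OF \<psi>]])
  \<comment> \<open>A continuous function is bounded on the compact closure of \<Omega>, so |f -
    w|^2 \<le> 2|f|^2 + 2|w|^2 is dominated.\<close>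
  have sq: "integrable ?M (\<lambda>x. (norm (f x - w x))\<^sup>2)"
    if f: "continuous_on UNIV f" and fm: "f \<in> borel_measurable ?M"
      and w: "w \<in> borel_measurable ?M" "integrable ?M (\<lambda>x. (norm (w x))\<^sup>2)"
    for f w :: "real^'d \<Rightarrow> 'b::euclidean_space"
  proof -
    have "compact (closure \<Omega>)" using \<Omega>(2) by (simp add: compact_closure)
    moreover have "continuous_on (closure \<Omega>) (\<lambda>x. 2 * (norm (f x))\<^sup>2)"
      by (intro continuous_intros continuous_on_subset[OF f]) auto
    ultimately obtain B where B: "\<And>x. x \<in> closure \<Omega> \<Longrightarrow> \<bar>2 * (norm (f x))\<^sup>2\<bar> \<le> B"
      using continuous_on_compact_abs_bound by blast
    have "norm ((norm (f x - w x))\<^sup>2) \<le> norm (B + 2 * (norm (w x))\<^sup>2)" if "x \<in> \<Omega>" for x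
    proof -
      have "(norm (f x - w x))\<^sup>2 \<le> (norm (f x) + norm (w x))\<^sup>2"
        by (intro power_mono norm_triangle_ineq4) simp
      also have "\<dots> \<le> 2 * (norm (f x))\<^sup>2 + 2 * (norm (w x))\<^sup>2"
        using sum_squares_bound[of "norm (f x)" "norm (w x)"] by (simp add: power2_sum)
      also have "\<dots> \<le> B + 2 * (norm (w x))\<^sup>2" using B[of x] that closure_subset[of \<Omega>] by auto
      finally show ?thesis by (simp add: order_trans[OF _ abs_ge_self])
    qed
    then have "AE x in ?M. norm ((norm (f x - w x))\<^sup>2) \<le> norm (B + 2 * (norm (w x))\<^sup>2)"
      by (intro AE_I2) (auto simp: space_restrict_space simp del: real_norm_def)
    show ?thesis
    proof (rule Bochner_Integration.integrable_bound)
      show "integrable ?M (\<lambda>x. B + 2 * (norm (w x))\<^sup>2)" using w(2) by simp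
      show "(\<lambda>x. (norm (f x - w x))\<^sup>2) \<in> borel_measurable ?M"
        using fm w(1) by measurable
    qed fact
  qed
  define h where "h n x = (\<psi> n x - v x)\<^sup>2 + (norm (classical_grad (\<psi> n) x - g x))\<^sup>2" for n x
  have hi: "integrable ?M (h n)" for n
  proof -
    have "integrable ?M (\<lambda>x. (norm (\<psi> n x - v x))\<^sup>2)"
      by (rule sq[OF test_functionsD(3)[OF \<psi>] \<psi>m(1) vm(1) v2(1)])
    moreover have "integrable ?M (\<lambda>x. (norm (classical_grad (\<psi> n) x - g x))\<^sup>2)"
      by (rule sq[OF test_functionsD(2)[OF \<psi>] \<psi>m(2) vm(2) v2(2)])
    ultimately show ?thesis unfolding h_def by (intro Bochner_Integration.integrable_add) simp_all
  qed
  have hlim: "(\<lambda>n. \<integral>x. h n x \<partial>?M) \<longlonglongrightarrow> 0" using lim by (simp add: h_def)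
  have m1: "(\<lambda>x. \<psi> n x - v x) \<in> borel_measurable ?M" for n
    using \<psi>m(1)[of n] vm(1) by measurable
  have m2: "(\<lambda>x. norm (classical_grad (\<psi> n) x - g x)) \<in> borel_measurable ?M" for n
    using \<psi>m(2)[of n] vm(2) by measurable
  have le1: "(\<psi> n x - v x)\<^sup>2 \<le> h n x" "(norm (classical_grad (\<psi> n) x - g x))\<^sup>2 \<le> h n x" for n x
    by (simp_all add: h_def)
  have "(\<lambda>n. \<integral>x. \<bar>norm (classical_grad (\<psi> n) x - g x)\<bar> \<partial>?M) \<longlonglongrightarrow> 0"
    by (rule L2_null_imp_L1_null(2)[of "\<lambda>n x. norm (classical_grad (\<psi> n) x - g x)", OF m2 hi le1(2) hlim])
  then have "H1_limit \<Omega> v g \<psi>"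
    unfolding H1_limit_def
    using L2 \<psi> L2_null_imp_L1_null[of "\<lambda>n x. \<psi> n x - v x", OF m1 hi le1(1) hlim]
      L2_null_imp_L1_null(1)[of "\<lambda>n x. norm (classical_grad (\<psi> n) x - g x)", OF m2 hi le1(2) hlim]
    by simp
  then show ?thesis by (rule that)
qed

text \<open>The functional differs from its limit by at most B times the sum of the two L1
  distances, with one common bound \<open>B\<close> for both weights.\<close>

lemma H1_limit_functional:
  fixes \<Omega> :: "(real^'d) set"
  assumes lim: "H1_limit \<Omega> v g \<psi>" and \<Omega>: "open \<Omega>" "bounded \<Omega>"
    and b: "b \<in> borel_measurable borel" "\<And>x. \<bar>b x\<bar> \<le> B"
    and w: "w \<in> borel_measurable borel" "\<And>x. norm (w x) \<le> B"
  shows "integrable (lebesgue_on \<Omega>) (\<lambda>x. b x * v x + g x \<bullet> w x)"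
    and "(\<lambda>n. \<integral>x. b x * \<psi> n x + classical_grad (\<psi> n) x \<bullet> w x \<partial>lebesgue_on \<Omega>)
      \<longlonglongrightarrow> (\<integral>x. b x * v x + g x \<bullet> w x \<partial>lebesgue_on \<Omega>)"
proof -
  let ?a = "\<lambda>n x. b x * \<psi> n x + classical_grad (\<psi> n) x \<bullet> w x"
  let ?l = "\<lambda>x. b x * v x + g x \<bullet> w x"
  let ?p = "\<lambda>n x. \<bar>\<psi> n x - v x\<bar>"
  let ?q = "\<lambda>n x. norm (classical_grad (\<psi> n) x - g x)"
  let ?M = "lebesgue_on \<Omega>"
  have lm: "\<Omega> \<in> lmeasurable" by (rule open_bounded_lmeasurable[OF \<Omega>])
  have \<psi>: "\<And>n. \<psi> n \<in> test_functions \<Omega>" using lim by (simp add: H1_limit_def)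
  have B0: "0 \<le> B" using b(2)[of 0] by linarith
  have bm: "b \<in> borel_measurable ?M" "w \<in> borel_measurable ?M"
    using b w by (auto intro: borel_measurable_lebesgue_on)
  have ints: "integrable ?M (\<lambda>x. b x * f x + h x \<bullet> w x)"
    if f: "integrable ?M f" and h: "integrable ?M h" for f and h :: "real^'d \<Rightarrow> real^'d"
  proof (rule Bochner_Integration.integrable_bound)
    show "integrable ?M (\<lambda>x. B * \<bar>f x\<bar> + B * norm (h x))" using f h by simp
    show "(\<lambda>x. b x * f x + h x \<bullet> w x) \<in> borel_measurable ?M"
      using bm borel_measurable_integrable[OF f] borel_measurable_integrable[OF h] by measurable
    show "AE x in ?M. norm (b x * f x + h x \<bullet> w x) \<le> norm (B * \<bar>f x\<bar> + B * norm (h x))"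
    proof (rule AE_I2)
      fix x
      have "\<bar>b x * f x\<bar> \<le> B * \<bar>f x\<bar>" unfolding abs_mult by (intro mult_right_mono b) simp
      moreover have "\<bar>h x \<bullet> w x\<bar> \<le> norm (h x) * norm (w x)" by (rule Cauchy_Schwarz_ineq2)
      moreover have "norm (h x) * norm (w x) \<le> norm (h x) * B" by (intro mult_left_mono w) simp
      ultimately have "\<bar>b x * f x + h x \<bullet> w x\<bar> \<le> B * \<bar>f x\<bar> + B * norm (h x)"
        by (simp add: mult.commute)
      then show "norm (b x * f x + h x \<bullet> w x) \<le> norm (B * \<bar>f x\<bar> + B * norm (h x))"
        by (simp add: order_trans[OF _ abs_ge_self])
    qed
  qed
  have vi: "integrable ?M v" "integrable ?M g"
    using lim L2_space_integrable[OF lm] by (auto simp: H1_limit_def)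
  show i1: "integrable ?M (\<lambda>x. ?l x)" by (rule ints[OF vi])
  have d1: "integrable ?M (\<lambda>x. \<psi> n x - v x)" for n using lim by (simp add: H1_limit_def)
  have d2: "integrable ?M (\<lambda>x. classical_grad (\<psi> n) x - g x)" for n
  proof -
    have "integrable ?M (\<lambda>x. ?q n x)" using lim by (simp add: H1_limit_def)
    moreover have "(\<lambda>x. classical_grad (\<psi> n) x - g x) \<in> borel_measurable ?M"
      using borel_measurable_lebesgue_on[OF test_function_borel(2)[OF \<psi>[of n]], of \<Omega>]
        borel_measurable_integrable[OF vi(2)] by measurable
    ultimately show ?thesis by (simp add: integrable_norm_iff)
  qed
  have i2: "integrable ?M (\<lambda>x. ?a n x)" for n
  proof (rule ints)
    have "integrable ?M (\<lambda>x. (\<psi> n x - v x) + v x)" by (intro Bochner_Integration.integrable_add d1 vi)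
    then show "integrable ?M (\<psi> n)" by simp
    have "integrable ?M (\<lambda>x. (classical_grad (\<psi> n) x - g x) + g x)"
      by (intro Bochner_Integration.integrable_add d2 vi)
    then show "integrable ?M (classical_grad (\<psi> n))" by simp
  qed
  show "(\<lambda>n. \<integral>x. ?a n x \<partial>?M)
      \<longlonglongrightarrow> (\<integral>x. ?l x \<partial>?M)"
  proof (rule tendsto_integral_L1[OF i2 i1])
    have l: "(\<lambda>n. B * (\<integral>x. ?p n x \<partial>?M)
        + B * (\<integral>x. ?q n x \<partial>?M)) \<longlonglongrightarrow> B * 0 + B * 0"
      using lim unfolding H1_limit_def by (intro tendsto_intros) auto
    show "(\<lambda>n. \<integral>x. \<bar>?a n x - (?l x)\<bar> \<partial>?M) \<longlonglongrightarrow> 0"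
    proof (rule tendsto_sandwich[OF _ _ tendsto_const l[simplified]])
      show "\<forall>\<^sub>F n in sequentially. 0 \<le> (\<integral>x. \<bar>?a n x - (?l x)\<bar> \<partial>?M)"
        by simp
      show "\<forall>\<^sub>F n in sequentially. (\<integral>x. \<bar>?a n x - (?l x)\<bar> \<partial>?M)
        \<le> B * (\<integral>x. ?p n x \<partial>?M) + B * (\<integral>x. ?q n x \<partial>?M)"
      proof (rule always_eventually, rule allI)
        fix n
        have "(\<integral>x. \<bar>?a n x - (?l x)\<bar> \<partial>?M)
           \<le> (\<integral>x. B * ?p n x + B * ?q n x \<partial>?M)"
        proof (rule integral_mono)
          show "integrable ?M (\<lambda>x. \<bar>?a n x - (?l x)\<bar>)"
            by (intro integrable_abs Bochner_Integration.integrable_diff i2 i1)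
          show "integrable ?M (\<lambda>x. B * ?p n x + B * ?q n x)"
            using d1 d2 by simp
          fix x
          have "?a n x - (?l x)
             = b x * (\<psi> n x - v x) + (classical_grad (\<psi> n) x - g x) \<bullet> w x"
            by (simp add: algebra_simps inner_diff_left)
          moreover have "\<bar>b x * (\<psi> n x - v x)\<bar> \<le> B * ?p n x"
            unfolding abs_mult by (intro mult_right_mono b) simp
          moreover have "\<bar>(classical_grad (\<psi> n) x - g x) \<bullet> w x\<bar> \<le> ?q n x * norm (w x)"
            by (rule Cauchy_Schwarz_ineq2)
          moreover have "?q n x * norm (w x) \<le> ?q n x * B"
            by (intro mult_left_mono w) simp
          ultimately show "\<bar>?a n x - (?l x)\<bar>
              \<le> B * ?p n x + B * ?q n x"
            by (simp add: mult.commute)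
        qed
        also have "\<dots> = B * (\<integral>x. ?p n x \<partial>?M) + B * (\<integral>x. ?q n x \<partial>?M)"
          using d1 d2 by simp
        finally show "(\<integral>x. \<bar>?a n x - (?l x)\<bar> \<partial>?M)
        \<le> B * (\<integral>x. ?p n x \<partial>?M) + B * (\<integral>x. ?q n x \<partial>?M)" .
      qed
    qed
  qed
qed

text \<open>Passing from \<open>\<Omega>\<close> to the union \<open>S\<close> of the open elements, which need not be contained in \<open>\<Omega>\<close>
  (a slit of the domain may cross an element), is possible because the approximating test functions
  are smooth on the whole space.\<close>

lemma H1_limit_weak_gradient:
  fixes \<Omega> S :: "(real^'d) set"
  assumes lim: "H1_limit \<Omega> v g \<psi>" and \<Omega>: "open \<Omega>" "bounded \<Omega>" and S: "open S"
    and AE: "AE x in lebesgue. x \<in> \<Omega> \<longleftrightarrow> x \<in> S"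
  shows "H1_with_grad S v g"
proof -
  have sets: "\<Omega> \<in> sets lebesgue" "S \<in> sets lebesgue" using \<Omega> S by auto
  have \<psi>: "\<And>n. \<psi> n \<in> test_functions \<Omega>" using lim by (simp add: H1_limit_def)
  have L2: "v \<in> L2_space \<Omega>" "g \<in> L2_space \<Omega>" using lim by (auto simp: H1_limit_def)
  have vS: "v \<in> L2_space S" and gS: "g \<in> L2_space S"
    using L2_space_AE_eq[OF sets AE] L2 by blast+
  have "integral\<^sup>L (lebesgue_on S) (\<lambda>x. v x * classical_grad \<zeta> x $ i)
      = - integral\<^sup>L (lebesgue_on S) (\<lambda>x. g x $ i * \<zeta> x)" if \<zeta>: "\<zeta> \<in> test_functions S" for \<zeta> i
  proof -
    define Z where "Z = closure {x. \<zeta> x \<noteq> 0}"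
    note d\<zeta> = test_functionsD[OF \<zeta>, folded Z_def]
    have out: "\<zeta> x = 0" "classical_grad \<zeta> x = 0" if "x \<notin> Z" for x
    proof -
      show "\<zeta> x = 0" using that closure_subset[of "{x. \<zeta> x \<noteq> 0}"] unfolding Z_def by blast
      show "classical_grad \<zeta> x = 0" using that unfolding Z_def by (rule classical_grad_outside_support[OF \<zeta>])
    qed
    have \<zeta>m: "\<zeta> \<in> borel_measurable borel" "classical_grad \<zeta> \<in> borel_measurable borel"
      by (rule test_function_borel[OF \<zeta>])+
    \<comment> \<open>With these weights the functional of \<open>H1_limit_functional\<close> is the
      defect in the integration by parts, which vanishes for each approximating test
      function.\<close>
    define b where "b x = classical_grad \<zeta> x $ i" for x
    define w where "w x = \<zeta> x *\<^sub>R axis i (1::real)" for x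
    have cbw: "continuous_on UNIV b" "continuous_on UNIV w"
      unfolding b_def w_def
      by (intro continuous_on_component continuous_on_scaleR continuous_on_const d\<zeta>(2,3))+
    then have bw: "b \<in> borel_measurable borel" "w \<in> borel_measurable borel"
      by (simp_all add: borel_measurable_continuous_onI)
    have "continuous_on Z (\<lambda>x. \<bar>b x\<bar> + norm (w x))"
      unfolding b_def w_def
      by (intro continuous_on_add continuous_on_rabs continuous_on_norm continuous_on_component
          continuous_on_scaleR continuous_on_const continuous_on_subset[OF d\<zeta>(2)] d\<zeta>(3)) simp
    then obtain B where B0: "\<And>x. x \<in> Z \<Longrightarrow> \<bar>\<bar>b x\<bar> + norm (w x)\<bar> \<le> B"
      using continuous_on_compact_abs_bound[OF d\<zeta>(4)] by blast
    have "\<bar>b x\<bar> + norm (w x) \<le> \<bar>B\<bar>" for x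
    proof (cases "x \<in> Z")
      case True
      then show ?thesis using B0[OF True] by linarith
    next
      case False
      then show ?thesis using out[OF False] by (simp add: b_def w_def)
    qed
    note bB = this
    have B: "\<bar>b x\<bar> \<le> \<bar>B\<bar>" "norm (w x) \<le> \<bar>B\<bar>" for x
      using bB[of x] norm_ge_zero[of "w x"] abs_ge_zero[of "b x"] by linarith+
    have ibp: "(\<integral>x. b x * \<psi> n x + classical_grad (\<psi> n) x \<bullet> w x \<partial>lebesgue_on \<Omega>) = 0" for n
    proof -
      note d\<psi> = test_functionsD[OF \<psi>[of n]]
      \<comment> \<open>The support of \<zeta> lies in \<open>S\<close>, hence almost everywhere in
        \<Omega>, so the integral may be taken over the whole space.\<close>
      have AE0: "AE x in lebesgue. x \<notin> \<Omega> \<longrightarrow> b x * \<psi> n x + classical_grad (\<psi> n) x \<bullet> w x = 0"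
        using AE
      proof eventually_elim
        case (elim x)
        show ?case
        proof
          assume "x \<notin> \<Omega>"
          then have "x \<notin> Z" using elim d\<zeta>(5) by blast
          then show "b x * \<psi> n x + classical_grad (\<psi> n) x \<bullet> w x = 0"
            unfolding b_def w_def using out[of x] by simp
        qed
      qed
      have m: "(\<lambda>x. b x * \<psi> n x + classical_grad (\<psi> n) x \<bullet> w x) \<in> borel_measurable borel"
        by (intro borel_measurable_continuous_onI continuous_on_add continuous_on_mult
            continuous_on_inner cbw d\<psi>(2,3))
      note int = integrable_compact_support[OF _ d\<zeta>(4)]
      have i1: "integrable lborel (\<lambda>x. \<psi> n x * classical_grad \<zeta> x $ i)"
        by (rule int[OF continuous_on_mult[OF d\<psi>(3) continuous_on_component[OF d\<zeta>(2)]]])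
           (use out in simp)
      have i2: "integrable lborel (\<lambda>x. classical_grad (\<psi> n) x $ i * \<zeta> x)"
        by (rule int[OF continuous_on_mult[OF continuous_on_component[OF d\<psi>(2)] d\<zeta>(3)]])
           (use out in simp)
      have diff: "\<And>x. \<psi> n differentiable at x" using d\<psi>(1) differentiableI by blast
      have "(\<integral>x. b x * \<psi> n x + classical_grad (\<psi> n) x \<bullet> w x \<partial>lebesgue_on \<Omega>)
          = (\<integral>x. b x * \<psi> n x + classical_grad (\<psi> n) x \<bullet> w x \<partial>lborel)"
        by (rule integral_lebesgue_on_borel[OF sets(1) m AE0])
      also have "\<dots> = (\<integral>x. \<psi> n x * classical_grad \<zeta> x $ i + classical_grad (\<psi> n) x $ i * \<zeta> x \<partial>lborel)"
        by (rule Bochner_Integration.integral_cong) (simp_all add: b_def w_def inner_axis mult.commute)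
      also have "\<dots> = 0"
        unfolding Bochner_Integration.integral_add[OF i1 i2]
          test_function_integration_by_parts[OF diff d\<psi>(2) \<zeta>] by simp
      finally show ?thesis .
    qed
    have lim0: "(\<integral>x. b x * v x + g x \<bullet> w x \<partial>lebesgue_on \<Omega>) = 0"
      using H1_limit_functional(2)[OF lim \<Omega> bw(1) B(1) bw(2) B(2)] unfolding ibp
      by (simp add: LIMSEQ_const_iff)
    have j1: "integrable (lebesgue_on \<Omega>) (\<lambda>x. b x * v x)"
      using H1_limit_functional(1)[OF lim \<Omega> bw(1) B(1), of "\<lambda>_. 0"] by simp
    have j2: "integrable (lebesgue_on \<Omega>) (\<lambda>x. g x \<bullet> w x)"
      using H1_limit_functional(1)[OF lim \<Omega> _ _ bw(2) B(2), of "\<lambda>_. 0"] by simp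
    have "(\<integral>x. b x * v x \<partial>lebesgue_on \<Omega>) = - (\<integral>x. g x \<bullet> w x \<partial>lebesgue_on \<Omega>)"
      using lim0 unfolding Bochner_Integration.integral_add[OF j1 j2] by linarith
    then have "(\<integral>x. b x * v x \<partial>lebesgue_on S) = - (\<integral>x. g x \<bullet> w x \<partial>lebesgue_on S)"
      unfolding lebesgue_on_AE_eq(3)[OF sets AE borel_measurable_integrable[OF j1]]
        lebesgue_on_AE_eq(3)[OF sets AE borel_measurable_integrable[OF j2]] .
    moreover have "(\<integral>x. b x * v x \<partial>lebesgue_on S) = (\<integral>x. v x * classical_grad \<zeta> x $ i \<partial>lebesgue_on S)"
      by (rule Bochner_Integration.integral_cong[OF refl]) (simp add: b_def)
    moreover have "(\<integral>x. g x \<bullet> w x \<partial>lebesgue_on S) = (\<integral>x. g x $ i * \<zeta> x \<partial>lebesgue_on S)"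
      by (rule Bochner_Integration.integral_cong[OF refl]) (simp add: w_def inner_axis)
    ultimately show ?thesis by (simp only:)
  qed
  then show ?thesis using vS gS unfolding H1_with_grad_def by blast
qed


section \<open>Traces on the facets of a simplex\<close>

text \<open>A C1 profile that vanishes on the negative half-line and tends to 1 at infinity.
  Squaring removes the corner of \<open>max 0 r\<close>, which is all the regularity
  \<open>test_functions\<close> asks for.\<close>

definition bump :: "real \<Rightarrow> real" where
  "bump r = (max 0 r)\<^sup>2 / (1 + (max 0 r)\<^sup>2)"

lemma pos_part_square_deriv:
  "((\<lambda>r::real. (max 0 r)\<^sup>2) has_real_derivative 2 * max 0 r) (at r)"
proof -
  consider "r < 0" | "r = 0" | "0 < r" by linarith
  then show ?thesis
  proof cases
    case 1
    have "((\<lambda>r::real. (max 0 r)\<^sup>2) has_real_derivative 0) (at r)"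
      by (rule has_field_derivative_transform_within_open[of "\<lambda>_. 0" 0 r "{..<0}"]) (use 1 in auto)
    then show ?thesis using 1 by simp
  next
    case 2
    have "((\<lambda>h::real. (max 0 h)\<^sup>2 / h) \<longlongrightarrow> 0) (at 0)"
    proof (rule Lim_null_comparison)
      show "\<forall>\<^sub>F h in at 0. norm ((max 0 h)\<^sup>2 / h) \<le> \<bar>h::real\<bar>"
        by (intro always_eventually allI) (simp add: max_def power2_eq_square)
      show "((\<lambda>h::real. \<bar>h\<bar>) \<longlongrightarrow> 0) (at 0)" using tendsto_rabs_zero[OF tendsto_ident_at] by simp
    qed
    then show ?thesis using 2 by (simp add: DERIV_def)
  next
    case 3
    have "((\<lambda>r::real. (max 0 r)\<^sup>2) has_real_derivative 2 * r) (at r)"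
      by (rule has_field_derivative_transform_within_open[of "\<lambda>r. r\<^sup>2" "2 * r" r "{0<..}"])
         (use 3 in \<open>auto intro!: derivative_eq_intros\<close>)
    then show ?thesis using 3 by simp
  qed
qed

lemma bump_deriv:
  "(bump has_real_derivative 2 * max 0 r / (1 + (max 0 r)\<^sup>2)\<^sup>2) (at r)"
proof -
  have p: "1 + (max 0 r)\<^sup>2 \<noteq> (0::real)" by (smt (verit) zero_le_power2)
  have "((\<lambda>r. (max 0 r)\<^sup>2 / (1 + (max 0 r)\<^sup>2)) has_real_derivative
     ((2 * max 0 r) * (1 + (max 0 r)\<^sup>2) - (max 0 r)\<^sup>2 * (0 + 2 * max 0 r)) / ((1 + (max 0 r)\<^sup>2) * (1 + (max 0 r)\<^sup>2))) (at r)"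
    by (rule DERIV_divide[OF pos_part_square_deriv DERIV_add[OF DERIV_const pos_part_square_deriv] p])
  moreover have "((2 * max 0 r) * (1 + (max 0 r)\<^sup>2) - (max 0 r)\<^sup>2 * (0 + 2 * max 0 r)) / ((1 + (max 0 r)\<^sup>2) * (1 + (max 0 r)\<^sup>2))
      = 2 * max 0 r / (1 + (max 0 r)\<^sup>2)\<^sup>2"
    by (simp add: algebra_simps power2_eq_square)
  moreover have "bump = (\<lambda>r. (max 0 r)\<^sup>2 / (1 + (max 0 r)\<^sup>2))" by (simp add: bump_def fun_eq_iff)
  ultimately show ?thesis by simp
qed

lemma bump_bounds: "0 \<le> bump r" "bump r \<le> 1"
  by (simp_all add: bump_def divide_le_eq add_pos_nonneg add_nonneg_nonneg)

lemma bump_nonpos: "r \<le> 0 \<Longrightarrow> bump r = 0"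
  by (simp add: bump_def)

lemma bump_at_top: "(bump \<longlongrightarrow> 1) at_top"
proof -
  have "((\<lambda>r::real. r\<^sup>2 / (1 + r\<^sup>2)) \<longlongrightarrow> 1) at_top" by real_asymp
  then show ?thesis
    by (rule Lim_transform_eventually)
       (use eventually_gt_at_top[of "0::real"] in eventually_elim, simp add: bump_def)
qed

text \<open>A product over all vertices: it vanishes as soon as one coordinate is small, which keeps
  the support in a compact part of the interior, and each factor tends to one where all coordinates
  are positive.\<close>

lemma simplex_cutoffs:
  fixes C :: "(real^'d) set"
  assumes "full_simplex C"
  obtains \<zeta> :: "nat \<Rightarrow> real^'d \<Rightarrow> real" where
    "\<And>m. \<zeta> m \<in> test_functions (interior (convex hull C))"
    "\<And>m x. \<bar>\<zeta> m x\<bar> \<le> 1"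
    "\<And>x. (\<lambda>m. \<zeta> m x) \<longlonglongrightarrow> indicator (interior (convex hull C)) x"
proof -
  interpret full_simplex C by fact
  let ?I = "interior (convex hull C)"
  \<comment> \<open>The shift by 1 makes the factor vanish already where the coordinate is at most
    1/(m+1), not merely on the boundary.\<close>
  define f where "f m c x = bump (real (Suc m) * bary c x - 1)" for m c x
  define b where "b r = 2 * max 0 r / (1 + (max 0 r)\<^sup>2)\<^sup>2" for r :: real
  define f' where "f' m c x = (real (Suc m) * b (real (Suc m) * bary c x - 1)) *\<^sub>R bgrad c" for m c x
  define \<zeta> where "\<zeta> m x = (\<Prod>c\<in>C. f m c x)" for m x
  define g where "g m x = (\<Sum>c\<in>C. (\<Prod>j\<in>C - {c}. f m j x) *\<^sub>R f' m c x)" for m x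
  have bump_cont: "continuous_on UNIV bump"
    by (meson bump_deriv DERIV_isCont continuous_at_imp_continuous_on)
  have b_cont: "continuous_on UNIV b"
    unfolding b_def by (intro continuous_intros) (simp add: add_pos_nonneg less_imp_neq[THEN not_sym])
  have f_cont: "continuous_on UNIV (f m c)" for m c
    unfolding f_def by (rule continuous_on_compose2[OF bump_cont]) (auto intro!: continuous_intros)
  have f'_cont: "continuous_on UNIV (f' m c)" for m c
    unfolding f'_def
    by (intro continuous_on_scaleR continuous_on_mult continuous_on_const continuous_on_compose2[OF b_cont])
       (auto intro!: continuous_intros)
  have df: "(f m c has_derivative (\<lambda>h. f' m c x \<bullet> h)) (at x)" for m c x
  proof -
    have "((\<lambda>x. real (Suc m) * bary c x - 1) has_derivative (\<lambda>h. real (Suc m) * (bgrad c \<bullet> h))) (at x)"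
      unfolding bary_def by (auto intro!: derivative_eq_intros)
    from DERIV_compose_FDERIV[OF bump_deriv this]
    have "((\<lambda>x. f m c x) has_derivative (\<lambda>h. real (Suc m) * (bgrad c \<bullet> h) * b (real (Suc m) * bary c x - 1))) (at x)"
      unfolding f_def b_def .
    moreover have "(\<lambda>h. real (Suc m) * (bgrad c \<bullet> h) * b (real (Suc m) * bary c x - 1)) = (\<lambda>h. f' m c x \<bullet> h)"
      by (rule ext) (simp add: f'_def mult_ac del: of_nat_Suc)
    ultimately show ?thesis by simp
  qed
  have "\<zeta> m \<in> test_functions ?I" for m
  proof (rule test_functionsI)
    show "(\<zeta> m has_derivative (\<lambda>h. g m x \<bullet> h)) (at x)" for x
    proof -
      have "((\<lambda>x. \<Prod>c\<in>C. f m c x) has_derivative (\<lambda>h. \<Sum>c\<in>C. (f' m c x \<bullet> h) * (\<Prod>j\<in>C - {c}. f m j x))) (at x)"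
        by (rule has_derivative_prod[OF df])
      moreover have "(\<lambda>h. \<Sum>c\<in>C. (f' m c x \<bullet> h) * (\<Prod>j\<in>C - {c}. f m j x)) = (\<lambda>h. g m x \<bullet> h)"
        by (rule ext) (simp add: g_def inner_sum_left mult.commute)
      moreover have "\<zeta> m = (\<lambda>x. \<Prod>c\<in>C. f m c x)" by (simp add: \<zeta>_def fun_eq_iff)
      ultimately show ?thesis by simp
    qed
    show "continuous_on UNIV (g m)"
      unfolding g_def by (intro continuous_on_sum continuous_on_scaleR continuous_on_prod f_cont f'_cont)
    let ?K = "{x \<in> convex hull C. \<forall>c\<in>C. 1 / real (Suc m) \<le> bary c x}"
    have eq: "?K = convex hull C \<inter> (\<Inter>c\<in>C. {x. 1 / real (Suc m) \<le> bary c x})" by blast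
    show "closed ?K"
      unfolding eq using compact_hull
      by (intro closed_Int closed_INT compact_imp_closed ballI closed_Collect_le continuous_intros) auto
    show "bounded ?K"
      by (rule bounded_subset[OF compact_imp_bounded[OF compact_hull]]) blast
    show "?K \<subseteq> ?I"
    proof
      fix x assume x: "x \<in> ?K"
      have "0 < bary c x" if "c \<in> C" for c
      proof -
        have "0 < 1 / real (Suc m)" by simp
        also have "\<dots> \<le> bary c x" using x that by blast
        finally show ?thesis .
      qed
      then show "x \<in> ?I" by (simp add: mem_interior_hull_iff)
    qed
    show "\<zeta> m x = 0" if "x \<notin> ?K" for x
    proof -
      obtain c where c: "c \<in> C" "bary c x < 1 / real (Suc m)"
      proof (cases "x \<in> convex hull C")
        case True
        then show thesis using \<open>x \<notin> ?K\<close> \<open>\<And>c. c \<in> C \<Longrightarrow> bary c x < 1 / real (Suc m) \<Longrightarrow> thesis\<close>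
          by (auto simp: not_le)
      next
        case False
        then obtain c where "c \<in> C" "bary c x < 0" by (auto simp: mem_hull_iff not_le)
        moreover have "0 < 1 / real (Suc m)" by simp
        ultimately show thesis using \<open>\<And>c. c \<in> C \<Longrightarrow> bary c x < 1 / real (Suc m) \<Longrightarrow> thesis\<close>
          by (meson order_less_trans)
      qed
      then have "real (Suc m) * bary c x - 1 \<le> 0"
        by (simp add: pos_less_divide_eq mult.commute less_imp_le del: of_nat_Suc)
      then have "f m c x = 0" unfolding f_def by (rule bump_nonpos)
      then show ?thesis using c(1) by (auto simp: \<zeta>_def)
    qed
  qed
  moreover have "\<bar>\<zeta> m x\<bar> \<le> 1" for m x
  proof -
    have "0 \<le> \<zeta> m x" unfolding \<zeta>_def f_def by (intro prod_nonneg) (simp add: bump_bounds)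
    moreover have "\<zeta> m x \<le> 1" unfolding \<zeta>_def f_def by (intro prod_le_1) (simp add: bump_bounds)
    ultimately show ?thesis by simp
  qed
  moreover have "(\<lambda>m. \<zeta> m x) \<longlonglongrightarrow> indicator ?I x" for x
  proof (cases "x \<in> ?I")
    case True
    have "(\<lambda>m. f m c x) \<longlonglongrightarrow> 1" if c: "c \<in> C" for c
    proof -
      have p: "0 < bary c x" using True c by (simp add: mem_interior_hull_iff)
      have "filterlim (\<lambda>m. real (Suc m) * bary c x - 1) at_top sequentially"
        using p by real_asymp
      from filterlim_compose[OF bump_at_top this] show ?thesis by (simp add: f_def)
    qed
    then have "(\<lambda>m. \<Prod>c\<in>C. f m c x) \<longlonglongrightarrow> (\<Prod>c\<in>C. 1)" by (intro tendsto_prod)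
    then show ?thesis using True by (simp add: \<zeta>_def)
  next
    case False
    then obtain c where c: "c \<in> C" "bary c x \<le> 0" by (auto simp: mem_interior_hull_iff not_less)
    have "\<zeta> m x = 0" for m
    proof -
      have "real (Suc m) * bary c x \<le> 0" using c(2) by (simp add: mult_nonneg_nonpos)
      then have "f m c x = 0" unfolding f_def by (intro bump_nonpos) linarith
      then show ?thesis using c(1) by (auto simp: \<zeta>_def)
    qed
    then show ?thesis using False by simp
  qed
  ultimately show ?thesis using that by blast
qed

lemma test_functions_mono: "S \<subseteq> S' \<Longrightarrow> test_functions S \<subseteq> test_functions S'"
  by (auto simp: test_functions_def)

text \<open>Two weak gradients have equal integrals against the cut-offs, which converge boundedly
  to the indicator of the open simplex. This makes the arbitrary choice in \<open>elem_grad\<close>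
  harmless.\<close>

lemma weak_gradient_integral_unique:
  fixes C :: "(real^'d) set"
  assumes C: "full_simplex C" and S: "open S" "bounded S" "interior (convex hull C) \<subseteq> S"
    and g: "H1_with_grad S v g" "H1_with_grad S v h"
  shows "(\<integral>x. indicator (interior (convex hull C)) x * g x $ i \<partial>lebesgue_on S)
       = (\<integral>x. indicator (interior (convex hull C)) x * h x $ i \<partial>lebesgue_on S)"
proof -
  obtain \<zeta> :: "nat \<Rightarrow> real^'d \<Rightarrow> real" where \<zeta>:
    "\<And>m. \<zeta> m \<in> test_functions (interior (convex hull C))"
    "\<And>m x. \<bar>\<zeta> m x\<bar> \<le> 1"
    "\<And>x. (\<lambda>m. \<zeta> m x) \<longlonglongrightarrow> indicator (interior (convex hull C)) x"
    using simplex_cutoffs[OF C] by blast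
  have \<zeta>S: "\<zeta> m \<in> test_functions S" for m using \<zeta>(1) test_functions_mono[OF S(3)] by blast
  have lim: "(\<lambda>m. \<integral>x. k x $ i * \<zeta> m x \<partial>lebesgue_on S)
      \<longlonglongrightarrow> (\<integral>x. indicator (interior (convex hull C)) x * k x $ i \<partial>lebesgue_on S)"
    if k: "H1_with_grad S v k" for k
  proof -
    have "k \<in> L2_space S" using k by (simp add: H1_with_grad_def)
    then have "integrable (lebesgue_on S) k"
      by (rule L2_space_integrable[OF open_bounded_lmeasurable[OF S(1,2)]])
    then have ki: "integrable (lebesgue_on S) (\<lambda>x. k x $ i)"
      by (rule integrable_bounded_linear[OF bounded_linear_vec_nth])
    show ?thesis
    proof (rule integral_dominated_convergence[where w="\<lambda>x. \<bar>k x $ i\<bar>"])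
      show "(\<lambda>x. indicator (interior (convex hull C)) x * k x $ i) \<in> borel_measurable (lebesgue_on S)"
        by (intro borel_measurable_times borel_measurable_integrable[OF ki] borel_measurable_lebesgue_on
            borel_measurable_indicator) simp
      show "(\<lambda>x. k x $ i * \<zeta> m x) \<in> borel_measurable (lebesgue_on S)" for m
        by (intro borel_measurable_times borel_measurable_integrable[OF ki] borel_measurable_lebesgue_on
            test_function_borel(1)[OF \<zeta>(1)])
      show "integrable (lebesgue_on S) (\<lambda>x. \<bar>k x $ i\<bar>)" using ki by simp
      show "AE x in lebesgue_on S. (\<lambda>m. k x $ i * \<zeta> m x) \<longlonglongrightarrow> indicator (interior (convex hull C)) x * k x $ i"
      proof (rule AE_I2)
        fix x
        show "(\<lambda>m. k x $ i * \<zeta> m x) \<longlonglongrightarrow> indicator (interior (convex hull C)) x * k x $ i"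
          unfolding mult.commute[of _ "k x $ i"] by (rule tendsto_mult_left[OF \<zeta>(3)])
      qed
      show "AE x in lebesgue_on S. norm (k x $ i * \<zeta> m x) \<le> \<bar>k x $ i\<bar>" for m
        using \<zeta>(2) by (intro AE_I2) (simp add: abs_mult mult_left_le)
    qed
  qed
  have "(\<integral>x. g x $ i * \<zeta> m x \<partial>lebesgue_on S) = (\<integral>x. h x $ i * \<zeta> m x \<partial>lebesgue_on S)" for m
  proof -
    have "(\<integral>x. v x * classical_grad (\<zeta> m) x $ i \<partial>lebesgue_on S) = - (\<integral>x. k x $ i * \<zeta> m x \<partial>lebesgue_on S)"
      if "H1_with_grad S v k" for k
      using that \<zeta>S[of m] unfolding H1_with_grad_def by blast
    from this[OF g(1)] this[OF g(2)] show ?thesis by linarith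
  qed
  then show ?thesis using lim[OF g(1)] lim[OF g(2)] LIMSEQ_unique by simp
qed

lemma AE_lebesgue_on_lborel: "AE x in lborel. P x \<Longrightarrow> S \<in> sets lebesgue \<Longrightarrow> AE x in lebesgue_on S. P x"
  using AE_completion[of P lborel] by (auto simp: AE_restrict_space_iff)

text \<open>\<open>cone_identity\<close> holds for the test functions. At fixed cut-off depth both
  sides are bounded functionals and pass to \<open>v\<close>. Letting the depth tend to zero
  afterwards turns the right-hand side into a facet integral by \<open>slab_limit\<close>. For a
  facet missing \<Omega> the two limits are taken in the opposite order.\<close>

lemma cone_trace:
  fixes C :: "(real^'d) set"
  assumes C: "full_simplex C" and c: "c \<in> C" and \<Omega>: "open \<Omega>" "bounded \<Omega>"
    and AE: "AE x in lebesgue. x \<in> convex hull C \<longrightarrow> x \<in> \<Omega>"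
    and lim: "H1_limit \<Omega> v g \<psi>" and v: "continuous_on (convex hull C) v"
  defines "G \<equiv> full_simplex.bgrad C c" and "F \<equiv> full_simplex.facet C c"
    and "X \<equiv> \<integral>x. indicator (convex hull C) x * (g x \<bullet> (x - c) + real CARD('d) * v x) \<partial>lebesgue_on \<Omega>"
  shows "X = face_integral (G /\<^sub>R norm G) F v / norm G"
    and "F \<inter> \<Omega> = {} \<Longrightarrow> X = 0"
    and "integrable (lebesgue_on \<Omega>) (\<lambda>x. indicator (convex hull C) x * (g x \<bullet> (x - c) + real CARD('d) * v x))"
proof -
  let ?q = "\<lambda>n x. classical_grad (\<psi> n) x \<bullet> (x - c) + real CARD('d) * \<psi> n x"
  let ?Q = "\<lambda>x. g x \<bullet> (x - c) + real CARD('d) * v x"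
  interpret full_simplex C by fact
  define K where "K = convex hull C"
  let ?M = "lebesgue_on \<Omega>"
  let ?d = "real CARD('d)"
  have sets: "\<Omega> \<in> sets lebesgue" using \<Omega> by auto
  have \<psi>: "\<And>n. \<psi> n \<in> test_functions \<Omega>" using lim by (simp add: H1_limit_def)
  have G0: "0 < norm G" unfolding G_def using bgrad_nonzero[OF c] by simp
  define \<delta> where "\<delta> m = norm G / real (Suc m)" for m
  have \<delta>0: "0 < \<delta> m" for m using G0 by (simp add: \<delta>_def)
  have K: "compact K" unfolding K_def by (rule compact_hull)
  have Km [measurable]: "K \<in> sets borel" using K by (simp add: borel_compact)
  have bc: "0 \<le> bary c x" "bary c x \<le> 1" if "x \<in> K" for x
    using that c bary_le_1[of x c] by (auto simp: K_def mem_hull_iff)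
  have "continuous_on K (\<lambda>x. norm (x - c))" by (intro continuous_intros)
  then obtain R where R: "\<And>x. x \<in> K \<Longrightarrow> \<bar>norm (x - c)\<bar> \<le> R"
    using continuous_on_compact_abs_bound[OF K] by blast
  define B where "B = \<bar>R\<bar> + ?d"
  \<comment> \<open>Both claims are \<open>H1_limit_functional\<close> with weight d \<kappa> for
    the function and \<kappa> (x - c) for the gradient; \<open>B\<close> bounds both.\<close>
  have fun1: "integrable ?M (\<lambda>x. \<kappa> x * ?Q x)"
    and fun2: "(\<lambda>n. \<integral>x. \<kappa> x * ?q n x \<partial>?M)
      \<longlonglongrightarrow> (\<integral>x. \<kappa> x * ?Q x \<partial>?M)"
    if \<kappa>: "\<kappa> \<in> borel_measurable borel" "\<And>x. \<bar>\<kappa> x\<bar> \<le> indicator K x" for \<kappa>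
  proof -
    have b: "(\<lambda>x. ?d * \<kappa> x) \<in> borel_measurable borel" "(\<lambda>x. \<kappa> x *\<^sub>R (x - c)) \<in> borel_measurable borel"
      using \<kappa>(1) by measurable
    have k1: "\<bar>\<kappa> x\<bar> \<le> 1" for x
      using order_trans[OF \<kappa>(2)[of x], of 1] by (simp add: indicator_def)
    have B1: "\<bar>?d * \<kappa> x\<bar> \<le> B" for x
    proof -
      have "?d * \<bar>\<kappa> x\<bar> \<le> ?d * 1" by (rule mult_left_mono[OF k1]) simp
      then have "?d * \<bar>\<kappa> x\<bar> \<le> \<bar>R\<bar> + ?d" using abs_ge_zero[of R] by linarith
      then show ?thesis unfolding B_def abs_mult abs_of_nat .
    qed
    have B2: "norm (\<kappa> x *\<^sub>R (x - c)) \<le> B" for x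
    proof (cases "x \<in> K")
      case True
      then have "\<bar>\<kappa> x\<bar> * norm (x - c) \<le> 1 * \<bar>R\<bar>"
        using \<kappa>(2)[of x] R[of x] by (intro mult_mono) auto
      then show ?thesis by (simp add: B_def)
    next
      case False
      then show ?thesis using \<kappa>(2)[of x] by (simp add: B_def)
    qed
    have eq: "?d * \<kappa> x * f x + h x \<bullet> (\<kappa> x *\<^sub>R (x - c)) = \<kappa> x * (h x \<bullet> (x - c) + ?d * f x)" for f h x
      by (simp add: algebra_simps)
    show "integrable ?M (\<lambda>x. \<kappa> x * ?Q x)"
      using H1_limit_functional(1)[OF lim \<Omega> b(1) B1 b(2) B2] unfolding eq .
    show "(\<lambda>n. \<integral>x. \<kappa> x * ?q n x \<partial>?M)
      \<longlonglongrightarrow> (\<integral>x. \<kappa> x * ?Q x \<partial>?M)"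
      using H1_limit_functional(2)[OF lim \<Omega> b(1) B1 b(2) B2] unfolding eq .
  qed
  define \<kappa> where "\<kappa> m x = indicator K x * clamp01 (bary c x / \<delta> m)" for m x
  have \<kappa>m: "\<kappa> m \<in> borel_measurable borel" for m unfolding \<kappa>_def by measurable
  have \<kappa>1: "\<bar>\<kappa> m x\<bar> \<le> indicator K x" for m x
    using clamp01_bounds[of "bary c x / \<delta> m"] by (simp add: \<kappa>_def indicator_def)
  have \<kappa>lim: "AE x in lborel. (\<lambda>m. \<kappa> m x) \<longlonglongrightarrow> indicator K x"
    using AE_bary_ne[OF c, of 0]
  proof eventually_elim
    case (elim x)
    show ?case
    proof (cases "x \<in> K")
      case True
      then have p: "0 < bary c x" using elim bc(1)[OF True] by linarith
      have "\<delta> \<longlonglongrightarrow> 0" unfolding \<delta>_def by real_asymp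
      then have "\<forall>\<^sub>F m in sequentially. \<delta> m < bary c x" by (rule order_tendstoD(2)[OF _ p])
      then have "\<forall>\<^sub>F m in sequentially. \<kappa> m x = 1"
      proof eventually_elim
        case (elim m)
        then have "1 \<le> bary c x / \<delta> m" using \<delta>0[of m] by simp
        then show ?case using True by (simp add: \<kappa>_def clamp01_def)
      qed
      then show ?thesis using True by (simp add: tendsto_eventually)
    qed (simp add: \<kappa>_def)
  qed
  define r where "r m x = indicator {x \<in> K. bary c x < \<delta> m} x * (1 - bary c x)" for m x
  have rm: "r m \<in> borel_measurable borel" for m unfolding r_def by measurable
  have r1: "\<bar>r m x\<bar> \<le> 1" for m x using bc[of x] by (auto simp: r_def indicator_def)
  have id: "(\<integral>x. \<kappa> m x * ?q n x \<partial>lborel)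
      = 1 / \<delta> m * (\<integral>x. r m x * \<psi> n x \<partial>lborel)" for m n
    using cone_identity[OF test_functionsD(1)[OF \<psi>[of n]] test_functionsD(2)[OF \<psi>[of n]] c \<delta>0[of m]]
    by (simp add: \<kappa>_def r_def K_def mult.assoc)
  have \<psi>m [measurable]: "\<psi> n \<in> borel_measurable borel" "classical_grad (\<psi> n) \<in> borel_measurable borel" for n
    by (rule test_function_borel[OF \<psi>])+
  have toM: "(\<integral>x. \<kappa>' x * ?q n x \<partial>lborel)
      = (\<integral>x. \<kappa>' x * ?q n x \<partial>?M)"
    if k: "\<kappa>' \<in> borel_measurable borel" "\<And>x. \<bar>\<kappa>' x\<bar> \<le> indicator K x" for \<kappa>' n
  proof (rule integral_lebesgue_on_borel[OF sets, symmetric])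
    show "(\<lambda>x. \<kappa>' x * ?q n x) \<in> borel_measurable borel"
      using k(1) by measurable
    show "AE x in lebesgue. x \<notin> \<Omega> \<longrightarrow> \<kappa>' x * ?q n x = 0"
      using AE
    proof eventually_elim
      case (elim x)
      show ?case
      proof
        assume "x \<notin> \<Omega>"
        then have "x \<notin> K" using elim unfolding K_def by blast
        then have "\<kappa>' x = 0" using k(2)[of x] by simp
        then show "\<kappa>' x * ?q n x = 0" by simp
      qed
    qed
  qed
  have toM2: "(\<integral>x. r m x * \<psi> n x \<partial>lborel) = (\<integral>x. r m x * \<psi> n x \<partial>?M)" for m n
  proof (rule integral_lebesgue_on_borel[OF sets, symmetric])
    show "(\<lambda>x. r m x * \<psi> n x) \<in> borel_measurable borel" using rm by measurable
    show "AE x in lebesgue. x \<notin> \<Omega> \<longrightarrow> r m x * \<psi> n x = 0"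
      using AE by eventually_elim (auto simp: r_def K_def)
  qed
  \<comment> \<open>The limit in n at fixed m: the factor \<open>1 / \<delta> m\<close> is still a
    constant.\<close>
  have step1: "(\<integral>x. \<kappa> m x * ?Q x \<partial>?M) = 1 / \<delta> m * (\<integral>x. r m x * v x \<partial>?M)" for m
  proof -
    have "(\<lambda>n. \<integral>x. r m x * \<psi> n x \<partial>?M) \<longlonglongrightarrow> (\<integral>x. r m x * v x \<partial>?M)"
      using H1_limit_functional(2)[OF lim \<Omega> rm r1, of "\<lambda>_. 0"] by simp
    then have "(\<lambda>n. 1 / \<delta> m * (\<integral>x. r m x * \<psi> n x \<partial>?M)) \<longlonglongrightarrow> 1 / \<delta> m * (\<integral>x. r m x * v x \<partial>?M)"
      by (rule tendsto_mult_left)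
    then have "(\<lambda>n. \<integral>x. \<kappa> m x * ?q n x \<partial>?M)
        \<longlonglongrightarrow> 1 / \<delta> m * (\<integral>x. r m x * v x \<partial>?M)"
      unfolding toM[OF \<kappa>m \<kappa>1, symmetric] id toM2 .
    then show ?thesis using fun2[OF \<kappa>m \<kappa>1] LIMSEQ_unique by blast
  qed
  have iK: "(\<lambda>x. indicator K x :: real) \<in> borel_measurable borel" by measurable
  have iK1: "\<bar>indicator K x :: real\<bar> \<le> indicator K x" for x by (simp add: indicator_def)
  show "integrable ?M (\<lambda>x. indicator (convex hull C) x * ?Q x)"
    using fun1[OF iK iK1] unfolding K_def .
  have step2: "(\<lambda>m. \<integral>x. \<kappa> m x * ?Q x \<partial>?M) \<longlonglongrightarrow> X"
    unfolding X_def K_def[symmetric]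
  proof (rule integral_dominated_convergence[where w="\<lambda>x. \<bar>indicator K x * ?Q x\<bar>"])
    show "integrable ?M (\<lambda>x. \<bar>indicator K x * ?Q x\<bar>)"
      by (rule integrable_abs[OF fun1[OF iK iK1]])
    show "(\<lambda>x. indicator K x * ?Q x) \<in> borel_measurable ?M"
      by (rule borel_measurable_integrable[OF fun1[OF iK iK1]])
    show "(\<lambda>x. \<kappa> m x * ?Q x) \<in> borel_measurable ?M" for m
      by (rule borel_measurable_integrable[OF fun1[OF \<kappa>m \<kappa>1]])
    show "AE x in ?M. (\<lambda>m. \<kappa> m x * ?Q x) \<longlonglongrightarrow> indicator K x * ?Q x"
      using AE_lebesgue_on_lborel[OF \<kappa>lim sets] by eventually_elim (rule tendsto_mult_right)
    show "AE x in ?M. norm (\<kappa> m x * ?Q x) \<le> \<bar>indicator K x * ?Q x\<bar>" for m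
      using mult_right_mono[OF \<kappa>1] by (intro AE_I2) (simp add: abs_mult)
  qed
  \<comment> \<open>\<open>slab_limit\<close> is applied to (1 - \<open>bary c x\<close>) v; the
    extra factor equals one on the facet and disappears from the facet integral.\<close>
  have "(\<lambda>m. 1 / \<delta> m * (\<integral>x. r m x * v x \<partial>?M)) \<longlonglongrightarrow> face_integral (G /\<^sub>R norm G) F v / norm G"
  proof -
    have cw: "continuous_on (convex hull C) (\<lambda>x. (1 - bary c x) * v x)"
      by (intro continuous_intros v)
    have "(\<integral>x. indicator {x \<in> convex hull C. bary c x < \<delta> m} x * ((1 - bary c x) * v x) \<partial>lborel)
        = (\<integral>x. r m x * v x \<partial>?M)" for m
    proof -
      have b1: "(\<lambda>x. indicator K x *\<^sub>R ((1 - bary c x) * v x)) \<in> borel_measurable borel"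
        by (rule borel_measurable_continuous_on_indicator[OF Km cw[folded K_def]])
      have b2: "(\<lambda>x. indicator {x. bary c x < \<delta> m} x :: real) \<in> borel_measurable borel" by measurable
      have "(\<lambda>x. indicator {x. bary c x < \<delta> m} x * (indicator K x *\<^sub>R ((1 - bary c x) * v x))) \<in> borel_measurable borel"
        by (rule borel_measurable_times[OF b2 b1])
      moreover have "(\<lambda>x. indicator {x. bary c x < \<delta> m} x * (indicator K x *\<^sub>R ((1 - bary c x) * v x)))
          = (\<lambda>x. r m x * v x)"
        by (rule ext) (auto simp: r_def indicator_def)
      ultimately have m: "(\<lambda>x. r m x * v x) \<in> borel_measurable borel" by simp
      have "(\<integral>x. r m x * v x \<partial>?M) = (\<integral>x. r m x * v x \<partial>lborel)"
        by (rule integral_lebesgue_on_borel[OF sets m]) (use AE in eventually_elim, auto simp: r_def K_def)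
      also have "\<dots> = (\<integral>x. indicator {x \<in> convex hull C. bary c x < \<delta> m} x * ((1 - bary c x) * v x) \<partial>lborel)"
        by (rule Bochner_Integration.integral_cong) (simp_all add: r_def K_def)
      finally show ?thesis by simp
    qed
    moreover have "face_integral (G /\<^sub>R norm G) F (\<lambda>x. (1 - bary c x) * v x) = face_integral (G /\<^sub>R norm G) F v"
      unfolding F_def
      by (rule face_integral_cong[OF compact_imp_closed[OF compact_facet] facet_nonempty])
         (simp add: mem_facet_iff[OF c])
    ultimately show ?thesis
      using slab_limit[OF C c cw, folded G_def F_def] by (simp add: \<delta>_def)
  qed
  then show "X = face_integral (G /\<^sub>R norm G) F v / norm G"
    using step2 unfolding step1 using LIMSEQ_unique by blast
  \<comment> \<open>Here m tends to infinity at fixed n: the right-hand side of the cone identity is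
    zero for all large m, before n is sent to infinity.\<close>
  show "X = 0" if disj: "F \<inter> \<Omega> = {}"
  proof -
    have zero: "(\<integral>x. indicator K x * ?q n x \<partial>lborel) = 0" for n
    proof -
      define q where "q x = classical_grad (\<psi> n) x \<bullet> (x - c) + ?d * \<psi> n x" for x
      have cq: "continuous_on A q" for A
        unfolding q_def
        by (intro continuous_intros continuous_on_subset[OF test_functionsD(2)[OF \<psi>[of n]]] test_functionsD(3)[OF \<psi>[of n]]) auto
      have qi: "integrable lborel (\<lambda>x. indicator K x * q x)"
        using borel_integrable_compact[OF K cq] by simp
      have qm: "q \<in> borel_measurable borel" by (rule borel_measurable_continuous_onI[OF cq])
      have l: "(\<lambda>m. \<integral>x. \<kappa> m x * q x \<partial>lborel) \<longlonglongrightarrow> (\<integral>x. indicator K x * q x \<partial>lborel)"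
      proof (rule integral_dominated_convergence[where w="\<lambda>x. \<bar>indicator K x * q x\<bar>"])
        show "integrable lborel (\<lambda>x. \<bar>indicator K x * q x\<bar>)" by (rule integrable_abs[OF qi])
        show "(\<lambda>x. indicator K x * q x) \<in> borel_measurable lborel" using borel_measurable_integrable[OF qi] .
        show "(\<lambda>x. \<kappa> m x * q x) \<in> borel_measurable lborel" for m using \<kappa>m[of m] qm by simp
        show "AE x in lborel. (\<lambda>m. \<kappa> m x * q x) \<longlonglongrightarrow> indicator K x * q x"
          using \<kappa>lim by eventually_elim (rule tendsto_mult_right)
        show "AE x in lborel. norm (\<kappa> m x * q x) \<le> \<bar>indicator K x * q x\<bar>" for m
          using mult_right_mono[OF \<kappa>1] by (intro AE_I2) (simp add: abs_mult)
      qed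
      define Z where "Z = closure {x. \<psi> n x \<noteq> 0}"
      have Z: "compact Z" "Z \<subseteq> \<Omega>" unfolding Z_def by (rule test_functionsD(4,5)[OF \<psi>])+
      have pos: "0 < bary c x" if "x \<in> K \<inter> Z" for x
      proof -
        have "x \<notin> F" using that Z(2) disj by blast
        then have "bary c x \<noteq> 0" using that mem_facet_iff[OF c] by (auto simp: F_def K_def)
        then show ?thesis using bc(1)[of x] that by auto
      qed
      \<comment> \<open>The coordinate attains a positive minimum on the compact part of the support
        inside \<open>K\<close>, so thin layers at the facet miss the support.\<close>
      obtain e where e: "0 < e" "\<And>x. x \<in> K \<inter> Z \<Longrightarrow> e \<le> bary c x"
      proof (cases "K \<inter> Z = {}")
        case True
        then show thesis using \<open>\<And>e. 0 < e \<Longrightarrow> (\<And>x. x \<in> K \<inter> Z \<Longrightarrow> e \<le> bary c x) \<Longrightarrow> thesis\<close>[of 1] by simp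
      next
        case False
        have "compact (K \<inter> Z)" using K Z(1) by (rule compact_Int)
        moreover have "continuous_on (K \<inter> Z) (\<lambda>x. bary c x)" by (intro continuous_intros)
        ultimately obtain y where y: "y \<in> K \<inter> Z" "\<And>x. x \<in> K \<inter> Z \<Longrightarrow> bary c y \<le> bary c x"
          using continuous_attains_inf[of "K \<inter> Z" "bary c"] False by auto
        show thesis
          by (rule \<open>\<And>e. 0 < e \<Longrightarrow> (\<And>x. x \<in> K \<inter> Z \<Longrightarrow> e \<le> bary c x) \<Longrightarrow> thesis\<close>[OF pos[OF y(1)] y(2)])
      qed
      have "\<delta> \<longlonglongrightarrow> 0" unfolding \<delta>_def by real_asymp
      then have "\<forall>\<^sub>F m in sequentially. \<delta> m < e" by (rule order_tendstoD(2)[OF _ e(1)])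
      then have "\<forall>\<^sub>F m in sequentially. (\<integral>x. \<kappa> m x * q x \<partial>lborel) = 0"
      proof eventually_elim
        case (elim m)
        have rz: "r m x * \<psi> n x = 0" for x
        proof (cases "x \<in> K \<inter> Z")
          case True
          then show ?thesis using e(2)[OF True] elim by (simp add: r_def)
        next
          case False
          then show ?thesis
            using closure_subset[of "{x. \<psi> n x \<noteq> 0}"] unfolding Z_def[symmetric] by (auto simp: r_def)
        qed
        show ?case unfolding q_def id rz by simp
      qed
      then have "(\<lambda>m. \<integral>x. \<kappa> m x * q x \<partial>lborel) \<longlonglongrightarrow> 0" by (rule tendsto_eventually)
      then show ?thesis using l LIMSEQ_unique unfolding q_def by blast
    qed
    have z: "(\<integral>x. indicator K x * ?q n x \<partial>?M) = 0" for n
      using toM[OF iK iK1, of n] zero[of n] by simp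
    show ?thesis
      using fun2[OF iK iK1] unfolding z X_def K_def[symmetric]
      by (simp add: LIMSEQ_const_iff)
  qed
qed


section \<open>Geometry of the mesh\<close>

context full_simplex begin

lemma rel_interior_facet_pos:
  assumes "x \<in> rel_interior (facet c)" "v \<in> C" "v \<noteq> c" "c \<in> C"
  shows "0 < bary v x"
proof -
  have "\<not> affine_dependent (C - {c})" using indep affine_dependent_subset by blast
  then obtain u where u: "\<forall>y\<in>C - {c}. 0 < u y" "sum u (C - {c}) = 1" "(\<Sum>y\<in>C - {c}. u y *\<^sub>R y) = x"
    using assms(1) unfolding facet_def by (simp add: rel_interior_convex_hull_explicit) blast
  have "bary v x = (\<Sum>y\<in>C - {c}. u y * bary v y)" using bary_affine[OF u(2)] u(3) by simp
  also have "\<dots> = (\<Sum>y\<in>C - {c}. if y = v then u y else 0)"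
    by (rule sum.cong) (auto simp: bary_vertex)
  also have "\<dots> = u v" using assms by simp
  finally show ?thesis using u(1) assms by simp
qed

text \<open>At a relative interior point the other coordinates are positive and stay so for small
  steps, while the coordinate of \<open>c\<close> grows linearly from zero.\<close>

lemma inward_from_facet:
  assumes x: "x \<in> rel_interior (facet c)" and c: "c \<in> C"
  shows "\<forall>\<^sub>F t in at_right 0. x + t *\<^sub>R (bgrad c /\<^sub>R norm (bgrad c)) \<in> interior (convex hull C)"
proof -
  let ?n = "bgrad c /\<^sub>R norm (bgrad c)"
  have xF: "x \<in> facet c" using x rel_interior_subset by blast
  then have x0: "bary c x = 0" using mem_facet_iff[OF c] by blast
  have p: "0 < bgrad c \<bullet> ?n" using bgrad_nonzero[OF c] by simp
  have "\<forall>\<^sub>F t in at_right 0. \<forall>v\<in>C. 0 < bary v (x + t *\<^sub>R ?n)"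
  proof (rule eventually_ball_finite[OF finite_C], rule ballI)
    fix v assume v: "v \<in> C"
    show "\<forall>\<^sub>F t in at_right 0. 0 < bary v (x + t *\<^sub>R ?n)"
    proof (cases "v = c")
      case True
      have "\<forall>\<^sub>F t in at_right (0::real). 0 < t" by (rule eventually_at_right_less)
      then show ?thesis
      proof eventually_elim
        case (elim t)
        have "bary c (x + t *\<^sub>R ?n) = t * (bgrad c \<bullet> ?n)" using x0 by (simp add: bary_add)
        also have "0 < \<dots>" using elim p by (rule mult_pos_pos)
        finally show ?case using True by simp
      qed
    next
      case False
      have "((\<lambda>t. bary v (x + t *\<^sub>R ?n)) \<longlongrightarrow> bary v (x + 0 *\<^sub>R ?n)) (at_right 0)"
        unfolding bary_def by (intro tendsto_intros)
      then show ?thesis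
        by (rule order_tendstoD(1)) (use rel_interior_facet_pos[OF x v False c] in simp)
    qed
  qed
  then show ?thesis by (simp add: mem_interior_hull_iff)
qed

lemma outward_from_facet:
  assumes x: "x \<in> facet c" and c: "c \<in> C" and "0 < t"
  shows "x - t *\<^sub>R bgrad c \<notin> convex hull C"
proof -
  have "bary c x = 0" using mem_facet_iff[OF c] x by blast
  then have "bary c (x + (- t) *\<^sub>R bgrad c) = - (t * (bgrad c \<bullet> bgrad c))"
    unfolding bary_add by simp
  also have "\<dots> < 0" using \<open>0 < t\<close> bgrad_nonzero[OF c] by simp
  finally show ?thesis using c by (auto simp: mem_hull_iff not_le)
qed

lemma facet_inj:
  assumes "c \<in> C" "c' \<in> C" "facet c = facet c'"
  shows "c = c'"
proof (rule ccontr)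
  assume "c \<noteq> c'"
  then have "c' \<in> facet c" unfolding facet_def using assms(2) by (intro hull_inc) auto
  moreover have "c' \<notin> facet c'" using mem_facet_iff[OF assms(2)] bary_vertex[OF assms(2), of c'] by simp
  ultimately show False using assms(3) by simp
qed

text \<open>The part w of \<open>n\<close> orthogonal to \<open>bgrad c\<close> takes the same inner
  product with all vertices of the facet. Expanding w by \<open>bgrad_combination\<close>, whose
  coefficients sum to zero, gives w \<bullet> w = 0.\<close>

lemma facet_normal:
  assumes c: "c \<in> C" and n: "norm n = 1" "\<And>x y. x \<in> facet c \<Longrightarrow> y \<in> facet c \<Longrightarrow> n \<bullet> (x - y) = 0"
  obtains s where "s = 1 \<or> s = -1" "n = s *\<^sub>R (bgrad c /\<^sub>R norm (bgrad c))"
proof -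
  let ?G = "bgrad c"
  have G: "?G \<noteq> 0" by (rule bgrad_nonzero[OF c])
  define \<beta> where "\<beta> = (n \<bullet> ?G) / (?G \<bullet> ?G)"
  define w where "w = n - \<beta> *\<^sub>R ?G"
  have wG: "?G \<bullet> w = 0" using G by (simp add: w_def \<beta>_def inner_diff_right inner_commute)
  obtain y where y: "y \<in> facet c" using facet_nonempty by blast
  have V: "w \<bullet> v = w \<bullet> y" if "v \<in> C - {c}" for v
  proof -
    have vF: "v \<in> facet c" unfolding facet_def using that by (intro hull_inc) auto
    have "n \<bullet> (v - y) = 0" by (rule n(2)[OF vF y])
    moreover have "?G \<bullet> (v - y) = 0" by (rule bgrad_orthogonal_facet[OF c vF y])
    ultimately have "w \<bullet> (v - y) = 0" by (simp add: w_def inner_diff_left)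
    then show ?thesis by (simp add: inner_diff_right)
  qed
  have "w \<bullet> w = w \<bullet> (\<Sum>v\<in>C. (bgrad v \<bullet> w) *\<^sub>R v)" by (simp add: bgrad_combination)
  also have "\<dots> = (\<Sum>v\<in>C. (bgrad v \<bullet> w) * (w \<bullet> v))" by (simp add: inner_sum_right)
  also have "\<dots> = (\<Sum>v\<in>C. (bgrad v \<bullet> w) * (w \<bullet> y))"
    by (rule sum.cong[OF refl]) (use V wG in \<open>metis Diff_iff mult_zero_left singletonD\<close>)
  also have "\<dots> = 0" using sum_bgrad[of w] by (simp flip: sum_distrib_right)
  finally have "n = \<beta> *\<^sub>R ?G" by (simp add: w_def)
  then have nG: "n = (\<beta> * norm ?G) *\<^sub>R (?G /\<^sub>R norm ?G)" using G by simp
  have "\<bar>\<beta> * norm ?G\<bar> = 1" using n(1) \<open>n = \<beta> *\<^sub>R ?G\<close> by (simp add: abs_mult)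
  then have "\<beta> * norm ?G = 1 \<or> \<beta> * norm ?G = - 1" by linarith
  then show thesis using nG by (rule that)
qed

end

section \<open>Elements of the mesh and null sets\<close>

lemma polyhedral_frontier_negligible:
  assumes "polyhedral_domain (\<Omega> :: (real^'d) set)"
  shows "negligible (frontier \<Omega>)"
proof -
  obtain F where F: "finite F" "\<And>f. f \<in> F \<Longrightarrow> polytope f \<and> aff_dim f = int CARD('d) - 1"
    "frontier \<Omega> = \<Union>F"
    using assms unfolding polyhedral_domain_def by blast
  have "negligible f" if "f \<in> F" for f
  proof -
    have "interior f = {}" using F(2)[OF that] aff_dim_nonempty_interior[of f] by fastforce
    then show ?thesis using F(2)[OF that] negligible_convex_interior polytope_imp_convex by blast
  qed
  then show ?thesis using F(1,3) negligible_Union by metis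
qed

lemma negligible_AE_lebesgue: "negligible N \<Longrightarrow> AE x in lebesgue. x \<notin> N"
  unfolding negligible_iff_null_sets by (rule AE_not_in)

locale polyhedral_mesh =
  fixes \<Omega> :: "(real^'d) set" and T :: "(real^'d) set set" and nrm :: "(real^'d) set \<Rightarrow> real^'d"
  assumes dom: "polyhedral_domain \<Omega>" and mesh: "simplicial_mesh \<Omega> T" and nrm: "edge_normals T nrm"
begin

lemma \<Omega>_open: "open \<Omega>" and \<Omega>_bounded: "bounded \<Omega>" and \<Omega>_nonempty: "\<Omega> \<noteq> {}"
  using dom by (auto simp: polyhedral_domain_def)

lemma finite_T: "finite T" and union_T: "\<Union>T = closure \<Omega>"
  and faces: "K \<in> T \<Longrightarrow> L \<in> T \<Longrightarrow> K \<inter> L face_of K"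
  using mesh by (auto simp: simplicial_mesh_def triangulation_def)

lemma faces': "K \<in> T \<Longrightarrow> L \<in> T \<Longrightarrow> K \<inter> L face_of L"
  using faces[of L K] by (simp add: Int_commute)

lemma element:
  assumes "K \<in> T"
  shows element_simplex: "full_simplex (vertices K)" and element_hull: "convex hull (vertices K) = K"
proof -
  have "int DIM(real^'d) simplex K" using assms mesh by (simp add: simplicial_mesh_def)
  then obtain C where C: "full_simplex C" "K = convex hull C" using simplex_full_simplex by blast
  have "vertices K = C"
    unfolding vertices_def C(2)
    using extreme_point_of_convex_hull_affine_independent full_simplex.indep[OF C(1)] by blast
  then show "full_simplex (vertices K)" "convex hull (vertices K) = K" using C by auto
qed

lemma element_compact: "K \<in> T \<Longrightarrow> compact K" and element_convex: "K \<in> T \<Longrightarrow> convex K"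
  using full_simplex.compact_hull[OF element_simplex] element_hull convex_convex_hull by metis+

lemma element_interior_nonempty: "K \<in> T \<Longrightarrow> interior K \<noteq> {}"
proof -
  assume K: "K \<in> T"
  interpret full_simplex "vertices K" by (rule element_simplex[OF K])
  have "aff_dim K = int DIM(real^'d)"
    using affine_hull_C element_hull[OF K] aff_dim_eq_full affine_hull_convex_hull by metis
  then show ?thesis
    using interior_rel_interior_gen[of K] rel_interior_eq_empty[OF element_convex[OF K]] facet_subset facet_nonempty
      element_hull[OF K] by auto
qed

lemma element_subset: "K \<in> T \<Longrightarrow> K \<subseteq> closure \<Omega>"
  using union_T by blast

lemma element_closure_interior: "K \<in> T \<Longrightarrow> closure (interior K) = K"
  using convex_closure_interior[OF element_convex element_interior_nonempty] element_compact
    compact_imp_closed closure_closed by metis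

text \<open>A face that meets the interior of a convex set is the whole set.\<close>

lemma elements_eq:
  assumes "K \<in> T" "L \<in> T" "interior K \<inter> interior L \<noteq> {}"
  shows "K = L"
proof -
  obtain x where x: "x \<in> interior K" "x \<in> interior L" using assms(3) by blast
  then have "x \<in> K \<inter> L" using interior_subset by blast
  then have "K \<inter> L = K" "K \<inter> L = L"
    using face_of_disjoint_interior[OF faces[OF assms(1,2)]] face_of_disjoint_interior[OF faces'[OF assms(1,2)]] x
    by blast+
  then show ?thesis by simp
qed

lemma AE_frontier: "AE x in lebesgue. x \<notin> frontier \<Omega> \<and> (\<forall>K\<in>T. x \<notin> frontier K)"
proof -
  have "negligible (\<Union>(frontier ` T))"
    using finite_T negligible_convex_frontier[OF element_convex] by (intro negligible_Union) auto
  then have "negligible (frontier \<Omega> \<union> \<Union>(frontier ` T))"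
    by (rule negligible_Un[OF polyhedral_frontier_negligible[OF dom]])
  from negligible_AE_lebesgue[OF this] show ?thesis by eventually_elim auto
qed

text \<open>An element lies in the closure of \<Omega>, and the excess over \<Omega> is confined to
  its frontier, a null set.\<close>

lemma AE_element: "K \<in> T \<Longrightarrow> AE x in lebesgue. x \<in> K \<longrightarrow> x \<in> \<Omega>"
proof -
  assume K: "K \<in> T"
  show ?thesis using AE_frontier
  proof eventually_elim
    case (elim x)
    then show ?case using element_subset[OF K] \<Omega>_open by (auto simp: frontier_def interior_open)
  qed
qed

lemma AE_interior: "K \<in> T \<Longrightarrow> AE x in lebesgue. x \<in> K \<longleftrightarrow> x \<in> interior K"
proof -
  assume K: "K \<in> T"
  show ?thesis using AE_frontier
  proof eventually_elim
    case (elim x)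
    then show ?case using K interior_subset closure_subset by (fastforce simp: frontier_def)
  qed
qed

definition interiors :: "(real^'d) set" where
  "interiors = (\<Union>K\<in>T. interior K)"

text \<open>Neither set need contain the other: \<Omega> contains parts of the mesh skeleton, while
  open elements may contain frontier points of \<Omega>. All discrepancies lie in null
  frontiers.\<close>

lemma AE_interiors: "AE x in lebesgue. x \<in> \<Omega> \<longleftrightarrow> x \<in> interiors"
  using AE_frontier
proof eventually_elim
  case (elim x)
  show ?case
  proof
    assume "x \<in> \<Omega>"
    then obtain K where "K \<in> T" "x \<in> K" using union_T closure_subset by blast
    then show "x \<in> interiors" using elim closure_subset[of K] by (auto simp: interiors_def frontier_def)
  next
    assume "x \<in> interiors"
    then obtain K where "K \<in> T" "x \<in> interior K" by (auto simp: interiors_def)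
    then have "x \<in> closure \<Omega>" using element_subset interior_subset by blast
    then show "x \<in> \<Omega>" using elim \<Omega>_open by (auto simp: frontier_def interior_open)
  qed
qed

lemma interiors_open: "open interiors" and interiors_bounded: "bounded interiors"
proof -
  show "open interiors" by (auto simp: interiors_def)
  have "interiors \<subseteq> closure \<Omega>" unfolding interiors_def using element_subset interior_subset by blast
  then show "bounded interiors" using \<Omega>_bounded bounded_closure bounded_subset by blast
qed

section \<open>Facets, interior edges and their normals\<close>

abbreviation facet_of_vertex :: "(real^'d) set \<Rightarrow> real^'d \<Rightarrow> (real^'d) set" where
  "facet_of_vertex K \<equiv> full_simplex.facet (vertices K)"

definition inward :: "(real^'d) set \<Rightarrow> real^'d \<Rightarrow> real^'d" where
  "inward K c = full_simplex.bgrad (vertices K) c /\<^sub>R norm (full_simplex.bgrad (vertices K) c)"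

lemma inward_neq_minus:
  assumes "K \<in> T" "c \<in> vertices K"
  shows "inward K c \<noteq> - inward K c"
proof
  assume "inward K c = - inward K c"
  then have "inward K c + inward K c = 0" by (simp only: eq_neg_iff_add_eq_0)
  then have "2 *\<^sub>R inward K c = 0" by (simp only: scaleR_2)
  then have "inward K c = 0" by simp
  then show False
    using full_simplex.bgrad_nonzero[OF element_simplex[OF assms(1)] assms(2)] by (simp add: inward_def)
qed

lemma facet_aff_dim:
  assumes K: "K \<in> T" and c: "c \<in> vertices K"
  shows "(int CARD('d) - 1) simplex facet_of_vertex K c"
proof -
  interpret full_simplex "vertices K" by (rule element_simplex[OF K])
  show ?thesis
    unfolding simplex_def facet_def
    using c card_C affine_dependent_subset[of "vertices K - {c}" "vertices K"] indep
    by (intro exI[of _ "vertices K - {c}"]) (auto simp: card_Diff_singleton)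
qed

text \<open>Faces of a simplex are spanned by subsets of its vertices, and only one vertex is left
  to omit.\<close>

lemma proper_face_containing_facet:
  assumes K: "K \<in> T" and c: "c \<in> vertices K" and F: "F face_of K" "F \<noteq> K" "facet_of_vertex K c \<subseteq> F"
  shows "F = facet_of_vertex K c"
proof -
  interpret full_simplex "vertices K" by (rule element_simplex[OF K])
  have "F face_of convex hull (vertices K)" using F(1) element_hull[OF K] by simp
  then obtain D where D: "D \<subseteq> vertices K" "F = convex hull D"
    using face_of_convex_hull_affine_independent[OF indep] by blast
  have "vertices K - {c} \<subseteq> D"
  proof
    fix v assume v: "v \<in> vertices K - {c}"
    then have "v \<in> convex hull D" using F(3) D(2) hull_inc[of v "vertices K - {c}" convex] unfolding facet_def by blast
    show "v \<in> D"
    proof (rule ccontr)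
      assume "v \<notin> D"
      then have "convex hull D \<subseteq> facet v" unfolding facet_def using D(1) by (intro hull_mono) blast
      then have "bary v v = 0" using \<open>v \<in> convex hull D\<close> mem_facet_iff v by blast
      then show False using bary_vertex[of v v] v by simp
    qed
  qed
  moreover have "D \<noteq> vertices K" using F(2) D(2) element_hull[OF K] by auto
  ultimately have "D = vertices K - {c}" using D(1) by blast
  then show ?thesis using D(2) by (simp add: facet_def)
qed

text \<open>\<open>K\<close> may be any element containing the edge: \<open>e\<close> is then still
  an intersection of faces of \<open>K\<close>. Its dimension leaves exactly one vertex of
  \<open>K\<close> over.\<close>

lemma edge_facet:
  assumes e: "e \<in> interior_edges T" and K: "K \<in> T" "e \<subseteq> K"
  obtains c where "c \<in> vertices K" "e = facet_of_vertex K c"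
proof -
  interpret full_simplex "vertices K" by (rule element_simplex[OF K(1)])
  obtain K1 K2 where K12: "K1 \<in> T" "K2 \<in> T" "e = K1 \<inter> K2" and simp: "(int CARD('d) - 1) simplex e"
    using e by (auto simp: interior_edges_def)
  have "(K \<inter> K1) \<inter> (K \<inter> K2) face_of K"
    by (rule face_of_Int[OF faces[OF K(1) K12(1)] faces[OF K(1) K12(2)]])
  moreover have "(K \<inter> K1) \<inter> (K \<inter> K2) = e" using K(2) K12(3) by blast
  ultimately have "e face_of convex hull (vertices K)" using element_hull[OF K(1)] by simp
  then obtain D where D: "D \<subseteq> vertices K" "e = convex hull D"
    using face_of_convex_hull_affine_independent[OF indep] by blast
  have "\<not> affine_dependent D" using indep D(1) affine_dependent_subset by blast
  then have "aff_dim e = int (card D) - 1" using D(2) by (simp add: aff_dim_convex_hull aff_dim_affine_independent)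
  moreover have "aff_dim e = int CARD('d) - 1" using simp by (rule aff_dim_simplex)
  ultimately have "card D = CARD('d)" by simp
  moreover have "finite D" using D(1) finite_C finite_subset by blast
  ultimately have "card (vertices K - D) = 1" using card_Diff_subset[OF _ D(1)] card_C by simp
  then obtain c where c: "vertices K - D = {c}" using card_1_singletonE by blast
  then have "c \<in> vertices K" "D = vertices K - {c}" using D(1) by blast+
  then show thesis using that[of c] D(2) by (simp add: facet_def)
qed

text \<open>The negated clauses make the alternatives exclusive, as uniqueness in
  \<open>elem_K\<close> and \<open>elem_L\<close> requires. They hold because the opposite vertex
  \<open>c\<close> lies at a strictly positive height over the facet.\<close>

lemma edge_normal:
  assumes e: "e \<in> interior_edges T" and K: "K \<in> T" and c: "c \<in> vertices K" "e = facet_of_vertex K c"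
  shows "nrm e = inward K c \<and> (\<forall>x\<in>K. \<forall>y\<in>e. 0 \<le> nrm e \<bullet> (x - y)) \<and> \<not> (\<forall>x\<in>K. \<forall>y\<in>e. nrm e \<bullet> (x - y) \<le> 0)
       \<or> nrm e = - inward K c \<and> (\<forall>x\<in>K. \<forall>y\<in>e. nrm e \<bullet> (x - y) \<le> 0) \<and> \<not> (\<forall>x\<in>K. \<forall>y\<in>e. 0 \<le> nrm e \<bullet> (x - y))"
proof -
  interpret full_simplex "vertices K" by (rule element_simplex[OF K])
  have n: "norm (nrm e) = 1" "\<And>x y. x \<in> facet c \<Longrightarrow> y \<in> facet c \<Longrightarrow> nrm e \<bullet> (x - y) = 0"
    using nrm e c(2) by (auto simp: edge_normals_def)
  have G: "0 < norm (bgrad c)" using bgrad_nonzero[OF c(1)] by simp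
  have val: "inward K c \<bullet> (x - y) = bary c x / norm (bgrad c)" if "x \<in> K" "y \<in> e" for x y
  proof -
    have "bary c y = 0" using that(2) c mem_facet_iff by blast
    then have "bgrad c \<bullet> (x - y) = bary c x" using bary_diff[of c x y] by simp
    then show ?thesis by (simp add: inward_def divide_inverse mult.commute)
  qed
  have ge: "0 \<le> inward K c \<bullet> (x - y)" if "x \<in> K" "y \<in> e" for x y
  proof -
    have "0 \<le> bary c x" using that(1) c(1) element_hull[OF K] mem_hull_iff[of x] by simp
    then show ?thesis unfolding val[OF that] using G by simp
  qed
  obtain y where y: "y \<in> e" using facet_nonempty c(2) by blast
  have cK: "c \<in> K" using c(1) element_hull[OF K] hull_inc by metis
  have pos: "0 < inward K c \<bullet> (c - y)" unfolding val[OF cK y] using bary_vertex[OF c(1), of c] G by simp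
  obtain s where s: "s = 1 \<or> s = -1" "nrm e = s *\<^sub>R inward K c"
    using facet_normal[OF c(1) n] unfolding inward_def by metis
  from s(1) show ?thesis
  proof
    assume "s = 1"
    then have n: "nrm e = inward K c" using s(2) by simp
    have "\<not> (\<forall>x\<in>K. \<forall>y\<in>e. nrm e \<bullet> (x - y) \<le> 0)"
    proof
      assume "\<forall>x\<in>K. \<forall>y\<in>e. nrm e \<bullet> (x - y) \<le> 0"
      then have "nrm e \<bullet> (c - y) \<le> 0" using cK y by blast
      then show False using pos n by simp
    qed
    moreover have "\<forall>x\<in>K. \<forall>y\<in>e. 0 \<le> nrm e \<bullet> (x - y)" unfolding n using ge by blast
    ultimately show ?thesis using n by blast
  next
    assume "s = -1"
    then have n: "nrm e = - inward K c" using s(2) by simp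
    have "\<not> (\<forall>x\<in>K. \<forall>y\<in>e. 0 \<le> nrm e \<bullet> (x - y))"
    proof
      assume "\<forall>x\<in>K. \<forall>y\<in>e. 0 \<le> nrm e \<bullet> (x - y)"
      then have "0 \<le> nrm e \<bullet> (c - y)" using cK y by blast
      then show False using pos n by simp
    qed
    moreover have "\<forall>x\<in>K. \<forall>y\<in>e. nrm e \<bullet> (x - y) \<le> 0" unfolding n using ge by simp
    ultimately show ?thesis using n by blast
  qed
qed

text \<open>A small step along the common inward normal, from a relative interior point of the edge,
  enters the interiors of both elements.\<close>

lemma same_side_eq:
  assumes e: "e \<in> interior_edges T" and K: "K \<in> T" "c \<in> vertices K" "e = facet_of_vertex K c"
    and L: "L \<in> T" "c' \<in> vertices L" "e = facet_of_vertex L c'" and eq: "inward K c = inward L c'"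
  shows "K = L"
proof -
  note sK = element_simplex[OF K(1)] and sL = element_simplex[OF L(1)]
  have "rel_interior e \<noteq> {}"
    using rel_interior_eq_empty full_simplex.convex_facet[OF sK] full_simplex.facet_nonempty[OF sK] K(3) by metis
  then obtain x where x: "x \<in> rel_interior e" by blast
  have "\<forall>\<^sub>F t in at_right 0. x + t *\<^sub>R inward K c \<in> interior K \<and> x + t *\<^sub>R inward K c \<in> interior L"
  proof (rule eventually_conj)
    show "\<forall>\<^sub>F t in at_right 0. x + t *\<^sub>R inward K c \<in> interior K"
      using full_simplex.inward_from_facet[OF sK _ K(2), of x] x K(3) element_hull[OF K(1)] by (simp add: inward_def)
    show "\<forall>\<^sub>F t in at_right 0. x + t *\<^sub>R inward K c \<in> interior L"
      unfolding eq
      using full_simplex.inward_from_facet[OF sL _ L(2), of x] x L(3) element_hull[OF L(1)] by (simp add: inward_def)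
  qed
  then have "\<exists>t. x + t *\<^sub>R inward K c \<in> interior K \<and> x + t *\<^sub>R inward K c \<in> interior L"
    using eventually_happens' trivial_limit_at_right_real by blast
  then show ?thesis using elements_eq[OF K(1) L(1)] by blast
qed

text \<open>By \<open>same_side_eq\<close> the two distinct elements at an edge have opposite inward
  normals, so the fixed normal is inward for exactly one of them. This validates both definite
  descriptions.\<close>

lemma edge_sides:
  assumes e: "e \<in> interior_edges T"
  obtains K L c c' where "K \<in> T" "c \<in> vertices K" "e = facet_of_vertex K c" "nrm e = - inward K c"
    "L \<in> T" "c' \<in> vertices L" "e = facet_of_vertex L c'" "nrm e = inward L c'"
    "elem_K T nrm e = K" "elem_L T nrm e = L" "K \<noteq> L"
proof -
  obtain K1 K2 where K12: "K1 \<in> T" "K2 \<in> T" "K1 \<noteq> K2" "e = K1 \<inter> K2"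
    using e by (auto simp: interior_edges_def)
  obtain c1 where c1: "c1 \<in> vertices K1" "e = facet_of_vertex K1 c1" using edge_facet[OF e K12(1)] K12(4) by blast
  obtain c2 where c2: "c2 \<in> vertices K2" "e = facet_of_vertex K2 c2" using edge_facet[OF e K12(2)] K12(4) by blast
  have "\<exists>K c L c'. K \<in> T \<and> c \<in> vertices K \<and> e = facet_of_vertex K c \<and> nrm e = - inward K c \<and>
     L \<in> T \<and> c' \<in> vertices L \<and> e = facet_of_vertex L c' \<and> nrm e = inward L c' \<and> K \<noteq> L"
    using edge_normal[OF e K12(1) c1] edge_normal[OF e K12(2) c2]
      same_side_eq[OF e K12(1) c1 K12(2) c2] K12(1-3) c1 c2 by (metis neg_equal_iff_equal)
  then obtain K c L c' where KL: "K \<in> T" "c \<in> vertices K" "e = facet_of_vertex K c" "nrm e = - inward K c"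
     "L \<in> T" "c' \<in> vertices L" "e = facet_of_vertex L c'" "nrm e = inward L c'" "K \<noteq> L" by blast
  have eK: "e \<subseteq> K" "e \<subseteq> L"
    using full_simplex.facet_subset[OF element_simplex] element_hull KL by metis+
  have n0: "inward K c \<noteq> - inward K c" and n1: "inward L c' \<noteq> - inward L c'"
    using inward_neq_minus KL(1,2,5,6) by blast+
  have "elem_K T nrm e = K"
    unfolding elem_K_def
  proof (rule the_equality)
    show "K \<in> T \<and> e \<subseteq> K \<and> (\<forall>x\<in>K. \<forall>y\<in>e. nrm e \<bullet> (x - y) \<le> 0)"
      using edge_normal[OF e KL(1-3)] KL(1,4) eK n0 by metis
    fix K' assume K': "K' \<in> T \<and> e \<subseteq> K' \<and> (\<forall>x\<in>K'. \<forall>y\<in>e. nrm e \<bullet> (x - y) \<le> 0)"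
    then obtain d where d: "d \<in> vertices K'" "e = facet_of_vertex K' d" using edge_facet[OF e] by blast
    then have "nrm e = - inward K' d" using edge_normal[OF e _ d] K' by blast
    then show "K' = K" using same_side_eq[OF e _ d KL(1-3)] K' KL(4) by simp
  qed
  moreover have "elem_L T nrm e = L"
    unfolding elem_L_def
  proof (rule the_equality)
    show "L \<in> T \<and> e \<subseteq> L \<and> (\<forall>x\<in>L. \<forall>y\<in>e. 0 \<le> nrm e \<bullet> (x - y))"
      using edge_normal[OF e KL(5-7)] KL(5,8) eK n1 by metis
    fix K' assume K': "K' \<in> T \<and> e \<subseteq> K' \<and> (\<forall>x\<in>K'. \<forall>y\<in>e. 0 \<le> nrm e \<bullet> (x - y))"
    then obtain d where d: "d \<in> vertices K'" "e = facet_of_vertex K' d" using edge_facet[OF e] by blast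
    then have "nrm e = inward K' d" using edge_normal[OF e _ d] K' by blast
    then show "K' = L" using same_side_eq[OF e _ d KL(5-7)] K' KL(8) by simp
  qed
  ultimately show thesis using that KL by blast
qed

lemma elem_of_facet:
  assumes K: "K \<in> T" "c \<in> vertices K" and e: "e = facet_of_vertex K c" "e \<in> interior_edges T"
  shows "(nrm e = - inward K c \<and> elem_K T nrm e = K \<and> elem_L T nrm e \<noteq> K) \<or>
         (nrm e = inward K c \<and> elem_L T nrm e = K \<and> elem_K T nrm e \<noteq> K)"
proof -
  obtain K' c' L d where KL: "K' \<in> T" "c' \<in> vertices K'" "e = facet_of_vertex K' c'" "nrm e = - inward K' c'"
    "L \<in> T" "d \<in> vertices L" "e = facet_of_vertex L d" "nrm e = inward L d"
    "elem_K T nrm e = K'" "elem_L T nrm e = L" "K' \<noteq> L"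
    using edge_sides[OF e(2)] by metis
  from edge_normal[OF e(2) K e(1)] show ?thesis
  proof
    assume a: "nrm e = inward K c \<and> (\<forall>x\<in>K. \<forall>y\<in>e. 0 \<le> nrm e \<bullet> (x - y)) \<and> \<not> (\<forall>x\<in>K. \<forall>y\<in>e. nrm e \<bullet> (x - y) \<le> 0)"
    then have "K = L" using same_side_eq[OF e(2) K e(1) KL(5-7)] KL(8) by simp
    then show ?thesis using a KL(9-11) by simp
  next
    assume a: "nrm e = - inward K c \<and> (\<forall>x\<in>K. \<forall>y\<in>e. nrm e \<bullet> (x - y) \<le> 0) \<and> \<not> (\<forall>x\<in>K. \<forall>y\<in>e. 0 \<le> nrm e \<bullet> (x - y))"
    then have "K = K'" using same_side_eq[OF e(2) K e(1) KL(1-3)] KL(4) by simp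
    then show ?thesis using a KL(9-11) by simp
  qed
qed

text \<open>Points just outside a facet that meets \<open>\<Omega>\<close> are covered by the mesh.\<close>

lemma facet_interior_edge:
  assumes K: "K \<in> T" and c: "c \<in> vertices K" and meets: "facet_of_vertex K c \<inter> \<Omega> \<noteq> {}"
  shows "facet_of_vertex K c \<in> interior_edges T"
proof -
  interpret full_simplex "vertices K" by (rule element_simplex[OF K])
  \<comment> \<open>The relative interior is dense in the facet, so the open set \<Omega> also
    contains a relative interior point of it.\<close>
  have "facet c \<subseteq> closure (rel_interior (facet c))"
    using convex_closure_rel_interior[OF convex_facet] closure_subset by blast
  then obtain x where x: "x \<in> rel_interior (facet c)" "x \<in> \<Omega>"
    using meets open_Int_closure_eq_empty[OF \<Omega>_open, of "rel_interior (facet c)"] by blast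
  have xF: "x \<in> facet c" using x(1) rel_interior_subset by blast
  define z where "z n = x - (1 / real (Suc n)) *\<^sub>R bgrad c" for n
  have zlim: "z \<longlonglongrightarrow> x"
  proof -
    have "(\<lambda>n. x - (1 / real (Suc n)) *\<^sub>R bgrad c) \<longlonglongrightarrow> x - 0 *\<^sub>R bgrad c"
      using LIMSEQ_inverse_real_of_nat by (intro tendsto_intros) (simp add: inverse_eq_divide)
    then show ?thesis by (simp add: z_def[abs_def])
  qed
  have zK: "z n \<notin> K" for n
    unfolding z_def using outward_from_facet[OF xF c, of "1 / real (Suc n)"] element_hull[OF K] by simp
  have "\<forall>\<^sub>F n in sequentially. z n \<in> \<Omega>" using topological_tendstoD[OF zlim \<Omega>_open x(2)] .
  then have "\<forall>\<^sub>F n in sequentially. \<exists>L\<in>T. z n \<in> L"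
    by eventually_elim (use union_T closure_subset in blast)
  then have "\<exists>\<^sub>F n in sequentially. \<exists>L\<in>T. z n \<in> L" by (rule eventually_frequently[OF sequentially_bot])
  then have "\<exists>L\<in>T. \<exists>\<^sub>F n in sequentially. z n \<in> L" by (rule frequently_bex_finite[OF finite_T])
  \<comment> \<open>Finitely many elements cover the points approaching from outside, so one of them
    contains infinitely many, and, being closed, also their limit.\<close>
  then obtain L where L: "L \<in> T" "\<exists>\<^sub>F n in sequentially. z n \<in> L" by blast
  have "L \<noteq> K" using L(2) zK frequently_ex by metis
  have "x \<in> L"
  proof (rule ccontr)
    assume "x \<notin> L"
    then have "\<forall>\<^sub>F n in sequentially. z n \<in> - L"
      using topological_tendstoD[OF zlim, of "- L"] compact_imp_closed[OF element_compact[OF L(1)]]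
      by (simp add: open_Compl)
    then show False using L(2) by (simp add: frequently_def)
  qed
  \<comment> \<open>A face containing a relative interior point of a convex subset contains that
    whole subset.\<close>
  have "facet c \<subseteq> K \<inter> L"
  proof (rule subset_of_face_of[OF faces[OF K L(1)]])
    show "facet c \<subseteq> K" using facet_subset element_hull[OF K] by simp
    show "K \<inter> L \<inter> rel_interior (facet c) \<noteq> {}" using x(1) \<open>x \<in> L\<close> xF facet_subset element_hull[OF K] by blast
  qed
  moreover have "K \<inter> L \<noteq> K"
  proof
    assume a: "K \<inter> L = K"
    have "interior K \<subseteq> interior L" using a by (intro interior_mono) blast
    then show False using elements_eq[OF K L(1)] element_interior_nonempty[OF K] \<open>L \<noteq> K\<close> by blast
  qed
  ultimately have "K \<inter> L = facet c"
    using proper_face_containing_facet[OF K c faces[OF K L(1)]] by simp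
  then show ?thesis
    unfolding interior_edges_def using facet_aff_dim[OF K c] K L(1) \<open>L \<noteq> K\<close> by blast
qed

text \<open>Each partial derivative is decomposed into the cone functionals of
  \<open>cone_trace\<close>, one per vertex. Those of facets outside \<open>interior_edges T\<close>
  vanish. The minus sign reflects that \<open>inward\<close> points into the element.\<close>

lemma element_divergence_theorem:
  fixes u :: "real^'d \<Rightarrow> real^'d"
  assumes K: "K \<in> T" and u: "continuous_on (closure \<Omega>) u" "\<And>i. (\<lambda>x. u x $ i) \<in> H10 \<Omega>"
  shows "(\<integral>x. elem_div T u x * indicator K x \<partial>lebesgue_on \<Omega>)
    = - (\<Sum>c\<in>{c \<in> vertices K. facet_of_vertex K c \<in> interior_edges T}.
           face_integral (inward K c) (facet_of_vertex K c) (\<lambda>x. inward K c \<bullet> u x))"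
proof -
  let ?I = "\<lambda>c. face_integral (inward K c) (facet_of_vertex K c)"
  interpret full_simplex "vertices K" by (rule element_simplex[OF K])
  have hull: "convex hull (vertices K) = K" by (rule element_hull[OF K])
  let ?M = "lebesgue_on \<Omega>"
  let ?A = "{c \<in> vertices K. facet c \<in> interior_edges T}"
  have sets: "\<Omega> \<in> sets lebesgue" "interiors \<in> sets lebesgue" "K \<in> sets lebesgue" "interior K \<in> sets lebesgue"
    using \<Omega>_open interiors_open element_compact[OF K] by (auto simp: borel_compact)
  have uK: "continuous_on K u" using u(1) element_subset[OF K] continuous_on_subset by blast
  have "\<exists>p. H1_limit \<Omega> (\<lambda>x. u x $ i) (fst p) (snd p)" for i
    using H10_H1_limit[OF u(2) \<Omega>_open \<Omega>_bounded] by (metis fst_conv snd_conv)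
  then obtain p where p: "\<And>i. H1_limit \<Omega> (\<lambda>x. u x $ i) (fst (p i)) (snd (p i))" by metis
  define g where "g i = fst (p i)" for i
  define \<psi> where "\<psi> i = snd (p i)" for i
  let ?q = "\<lambda>i c x. g i x \<bullet> (x - c) + real CARD('d) * u x $ i"
  have lim: "H1_limit \<Omega> (\<lambda>x. u x $ i) (g i) (\<psi> i)" for i using p by (simp add: g_def \<psi>_def)
  define h where "h i = elem_grad T (\<lambda>x. u x $ i)" for i
  have gS: "H1_with_grad interiors (\<lambda>x. u x $ i) (g i)" for i
    by (rule H1_limit_weak_gradient[OF lim \<Omega>_open \<Omega>_bounded interiors_open AE_interiors])
  have hS: "H1_with_grad interiors (\<lambda>x. u x $ i) (h i)" for i
    unfolding h_def elem_grad_def interiors_def[symmetric]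
    using someI[of "H1_with_grad interiors (\<lambda>x. u x $ i)", OF gS] .
  \<comment> \<open>Weak gradients live on the union of the open elements, the forms on \<Omega>;
    this carries integrals over \<open>K\<close> from one to the other.\<close>
  have conv: "integrable ?M (\<lambda>x. indicator K x * k x $ i)"
       "(\<integral>x. indicator K x * k x $ i \<partial>?M) = (\<integral>x. indicator (interior K) x * k x $ i \<partial>lebesgue_on interiors)"
    if k: "H1_with_grad interiors v k" for k v i
  proof -
    have "k \<in> L2_space interiors" using k by (simp add: H1_with_grad_def)
    then have "integrable (lebesgue_on interiors) k"
      by (rule L2_space_integrable[OF open_bounded_lmeasurable[OF interiors_open interiors_bounded]])
    then have ki: "integrable (lebesgue_on interiors) (\<lambda>x. k x $ i)"
      by (rule integrable_bounded_linear[OF bounded_linear_vec_nth])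
    have "AE x in lebesgue. x \<in> interiors \<longleftrightarrow> x \<in> \<Omega>" using AE_interiors by eventually_elim blast
    note eqs = lebesgue_on_AE_eq[OF sets(2,1) this]
    have sK: "K \<inter> space (lebesgue_on interiors) \<in> sets (lebesgue_on interiors)"
       "interior K \<inter> space (lebesgue_on interiors) \<in> sets (lebesgue_on interiors)"
      using sets by (auto simp: sets_restrict_space space_restrict_space Int_commute)
    have iK: "integrable (lebesgue_on interiors) (\<lambda>x. indicator K x * k x $ i)"
      using integrable_mult_indicator[of "K \<inter> space (lebesgue_on interiors)", OF sK(1) ki]
      by (rule Bochner_Integration.integrable_cong[THEN iffD1, rotated -1]) (auto simp: indicator_def)
    have iI: "integrable (lebesgue_on interiors) (\<lambda>x. indicator (interior K) x * k x $ i)"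
      using integrable_mult_indicator[of "interior K \<inter> space (lebesgue_on interiors)", OF sK(2) ki]
      by (rule Bochner_Integration.integrable_cong[THEN iffD1, rotated -1]) (auto simp: indicator_def)
    show "integrable ?M (\<lambda>x. indicator K x * k x $ i)"
      by (rule iffD1[OF eqs(2)[OF borel_measurable_integrable[OF iK]] iK])
    have "(\<integral>x. indicator K x * k x $ i \<partial>?M) = (\<integral>x. indicator K x * k x $ i \<partial>lebesgue_on interiors)"
      by (rule eqs(3)[OF borel_measurable_integrable[OF iK], symmetric])
    also have "\<dots> = (\<integral>x. indicator (interior K) x * k x $ i \<partial>lebesgue_on interiors)"
    proof (rule integral_cong_AE[OF borel_measurable_integrable[OF iK] borel_measurable_integrable[OF iI]])
      have "AE x in lebesgue_on interiors. x \<in> K \<longleftrightarrow> x \<in> interior K"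
        using AE_interior[OF K] sets(2) by (auto simp: AE_restrict_space_iff)
      then show "AE x in lebesgue_on interiors. indicator K x * k x $ i = indicator (interior K) x * k x $ i"
        by eventually_elim (simp add: indicator_def)
    qed
    finally show "(\<integral>x. indicator K x * k x $ i \<partial>?M) = (\<integral>x. indicator (interior K) x * k x $ i \<partial>lebesgue_on interiors)" .
  qed
  \<comment> \<open>The representative chosen by \<open>elem_grad\<close> is exchanged for the limit
    of the test function gradients, to which \<open>cone_trace\<close> applies.\<close>
  have hg: "(\<integral>x. indicator K x * h i x $ i \<partial>?M) = (\<integral>x. indicator K x * g i x $ i \<partial>?M)" for i
  proof -
    have "interior (convex hull (vertices K)) \<subseteq> interiors" using K by (auto simp: hull interiors_def)
    from weak_gradient_integral_unique[OF element_simplex[OF K] interiors_open interiors_bounded this hS gS]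
    show ?thesis unfolding conv(2)[OF hS] conv(2)[OF gS] hull .
  qed
  have F: "compact (facet c)" "convex (facet c)" "facet c \<noteq> {}" for c
    using compact_facet convex_facet facet_nonempty by auto
  have uF: "continuous_on (facet c) (\<lambda>x. u x $ i)" for c i
    using continuous_on_subset[OF uK] facet_subset hull by (intro continuous_on_component) blast
  define X where "X i c = (\<integral>x. indicator K x * ?q i c x \<partial>?M)" for i c
  have AEK: "AE x in lebesgue. x \<in> convex hull (vertices K) \<longrightarrow> x \<in> \<Omega>" using AE_element[OF K] hull by simp
  have uK': "continuous_on (convex hull (vertices K)) (\<lambda>x. u x $ i)" for i
    using continuous_on_component[OF uK] hull by simp
  have ct: "X i c = ?I c (\<lambda>x. u x $ i) / norm (bgrad c)"
      "facet c \<inter> \<Omega> = {} \<Longrightarrow> X i c = 0"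
      "integrable ?M (\<lambda>x. indicator K x * ?q i c x)"
    if "c \<in> vertices K" for i c
    using cone_trace[OF element_simplex[OF K] that \<Omega>_open \<Omega>_bounded AEK lim uK', of i]
    unfolding hull X_def inward_def by blast+
  \<comment> \<open>The i-th unit vector is the combination of the vectors c - x with coefficients
    \<open>bgrad c $ i\<close>. These sum to zero, so the zero-order terms d u_i cancel.\<close>
  have gX: "(\<integral>x. indicator K x * g i x $ i \<partial>?M) = (\<Sum>c\<in>vertices K. - (bgrad c $ i) * X i c)" for i
  proof -
    have "indicator K x * g i x $ i
        = (\<Sum>c\<in>vertices K. - (bgrad c $ i) * (indicator K x * ?q i c x))" for x
    proof -
      have bi: "bgrad c $ i = bgrad c \<bullet> axis i 1" for c by (simp add: inner_axis)
      have s0: "(\<Sum>c\<in>vertices K. bgrad c $ i) = 0" unfolding bi by (rule sum_bgrad)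
      have s1: "(\<Sum>c\<in>vertices K. (bgrad c $ i) *\<^sub>R c) = axis i 1" unfolding bi by (rule bgrad_combination)
      have "(\<Sum>c\<in>vertices K. - (bgrad c $ i) * ?q i c x)
          = (\<Sum>c\<in>vertices K. (g i x \<bullet> ((bgrad c $ i) *\<^sub>R c))
              - (bgrad c $ i) * (g i x \<bullet> x + real CARD('d) * u x $ i))"
        by (rule sum.cong) (simp_all add: inner_diff_right algebra_simps)
      also have "\<dots> = g i x \<bullet> (\<Sum>c\<in>vertices K. (bgrad c $ i) *\<^sub>R c)
          - (\<Sum>c\<in>vertices K. bgrad c $ i) * (g i x \<bullet> x + real CARD('d) * u x $ i)"
        by (simp add: sum_subtractf inner_sum_right sum_distrib_right)
      also have "\<dots> = g i x $ i" unfolding s0 s1 by (simp add: inner_axis)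
      finally have e: "(\<Sum>c\<in>vertices K. - (bgrad c $ i) * ?q i c x) = g i x $ i" .
      show ?thesis
        unfolding e[symmetric] sum_distrib_left by (rule sum.cong) (simp_all add: mult.left_commute)
    qed
    then have "(\<integral>x. indicator K x * g i x $ i \<partial>?M) = (\<integral>x. (\<Sum>c\<in>vertices K. - (bgrad c $ i) *
        (indicator K x * ?q i c x)) \<partial>?M)" by simp
    also have "\<dots> = (\<Sum>c\<in>vertices K. (\<integral>x. - (bgrad c $ i) *
        (indicator K x * ?q i c x) \<partial>?M))"
      by (rule Bochner_Integration.integral_sum) (rule integrable_mult_right, rule ct(3))
    also have "\<dots> = (\<Sum>c\<in>vertices K. - (bgrad c $ i) * X i c)"
      by (rule sum.cong[OF refl]) (simp add: X_def)
    finally show ?thesis .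
  qed
  have "(\<integral>x. elem_div T u x * indicator K x \<partial>?M) = (\<integral>x. (\<Sum>i\<in>UNIV. indicator K x * h i x $ i) \<partial>?M)"
    by (rule Bochner_Integration.integral_cong[OF refl])
       (simp add: elem_div_def elem_vgrad_def h_def sum_distrib_right mult.commute)
  also have "\<dots> = (\<Sum>i\<in>UNIV. (\<integral>x. indicator K x * h i x $ i \<partial>?M))"
    by (rule Bochner_Integration.integral_sum) (rule conv(1)[OF hS])
  also have "\<dots> = (\<Sum>i\<in>UNIV. \<Sum>c\<in>vertices K. - (bgrad c $ i) * X i c)" unfolding hg gX ..
  also have "\<dots> = (\<Sum>c\<in>vertices K. \<Sum>i\<in>UNIV. - (bgrad c $ i) * X i c)" by (rule sum.swap)
  also have "\<dots> = (\<Sum>c\<in>?A. \<Sum>i\<in>UNIV. - (bgrad c $ i) * X i c)"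
  proof (rule sum.mono_neutral_right)
    show "\<forall>c\<in>vertices K - ?A. (\<Sum>i\<in>UNIV. - (bgrad c $ i) * X i c) = 0"
    proof
      fix c assume c: "c \<in> vertices K - ?A"
      then have "facet c \<inter> \<Omega> = {}" using facet_interior_edge[OF K] by blast
      then have "X i c = 0" for i using ct(2) c by blast
      then show "(\<Sum>i\<in>UNIV. - (bgrad c $ i) * X i c) = 0" by simp
    qed
  qed auto
  also have "\<dots> = (\<Sum>c\<in>?A. - ?I c (\<lambda>x. inward K c \<bullet> u x))"
  proof (rule sum.cong[OF refl])
    fix c assume c: "c \<in> ?A"
    have "?I c (\<lambda>x. inward K c \<bullet> u x)
        = ?I c (\<lambda>x. \<Sum>i\<in>UNIV. inward K c $ i * u x $ i)"
      by (simp add: inner_vec_def)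
    also have "\<dots> = (\<Sum>i\<in>UNIV. ?I c (\<lambda>x. inward K c $ i * u x $ i))"
      by (rule face_integral_sum[OF F]) (intro continuous_on_mult continuous_on_const uF)
    also have "\<dots> = (\<Sum>i\<in>UNIV. bgrad c $ i * X i c)"
    proof (rule sum.cong[OF refl])
      fix i
      have cV: "c \<in> vertices K" using c by blast
      \<comment> \<open>The norm dividing the facet integral in \<open>cone_trace\<close> is exactly
        the one that normalises \<open>bgrad c\<close>.\<close>
      have i: "inward K c $ i = bgrad c $ i / norm (bgrad c)" by (simp add: inward_def divide_inverse mult.commute)
      show "?I c (\<lambda>x. inward K c $ i * u x $ i) = bgrad c $ i * X i c"
        unfolding face_integral_cmult ct(1)[OF cV] i by simp
    qed
    finally show "(\<Sum>i\<in>UNIV. - (bgrad c $ i) * X i c) = - ?I c (\<lambda>x. inward K c \<bullet> u x)"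
      by (simp add: sum_negf)
  qed
  finally show ?thesis by (simp add: sum_negf)
qed

end


section \<open>The maximum principle\<close>

lemma pos_part_nonneg: "0 \<le> pos_part v" and neg_part_nonneg: "0 \<le> neg_part v"
  and pos_part_minus_neg_part: "pos_part v - neg_part v = v"
  and pos_part_eq_0: "v \<le> 0 \<Longrightarrow> pos_part v = 0"
  by (auto simp: pos_part_def neg_part_def)

lemma mob_up_le_1: "mob_up z \<le> 1" and mob_down_nonpos: "mob_down z \<le> 0"
  by (auto simp: mob_up_def mob_down_def mob_def pos_part_def)

lemma one_less_square: "1 < z\<^sup>2" if "1 < z \<or> z < - 1" for z :: real
  using that abs_square_le_1[of z] by (auto simp: not_le[symmetric] abs_le_iff)

text \<open>Outside [-1,1] the mobility is zero. Above 1 the decreasing part has dropped by all of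
  M(0) = 1, which cancels the bound 1 for the increasing part; below -1 the increasing part has not
  yet started.\<close>

lemma mob_down_above: "1 < z \<Longrightarrow> mob_down z = - 1" and mob_up_below: "z < - 1 \<Longrightarrow> mob_up z = 0"
  using one_less_square[of z] by (auto simp: mob_up_def mob_down_def mob_def pos_part_def)

section \<open>Piecewise constant functions and their traces\<close>

lemma polys_0: "p \<in> polys 0 \<longleftrightarrow> (\<exists>a. p = (\<lambda>x::real^'d. a))"
proof -
  have "{\<alpha>::'d \<Rightarrow> nat. (\<Sum>i\<in>UNIV. \<alpha> i) \<le> 0} = {\<lambda>i. 0}" by (auto simp: fun_eq_iff)
  then show ?thesis by (auto simp: polys_def)
qed

lemma Pdisc_0_const:
  assumes "v \<in> Pdisc 0 T" "K \<in> T"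
  obtains a where "\<And>x. x \<in> interior K \<Longrightarrow> v x = a"
proof -
  obtain p where p: "p \<in> polys 0" "\<forall>x\<in>interior K. v x = p x"
    using assms by (auto simp: Pdisc_def)
  then obtain a where "p = (\<lambda>x. a)" using polys_0 by blast
  then show thesis using p(2) by (intro that[of a]) simp
qed

context polyhedral_mesh begin

lemma \<Omega>_sets: "\<Omega> \<in> sets lebesgue"
  using \<Omega>_open by simp

lemma notin_element:
  assumes "K \<in> T" "L \<in> T" "K \<noteq> L" "x \<in> interior L"
  shows "x \<notin> K"
proof
  assume x: "x \<in> K"
  have "K \<inter> L = L"
    using face_of_disjoint_interior[OF faces'[OF assms(1,2)]] x assms(4) interior_subset by blast
  then have "interior L \<subseteq> interior K" by (intro interior_mono) blast
  then show False using elements_eq[OF assms(1,2)] assms(3,4) by blast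
qed

lemma indicator_Pdisc:
  assumes "K \<in> T"
  shows "indicator K \<in> Pdisc 0 T"
  unfolding Pdisc_def
proof (rule CollectI, rule ballI)
  fix L assume L: "L \<in> T"
  show "\<exists>p\<in>polys 0. \<forall>x\<in>interior L. indicator K x = p x"
  proof (cases "K = L")
    case True
    then show ?thesis using interior_subset[of L] by (intro bexI[of _ "\<lambda>_. 1"]) (auto simp: polys_0 indicator_def)
  next
    case False
    then show ?thesis using notin_element[OF assms L] by (intro bexI[of _ "\<lambda>_. 0"]) (auto simp: polys_0 indicator_def)
  qed
qed

text \<open>\<open>Lim\<close> determines a value only along a nontrivial filter, so each point of
  an element has to be a limit point of its interior.\<close>

lemma trace_on_const:
  assumes K: "K \<in> T" and v: "\<And>x. x \<in> interior K \<Longrightarrow> v x = a" and y: "y \<in> K"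
  shows "trace_on K v y = a"
proof -
  have "y islimpt interior K"
  proof (cases "y \<in> interior K")
    case True
    then have "y \<in> interior (interior K)" by simp
    then show ?thesis by (rule interior_limit_point)
  next
    case False
    then show ?thesis using y element_closure_interior[OF K] by (auto simp: closure_def)
  qed
  then have "\<not> trivial_limit (at y within interior K)" by (simp add: trivial_limit_within)
  moreover have "(v \<longlongrightarrow> a) (at y within interior K)"
    by (rule tendsto_eventually) (simp add: eventually_at_filter v)
  ultimately show ?thesis unfolding trace_on_def by (rule tendsto_Lim)
qed

text \<open>Read off the open element, since \<open>Pdisc\<close> leaves the values on the mesh
  skeleton free.\<close>

definition cell_value :: "(real^'d \<Rightarrow> real) \<Rightarrow> (real^'d) set \<Rightarrow> real" where
  "cell_value v K = (SOME a. \<forall>x\<in>interior K. v x = a)"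

lemma cell_value: "v \<in> Pdisc 0 T \<Longrightarrow> K \<in> T \<Longrightarrow> x \<in> interior K \<Longrightarrow> v x = cell_value v K"
proof -
  assume v: "v \<in> Pdisc 0 T" "K \<in> T" "x \<in> interior K"
  have "\<exists>a. \<forall>x\<in>interior K. v x = a" using Pdisc_0_const[OF v(1,2)] by metis
  then have "\<forall>x\<in>interior K. v x = cell_value v K" unfolding cell_value_def by (rule someI_ex)
  then show ?thesis using v(3) by blast
qed

lemma trace_on_cell: "v \<in> Pdisc 0 T \<Longrightarrow> K \<in> T \<Longrightarrow> y \<in> K \<Longrightarrow> trace_on K v y = cell_value v K"
  by (rule trace_on_const[OF _ cell_value])

lemma cell_value_indicator:
  assumes "K \<in> T" "L \<in> T"
  shows "cell_value (indicator K) L = (if L = K then 1 else 0)"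
proof -
  obtain x where x: "x \<in> interior L" using element_interior_nonempty[OF assms(2)] by blast
  have "cell_value (indicator K) L = indicator K x"
    by (rule cell_value[OF indicator_Pdisc[OF assms(1)] assms(2) x, symmetric])
  then show ?thesis using x notin_element[OF assms _ x] interior_subset by (auto simp: indicator_def)
qed

lemma finite_interior_edges: "finite (interior_edges T)"
proof (rule finite_subset)
  show "interior_edges T \<subseteq> (\<lambda>(K, L). K \<inter> L) ` (T \<times> T)" by (auto simp: interior_edges_def)
qed (use finite_T in simp)

lemma edge_elements:
  assumes "e \<in> interior_edges T"
  shows "elem_K T nrm e \<in> T" "elem_L T nrm e \<in> T" "elem_K T nrm e \<noteq> elem_L T nrm e"
    "e \<subseteq> elem_K T nrm e" "e \<subseteq> elem_L T nrm e" "compact e" "convex e" "e \<noteq> {}" "closed e"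
    "\<And>x y. x \<in> e \<Longrightarrow> y \<in> e \<Longrightarrow> nrm e \<bullet> (x - y) = 0"
proof -
  obtain K L c c' where KL: "K \<in> T" "c \<in> vertices K" "e = facet_of_vertex K c"
    "L \<in> T" "c' \<in> vertices L" "e = facet_of_vertex L c'"
    "elem_K T nrm e = K" "elem_L T nrm e = L" "K \<noteq> L"
    using edge_sides[OF assms] by metis
  note s = element_simplex[OF KL(1)]
  show "elem_K T nrm e \<in> T" "elem_L T nrm e \<in> T" "elem_K T nrm e \<noteq> elem_L T nrm e" using KL by auto
  show "e \<subseteq> elem_K T nrm e" "e \<subseteq> elem_L T nrm e"
    using full_simplex.facet_subset[OF element_simplex] element_hull KL by metis+
  show "compact e" "convex e" "e \<noteq> {}"
    using full_simplex.compact_facet[OF s] full_simplex.convex_facet[OF s] full_simplex.facet_nonempty[OF s] KL(3) by auto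
  then show "closed e" using compact_imp_closed by blast
  show "\<And>x y. x \<in> e \<Longrightarrow> y \<in> e \<Longrightarrow> nrm e \<bullet> (x - y) = 0"
    using nrm assms by (simp add: edge_normals_def)
qed

lemma edge_jump_indicator:
  assumes "K \<in> T" "e \<in> interior_edges T" "x \<in> e"
  shows "edge_jump T nrm e (indicator K) x
    = (if elem_K T nrm e = K then 1 else 0) - (if elem_L T nrm e = K then 1 else 0)"
proof -
  note E = edge_elements[OF assms(2)]
  have x: "x \<in> elem_K T nrm e" "x \<in> elem_L T nrm e" using E(4,5) assms(3) by blast+
  show ?thesis
    unfolding edge_jump_def trace_on_cell[OF indicator_Pdisc[OF assms(1)] E(1) x(1)]
      trace_on_cell[OF indicator_Pdisc[OF assms(1)] E(2) x(2)]
      cell_value_indicator[OF assms(1) E(1)] cell_value_indicator[OF assms(1) E(2)] ..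
qed

text \<open>An interior edge contained in \<open>K\<close> is a facet of \<open>K\<close>, and
  distinct vertices have distinct opposite facets, so the sum can be reindexed by vertices.\<close>

lemma sum_edges_element:
  assumes K: "K \<in> T"
    and f: "\<And>e. e \<in> interior_edges T \<Longrightarrow> elem_K T nrm e \<noteq> K \<Longrightarrow> elem_L T nrm e \<noteq> K \<Longrightarrow> f e = (0::real)"
  shows "(\<Sum>e\<in>interior_edges T. f e)
    = (\<Sum>c\<in>{c \<in> vertices K. facet_of_vertex K c \<in> interior_edges T}. f (facet_of_vertex K c))"
proof -
  let ?A = "{c \<in> vertices K. facet_of_vertex K c \<in> interior_edges T}"
  have inj: "inj_on (facet_of_vertex K) ?A"
    using full_simplex.facet_inj[OF element_simplex[OF K]] by (auto intro!: inj_onI)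
  have "(\<Sum>e\<in>interior_edges T. f e) = (\<Sum>e\<in>facet_of_vertex K ` ?A. f e)"
  proof (rule sum.mono_neutral_right[OF finite_interior_edges])
    show "\<forall>e\<in>interior_edges T - facet_of_vertex K ` ?A. f e = 0"
    proof
      fix e assume e: "e \<in> interior_edges T - facet_of_vertex K ` ?A"
      then have eE: "e \<in> interior_edges T" by blast
      have "\<not> e \<subseteq> K"
      proof
        assume "e \<subseteq> K"
        then obtain c where "c \<in> vertices K" "e = facet_of_vertex K c" using edge_facet[OF eE K] by blast
        then show False using e by blast
      qed
      then show "f e = 0" using f[OF eE] edge_elements(4,5)[OF eE] by blast
    qed
  qed auto
  also have "\<dots> = (\<Sum>c\<in>?A. f (facet_of_vertex K c))" by (simp add: sum.reindex[OF inj])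
  finally show ?thesis .
qed

text \<open>For \<open>\<sigma> = 1\<close> (resp. \<open>\<sigma> = - 1\<close>) the element \<open>K\<close> carries the largest (resp. smallest) value.
  There the upwind flux dominates the flux of the constant \<open>cell_value \<phi> K\<close>, whose total vanishes
  by discrete incompressibility.\<close>

lemma a_upw_extremal:
  fixes u :: "real^'d \<Rightarrow> real^'d"
  assumes \<phi>: "\<phi> \<in> Pdisc 0 T" and K: "K \<in> T"
    and ext: "\<And>L. L \<in> T \<Longrightarrow> \<sigma> * cell_value \<phi> L \<le> \<sigma> * cell_value \<phi> K"
    and u: "continuous_on (closure \<Omega>) u" "\<And>i. (\<lambda>x. u x $ i) \<in> H10 \<Omega>"
    and div: "(\<integral>x. elem_div T u x * indicator K x \<partial>lebesgue_on \<Omega>) = 0"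
  shows "0 \<le> \<sigma> * a_upw T nrm u \<phi> (indicator K)"
proof -
  let ?A = "{c \<in> vertices K. facet_of_vertex K c \<in> interior_edges T}"
  let ?v = "cell_value \<phi>"
  let ?s = "\<lambda>e. (if elem_K T nrm e = K then 1 else 0) - (if elem_L T nrm e = K then 1 else (0::real))"
  let ?F = "\<lambda>e x. pos_part (u x \<bullet> nrm e) * ?v (elem_K T nrm e) - neg_part (u x \<bullet> nrm e) * ?v (elem_L T nrm e)"
  let ?G = "\<lambda>e x. pos_part (u x \<bullet> nrm e) * trace_on (elem_K T nrm e) \<phi> x
      - neg_part (u x \<bullet> nrm e) * trace_on (elem_L T nrm e) \<phi> x"
  let ?I = "\<lambda>c. face_integral (inward K c) (facet_of_vertex K c) (\<lambda>x. inward K c \<bullet> u x)"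
  define f where "f e = face_integral (nrm e) e
        (\<lambda>x. ?G e x * edge_jump T nrm e (indicator K) x)" for e
  have f: "f e = face_integral (nrm e) e
        (\<lambda>x. ?F e x
          * ?s e)"
    if e: "e \<in> interior_edges T" for e
  proof -
    note E = edge_elements[OF e]
    show ?thesis
      unfolding f_def
    proof (rule face_integral_cong[OF E(9,8)])
      fix x assume x: "x \<in> e"
      then have x': "x \<in> elem_K T nrm e" "x \<in> elem_L T nrm e" using E(4,5) by blast+
      show "?G e x * edge_jump T nrm e (indicator K) x
        = ?F e x
          * ?s e"
        unfolding edge_jump_indicator[OF K e x] trace_on_cell[OF \<phi> E(1) x'(1)] trace_on_cell[OF \<phi> E(2) x'(2)] ..
    qed
  qed
  have f0: "f e = 0" if "e \<in> interior_edges T" "elem_K T nrm e \<noteq> K" "elem_L T nrm e \<noteq> K" for e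
    unfolding f[OF that(1)] using that(2,3) by (simp add: face_integral_def)
  have main: "- (\<sigma> * ?v K) * ?I c
      \<le> \<sigma> * f (facet_of_vertex K c)" if c: "c \<in> ?A" for c
  proof -
    define e where "e = facet_of_vertex K c"
    have e: "e \<in> interior_edges T" and cK: "c \<in> vertices K" using c by (auto simp: e_def)
    note E = edge_elements[OF e]
    have ue: "continuous_on e u"
      using u(1) E(4) element_subset[OF E(1)] continuous_on_subset by blast
    have w: "continuous_on e (\<lambda>x. u x \<bullet> n)" "continuous_on e (\<lambda>x. pos_part (u x \<bullet> n))"
      "continuous_on e (\<lambda>x. neg_part (u x \<bullet> n))" for n
      unfolding pos_part_def neg_part_def by (intro continuous_intros ue)+
    \<comment> \<open>The sign s converts the fixed edge normal into the inward normal of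
      \<open>K\<close>: -1 when \<open>K\<close> is the element the normal leaves, 1 when it is the
      one entered.\<close>
    have ge: "- (\<sigma> * ?v K) * face_integral (nrm e) e (\<lambda>x. s * (u x \<bullet> nrm e)) \<le> \<sigma> * f e"
      if s: "elem_K T nrm e = K \<and> s = -1 \<or> elem_L T nrm e = K \<and> s = (1::real)" for s
    proof -
      have "face_integral (nrm e) e (\<lambda>x. - (\<sigma> * ?v K) * (s * (u x \<bullet> nrm e)))
         \<le> face_integral (nrm e) e (\<lambda>x. \<sigma> * (?F e x
          * ?s e))"
      proof (rule face_integral_mono[OF E(6,7,8)])
        fix x
        define pp where "pp = pos_part (u x \<bullet> nrm e)"
        define mm where "mm = neg_part (u x \<bullet> nrm e)"
        have pm: "u x \<bullet> nrm e = pp - mm" "0 \<le> pp" "0 \<le> mm"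
          unfolding pp_def mm_def by (simp_all add: pos_part_minus_neg_part pos_part_nonneg neg_part_nonneg)
        from s show "- (\<sigma> * ?v K) * (s * (u x \<bullet> nrm e))
          \<le> \<sigma> * (?F e x
          * ?s e)"
          unfolding pp_def[symmetric] mm_def[symmetric] unfolding pm(1)
        proof
          \<comment> \<open>The outgoing part already carries the value on \<open>K\<close>; only
            the incoming part carries the neighbour's value, and there extremality is used.\<close>
          assume a: "elem_K T nrm e = K \<and> s = -1"
          then have "elem_L T nrm e \<noteq> K" using E(3) by auto
          moreover have "mm * (\<sigma> * ?v (elem_L T nrm e)) \<le> mm * (\<sigma> * ?v K)"
            using ext[OF E(2)] pm(3) by (rule mult_left_mono)
          ultimately show "- (\<sigma> * ?v K) * (s * (pp - mm))
            \<le> \<sigma> * ((pp * ?v (elem_K T nrm e) - mm * ?v (elem_L T nrm e))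
              * ?s e)"
            using a by (simp add: algebra_simps)
        next
          assume a: "elem_L T nrm e = K \<and> s = 1"
          then have "elem_K T nrm e \<noteq> K" using E(3) by auto
          moreover have "pp * (\<sigma> * ?v (elem_K T nrm e)) \<le> pp * (\<sigma> * ?v K)"
            using ext[OF E(1)] pm(2) by (rule mult_left_mono)
          ultimately show "- (\<sigma> * ?v K) * (s * (pp - mm))
            \<le> \<sigma> * ((pp * ?v (elem_K T nrm e) - mm * ?v (elem_L T nrm e))
              * ?s e)"
            using a by (simp add: algebra_simps)
        qed
      qed (intro continuous_intros w)+
      then show ?thesis unfolding f[OF e] face_integral_cmult .
    qed
    have orth: "inward K c \<bullet> (x - y) = 0" if "x \<in> e" "y \<in> e" for x y
      using full_simplex.bgrad_orthogonal_facet[OF element_simplex[OF K] cK] that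
      unfolding e_def inward_def by simp
    have cont: "continuous_on e (\<lambda>x. inward K c \<bullet> u x)" by (intro continuous_intros ue)
    have eK: "e = facet_of_vertex K c" by (simp add: e_def)
    show ?thesis
      unfolding e_def[symmetric]
      using elem_of_facet[OF K cK eK e]
    proof
      assume a: "nrm e = - inward K c \<and> elem_K T nrm e = K \<and> elem_L T nrm e \<noteq> K"
      then have "face_integral (nrm e) e (\<lambda>x. -1 * (u x \<bullet> nrm e)) = face_integral (- inward K c) e (\<lambda>x. inward K c \<bullet> u x)"
        by (simp add: inner_commute)
      \<comment> \<open>The edge normal points out of \<open>K\<close>, so its prism is traded for
        the one on the inner side that the divergence theorem uses.\<close>
      also have "\<dots> = face_integral (inward K c) e (\<lambda>x. inward K c \<bullet> u x)"
        by (rule face_integral_minus_normal[OF E(6,7,8) cont orth])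
      finally show "- (\<sigma> * ?v K) * face_integral (inward K c) e (\<lambda>x. inward K c \<bullet> u x) \<le> \<sigma> * f e"
        using ge[of "-1"] a by simp
    next
      assume a: "nrm e = inward K c \<and> elem_L T nrm e = K \<and> elem_K T nrm e \<noteq> K"
      then show "- (\<sigma> * ?v K) * face_integral (inward K c) e (\<lambda>x. inward K c \<bullet> u x) \<le> \<sigma> * f e"
        using ge[of 1] by (simp add: inner_commute)
    qed
  qed
  have flux: "(\<Sum>c\<in>?A. ?I c) = 0"
    using element_divergence_theorem[OF K u] div by simp
  have "0 = (\<Sum>c\<in>?A. - (\<sigma> * ?v K) * ?I c)"
    unfolding sum_distrib_left[symmetric] flux by simp
  also have "\<dots> \<le> (\<Sum>c\<in>?A. \<sigma> * f (facet_of_vertex K c))" by (rule sum_mono) (rule main)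
  also have "\<dots> = \<sigma> * (\<Sum>e\<in>interior_edges T. f e)"
  proof -
    have se: "(\<Sum>e\<in>interior_edges T. f e) = (\<Sum>c\<in>?A. f (facet_of_vertex K c))"
      by (rule sum_edges_element[OF K f0])
    show ?thesis unfolding se sum_distrib_left ..
  qed
  also have "\<dots> = \<sigma> * a_upw T nrm u \<phi> (indicator K)" unfolding a_upw_def f_def ..
  finally show ?thesis .
qed

text \<open>Where the value of \<open>\<phi>\<close> leaves
  \<open>[- 1, 1]\<close>, the upwinded mobility of the flux that would drive it further away vanishes.\<close>

lemma b_upw_sign:
  assumes \<phi>: "\<phi> \<in> Pdisc 0 T" and K: "K \<in> T"
    and \<sigma>: "\<sigma> = 1 \<and> 1 < cell_value \<phi> K \<or> \<sigma> = - 1 \<and> cell_value \<phi> K < - 1"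
  shows "0 \<le> \<sigma> * b_upw \<Omega> T nrm \<mu> \<phi> (indicator K)"
proof -
  let ?v = "cell_value \<phi>"
  define F where "F e x = (let j = edge_jump T nrm e (Pi0 \<Omega> T \<mu>) x;
                 \<phi>K = trace_on (elem_K T nrm e) \<phi> x;
                 \<phi>L = trace_on (elem_L T nrm e) \<phi> x
             in (pos_part j * pos_part (mob_up \<phi>K + mob_down \<phi>L)
                 - neg_part j * pos_part (mob_up \<phi>L + mob_down \<phi>K)) * edge_jump T nrm e (indicator K) x)" for e x
  have "0 \<le> \<sigma> * F e x" if e: "e \<in> interior_edges T" and x: "x \<in> e" for e x
  proof -
    note E = edge_elements[OF e]
    have x': "x \<in> elem_K T nrm e" "x \<in> elem_L T nrm e" using E(4,5) x by blast+
    define j where "j = edge_jump T nrm e (Pi0 \<Omega> T \<mu>) x"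
    define a where "a = ?v (elem_K T nrm e)"
    define b where "b = ?v (elem_L T nrm e)"
    define s where "s = (if elem_K T nrm e = K then 1 else 0) - (if elem_L T nrm e = K then 1 else (0::real))"
    have F: "F e x = (pos_part j * pos_part (mob_up a + mob_down b) - neg_part j * pos_part (mob_up b + mob_down a)) * s"
      unfolding F_def Let_def edge_jump_indicator[OF K e x] trace_on_cell[OF \<phi> E(1) x'(1)]
        trace_on_cell[OF \<phi> E(2) x'(2)] j_def a_def b_def s_def ..
    have nn: "0 \<le> pos_part j * pos_part (mob_up a + mob_down b)" "0 \<le> neg_part j * pos_part (mob_up b + mob_down a)"
      by (intro mult_nonneg_nonneg pos_part_nonneg neg_part_nonneg)+
    have "(elem_K T nrm e = K \<and> s = 1 \<and> a = ?v K) \<or> (elem_L T nrm e = K \<and> s = - 1 \<and> b = ?v K) \<or> s = 0"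
      by (cases "elem_K T nrm e = K"; cases "elem_L T nrm e = K") (use E(3) in \<open>simp_all add: s_def a_def b_def\<close>)
    then consider "elem_K T nrm e = K" "s = 1" "a = ?v K" | "elem_L T nrm e = K" "s = - 1" "b = ?v K" | "s = 0"
      by blast
    then show ?thesis
    proof cases
      \<comment> \<open>The first flux term leaves \<open>K\<close> and the second enters it. Above
        1 the entering mobility is at most 1 - 1; below -1 the leaving one is at most 0 + 0. Case 2
        exchanges the two terms.\<close>
      case 1
      from \<sigma> show ?thesis
      proof
        assume "\<sigma> = 1 \<and> 1 < ?v K"
        moreover from this have "pos_part (mob_up b + mob_down a) = 0"
          using mob_up_le_1[of b] mob_down_above[of a] 1 by (intro pos_part_eq_0) simp
        ultimately show ?thesis using 1 nn by (simp add: F)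
      next
        assume "\<sigma> = - 1 \<and> ?v K < - 1"
        moreover from this have "pos_part (mob_up a + mob_down b) = 0"
          using mob_down_nonpos[of b] mob_up_below[of a] 1 by (intro pos_part_eq_0) simp
        ultimately show ?thesis using 1 nn by (simp add: F)
      qed
    next
      case 2
      from \<sigma> show ?thesis
      proof
        assume "\<sigma> = 1 \<and> 1 < ?v K"
        moreover from this have "pos_part (mob_up a + mob_down b) = 0"
          using mob_up_le_1[of a] mob_down_above[of b] 2 by (intro pos_part_eq_0) simp
        ultimately show ?thesis using 2 nn by (simp add: F)
      next
        assume "\<sigma> = - 1 \<and> ?v K < - 1"
        moreover from this have "pos_part (mob_up b + mob_down a) = 0"
          using mob_down_nonpos[of a] mob_up_below[of b] 2 by (intro pos_part_eq_0) simp
        ultimately show ?thesis using 2 nn by (simp add: F)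
      qed
    next
      case 3
      then show ?thesis by (simp add: F)
    qed
  qed
  then have "0 \<le> face_integral (nrm e) e (\<lambda>x. \<sigma> * F e x)" if "e \<in> interior_edges T" for e
    using that edge_elements(8,9)[OF that] by (intro face_integral_nonneg)
  then have "0 \<le> (\<Sum>e\<in>interior_edges T. 1 / edge_dist T nrm e * face_integral (nrm e) e (\<lambda>x. \<sigma> * F e x))"
    by (intro sum_nonneg mult_nonneg_nonneg) (auto simp: edge_dist_def)
  also have "\<dots> = \<sigma> * b_upw \<Omega> T nrm \<mu> \<phi> (indicator K)"
    unfolding face_integral_cmult b_upw_def F_def[symmetric] sum_distrib_left
    by (rule sum.cong[OF refl]) (rule mult.left_commute)
  finally show ?thesis .
qed

section \<open>Integrals over elements and the bound for the phase field\<close>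

lemma element_measure_pos: "K \<in> T \<Longrightarrow> 0 < measure lborel K"
proof (rule ccontr)
  assume K: "K \<in> T" and "\<not> 0 < measure lborel K"
  then have "measure lborel K = 0" using measure_nonneg[of lborel K] by simp
  moreover have "emeasure lborel K \<noteq> \<infinity>"
    using emeasure_compact_finite[OF element_compact[OF K]] by simp
  moreover have Kb: "K \<in> sets borel" using element_compact[OF K] by (simp add: borel_compact)
  ultimately have "emeasure lborel K = 0" by (simp add: emeasure_eq_ennreal_measure)
  then have "K \<in> null_sets lborel" using Kb by (intro null_setsI) auto
  then have "negligible K" using negligible_iff_null_sets null_sets_completionI by blast
  then show False
    using negligible_convex_interior[OF element_convex[OF K]] element_interior_nonempty[OF K] by blast
qed

lemma integral_indicator_element:
  assumes "K \<in> T"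
  shows "(\<integral>x. indicator K x \<partial>lebesgue_on \<Omega>) = measure lborel K"
    and "integrable (lebesgue_on \<Omega>) (\<lambda>x. indicator K x :: real)"
proof -
  have Kb: "K \<in> sets borel" using element_compact[OF assms] by (simp add: borel_compact)
  then have m: "(indicator K :: _ \<Rightarrow> real) \<in> borel_measurable borel" by simp
  have "(\<integral>x. indicator K x \<partial>lebesgue_on \<Omega>) = (\<integral>x. indicator K x \<partial>lborel :: real)"
    by (rule integral_lebesgue_on_borel[OF \<Omega>_sets m]) (use AE_element[OF assms] in eventually_elim, auto)
  also have "\<dots> = measure lborel K" using Kb by simp
  finally show "(\<integral>x. indicator K x \<partial>lebesgue_on \<Omega>) = measure lborel K" .
  interpret finite_measure "lebesgue_on \<Omega>"
    by (rule finite_measure_lebesgue_on[OF open_bounded_lmeasurable[OF \<Omega>_open \<Omega>_bounded]])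
  show "integrable (lebesgue_on \<Omega>) (\<lambda>x. indicator K x :: real)"
    by (rule integrable_const_bound[where B=1]) (use borel_measurable_lebesgue_on[OF m] in auto)
qed

lemma L2_prod_cell:
  assumes v: "v \<in> Pdisc 0 T" and w: "w \<in> Pdisc 0 T" and K: "K \<in> T"
  shows "L2_prod \<Omega> (\<lambda>x. (v x - w x) / \<tau>) (indicator K)
    = (cell_value v K - cell_value w K) / \<tau> * measure lborel K"
proof -
  let ?k = "(cell_value v K - cell_value w K) / \<tau>"
  have i: "integrable (lebesgue_on \<Omega>) (\<lambda>x. ?k * indicator K x)"
    using integral_indicator_element(2)[OF K] by (rule integrable_mult_right)
  have "AE x in lebesgue. indicator \<Omega> x *\<^sub>R (?k * indicator K x) = indicator \<Omega> x *\<^sub>R ((v x - w x) / \<tau> * indicator K x)"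
    using AE_interior[OF K]
  proof eventually_elim
    case (elim x)
    then show ?case using cell_value[OF v K, of x] cell_value[OF w K, of x] by (auto simp: indicator_def)
  qed
  note eq = lebesgue_on_cong_AE(3)[OF \<Omega>_sets \<Omega>_sets borel_measurable_integrable[OF i] this]
  show ?thesis
    unfolding L2_prod_def inner_real_def eq[symmetric] integral_mult_right_zero
      integral_indicator_element(1)[OF K] ..
qed

text \<open>A nonempty open set is not null, so a property valid almost everywhere is met at some
  point of the open element.\<close>

lemma cell_value_AE:
  assumes v: "v \<in> Pdisc 0 T" and K: "K \<in> T" and AE: "AE x in lebesgue_on \<Omega>. P (v x)"
  shows "P (cell_value v K)"
proof (rule ccontr)
  assume nP: "\<not> P (cell_value v K)"
  have "AE x in lebesgue. x \<in> \<Omega> \<longrightarrow> P (v x)" using AE \<Omega>_sets by (simp add: AE_restrict_space_iff)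
  then have "AE x in lebesgue. x \<notin> interior K"
    using AE_element[OF K]
  proof eventually_elim
    case (elim x)
    then show ?case using nP cell_value[OF v K, of x] interior_subset by auto
  qed
  then have "interior K \<in> null_sets lebesgue"
    by (subst (asm) AE_iff_null_sets[symmetric]) auto
  then have "negligible (interior K)" by (simp add: negligible_iff_null_sets)
  then show False using open_not_negligible[OF open_interior] element_interior_nonempty[OF K] by blast
qed

lemma finite_vertices: "K \<in> T \<Longrightarrow> finite (vertices K)"
  using full_simplex.finite_C[OF element_simplex] .

lemma T_nonempty: "T \<noteq> {}"
  using union_T \<Omega>_nonempty by (metis Union_empty closure_eq_empty)

lemma phase_bound:
  assumes \<tau>: "0 < \<tau>" and vp: "velocity_pressure_pair \<Omega> T U P" and u: "u \<in> U"
    and inc: "incompressibility_eq \<Omega> T P u"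
    and \<phi>0: "\<phi>0 \<in> Pdisc 0 T" "AE x in lebesgue_on \<Omega>. \<bar>\<phi>0 x\<bar> \<le> 1"
    and \<phi>: "\<phi> \<in> Pdisc 0 T" and eq: "phase_eq \<tau> \<Omega> T nrm \<phi>0 u \<phi> \<mu>" and K: "K \<in> T"
  shows "\<bar>cell_value \<phi> K\<bar> \<le> 1"
proof -
  have u1: "continuous_on (closure \<Omega>) u" "\<And>i. (\<lambda>x. u x $ i) \<in> H10 \<Omega>"
    using vp u by (auto simp: velocity_pressure_pair_def)
  have div: "(\<integral>x. elem_div T u x * indicator L x \<partial>lebesgue_on \<Omega>) = 0" if "L \<in> T" for L
  proof -
    \<comment> \<open>Piecewise constants are admissible pressures, so incompressibility holds on
      every single element.\<close>
    have "indicator L \<in> P" using vp indicator_Pdisc[OF that] by (auto simp: velocity_pressure_pair_def)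
    then have "L2_prod \<Omega> (elem_div T u) (indicator L) = 0" using inc by (simp add: incompressibility_eq_def)
    then show ?thesis by (simp add: L2_prod_def)
  qed
  \<comment> \<open>The sign \<sigma> covers the upper and the lower bound by one argument.\<close>
  have step: "\<sigma> * cell_value \<phi> K \<le> 1" if s: "\<sigma> = 1 \<or> \<sigma> = - 1" for \<sigma> :: real
  proof -
    have "finite ((\<lambda>L. \<sigma> * cell_value \<phi> L) ` T)" "(\<lambda>L. \<sigma> * cell_value \<phi> L) ` T \<noteq> {}"
      using finite_T T_nonempty by auto
    note fin = this
    obtain L where L1: "L \<in> T" "Max ((\<lambda>L. \<sigma> * cell_value \<phi> L) ` T) = \<sigma> * cell_value \<phi> L"
      using Max_in[OF fin] by blast
    have L: "L \<in> T" "\<And>L'. L' \<in> T \<Longrightarrow> \<sigma> * cell_value \<phi> L' \<le> \<sigma> * cell_value \<phi> L"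
      using L1(1) Max_ge[OF fin(1)] unfolding L1(2) by blast+
    have "\<sigma> * cell_value \<phi> L \<le> 1"
    proof (rule ccontr)
      assume gt: "\<not> \<sigma> * cell_value \<phi> L \<le> 1"
      then have cases: "\<sigma> = 1 \<and> 1 < cell_value \<phi> L \<or> \<sigma> = - 1 \<and> cell_value \<phi> L < - 1" using s by auto
      have "\<bar>cell_value \<phi>0 L\<bar> \<le> 1" by (rule cell_value_AE[OF \<phi>0(1) L(1) \<phi>0(2)])
      then have "\<sigma> * cell_value \<phi>0 L \<le> 1" using s by auto
      then have "0 < \<sigma> * (cell_value \<phi> L - cell_value \<phi>0 L)" using gt by (simp add: right_diff_distrib)
      \<comment> \<open>The time difference contributes strictly positively and the two transport
        terms nonnegatively, which contradicts that the tested equation sums to zero.\<close>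
      then have "0 < \<sigma> * (cell_value \<phi> L - cell_value \<phi>0 L) * measure lborel L / \<tau>"
        using element_measure_pos[OF L(1)] \<tau> by simp
      then have "0 < \<sigma> * L2_prod \<Omega> (\<lambda>x. (\<phi> x - \<phi>0 x) / \<tau>) (indicator L)"
        unfolding L2_prod_cell[OF \<phi> \<phi>0(1) L(1)] by (simp add: mult.assoc)
      moreover have "0 \<le> \<sigma> * a_upw T nrm u \<phi> (indicator L)"
        by (rule a_upw_extremal[OF \<phi> L(1) L(2) u1 div[OF L(1)]])
      moreover have "0 \<le> \<sigma> * b_upw \<Omega> T nrm \<mu> \<phi> (indicator L)"
        by (rule b_upw_sign[OF \<phi> L(1) cases])
      moreover have "\<sigma> * (L2_prod \<Omega> (\<lambda>x. (\<phi> x - \<phi>0 x) / \<tau>) (indicator L)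
          + a_upw T nrm u \<phi> (indicator L) + b_upw \<Omega> T nrm \<mu> \<phi> (indicator L)) = 0"
        using eq indicator_Pdisc[OF L(1)] by (simp add: phase_eq_def)
      ultimately show False by (simp add: distrib_left)
    qed
    then show ?thesis using L(2)[OF K] by linarith
  qed
  show ?thesis using step[of 1] step[of "- 1"] by (simp add: abs_le_iff)
qed

end


section \<open>The mass-lumped projection\<close>

lemma sum_multi_indices_le_1:
  fixes F :: "('d::finite \<Rightarrow> nat) \<Rightarrow> real"
  shows "(\<Sum>\<alpha>\<in>{\<alpha>. (\<Sum>i\<in>UNIV. \<alpha> i) \<le> 1}. F \<alpha>) = F (\<lambda>_. 0) + (\<Sum>i\<in>UNIV. F (\<lambda>j. if j = i then 1 else 0))"
proof -
  let ?e = "\<lambda>(i::'d) (j::'d). if j = i then 1 else (0::nat)"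
  have eq: "{\<alpha>::'d \<Rightarrow> nat. (\<Sum>i\<in>UNIV. \<alpha> i) \<le> 1} = insert (\<lambda>_. 0) (range ?e)"
  proof (intro equalityI subsetI)
    fix \<alpha> :: "'d \<Rightarrow> nat" assume "\<alpha> \<in> {\<alpha>. (\<Sum>i\<in>UNIV. \<alpha> i) \<le> 1}"
    then have le: "(\<Sum>i\<in>UNIV. \<alpha> i) \<le> 1" by simp
    show "\<alpha> \<in> insert (\<lambda>_. 0) (range ?e)"
    proof (cases "\<exists>i. \<alpha> i \<noteq> 0")
      case True
      then obtain i where i: "\<alpha> i \<noteq> 0" by blast
      have s: "(\<Sum>j\<in>UNIV. \<alpha> j) = \<alpha> i + (\<Sum>j\<in>UNIV - {i}. \<alpha> j)" by (rule sum.remove) auto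
      then have z: "(\<Sum>j\<in>UNIV - {i}. \<alpha> j) = 0" "\<alpha> i = 1" using le i by linarith+
      have "\<alpha> = ?e i"
      proof
        fix j show "\<alpha> j = ?e i j" using z by (cases "j = i") auto
      qed
      then show ?thesis by blast
    next
      case False
      then have "\<alpha> = (\<lambda>_. 0)" by (auto simp: fun_eq_iff)
      then show ?thesis by simp
    qed
  qed auto
  have inj: "inj ?e"
  proof (rule injI)
    fix i i' assume eq: "?e i = ?e i'"
    show "i = i'" using fun_cong[OF eq, of i] by (simp split: if_splits)
  qed
  have "(\<lambda>_. 0) \<notin> range ?e"
  proof
    assume "(\<lambda>_. 0) \<in> range ?e"
    then obtain i where i: "(\<lambda>_. 0) = ?e i" by blast
    show False using fun_cong[OF i, of i] by simp
  qed
  then show ?thesis unfolding eq by (simp add: sum.reindex[OF inj])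
qed

lemma prod_unit_power: "(\<Prod>j\<in>UNIV. (x::real^'d) $ j ^ (if j = i then 1 else 0)) = x $ i"
proof -
  have "(\<Prod>j\<in>UNIV. x $ j ^ (if j = i then 1 else 0)) = (\<Prod>j\<in>UNIV. if j = i then x $ j else 1)"
    by (rule prod.cong) auto
  then show ?thesis by simp
qed

lemma polys_1: "p \<in> polys 1 \<longleftrightarrow> (\<exists>g b. p = (\<lambda>x::real^'d. g \<bullet> x + b))"
proof
  assume "p \<in> polys 1"
  then obtain c where p: "p = (\<lambda>x. \<Sum>\<alpha>\<in>{\<alpha>::'d \<Rightarrow> nat. (\<Sum>i\<in>UNIV. \<alpha> i) \<le> 1}. c \<alpha> * (\<Prod>i\<in>UNIV. x $ i ^ \<alpha> i))"
    by (auto simp: polys_def)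
  define g where "g = vec_lambda (\<lambda>i. c (\<lambda>j. if j = i then 1 else 0))"
  have "p x = g \<bullet> x + c (\<lambda>_. 0)" for x
    unfolding p sum_multi_indices_le_1 prod_unit_power by (simp add: g_def inner_vec_def)
  then have "p = (\<lambda>x. g \<bullet> x + c (\<lambda>_. 0))" by (rule ext)
  then show "\<exists>g b. p = (\<lambda>x. g \<bullet> x + b)" by blast
next
  assume "\<exists>g b. p = (\<lambda>x. g \<bullet> x + b)"
  then obtain g b where p: "p = (\<lambda>x. g \<bullet> x + b)" by blast
  \<comment> \<open>On a unit multi-index the sum selects the matching component of
    \<open>g\<close>; multi-indices of higher degree do not occur in the expansion.\<close>
  define c where "c \<alpha> = (if \<alpha> = (\<lambda>_. 0) then b else (\<Sum>i\<in>UNIV. real (\<alpha> i) * g $ i))" for \<alpha> :: "'d \<Rightarrow> nat"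
  have ce: "c (\<lambda>j. if j = i then 1 else 0) = g $ i" for i
  proof -
    have "(\<lambda>j. if j = i then 1 else 0) \<noteq> (\<lambda>_::'d. 0::nat)"
    proof
      assume "(\<lambda>j. if j = i then 1 else 0) = (\<lambda>_::'d. 0::nat)"
      from fun_cong[OF this, of i] show False by simp
    qed
    moreover have "(\<Sum>k\<in>UNIV. real (if k = i then 1 else 0) * g $ k) = (\<Sum>k\<in>UNIV. if k = i then g $ k else 0)"
      by (rule sum.cong) auto
    ultimately show ?thesis by (simp add: c_def)
  qed
  have "p x = (\<Sum>\<alpha>\<in>{\<alpha>::'d \<Rightarrow> nat. (\<Sum>i\<in>UNIV. \<alpha> i) \<le> 1}. c \<alpha> * (\<Prod>i\<in>UNIV. x $ i ^ \<alpha> i))" for x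
    unfolding sum_multi_indices_le_1 prod_unit_power ce by (simp add: p c_def inner_vec_def)
  then show "p \<in> polys 1" unfolding polys_def by blast
qed

context polyhedral_mesh begin

section \<open>The nodal basis of continuous piecewise affine functions\<close>

abbreviation ebary :: "(real^'d) set \<Rightarrow> real^'d \<Rightarrow> real^'d \<Rightarrow> real" where
  "ebary K \<equiv> full_simplex.bary (vertices K)"

definition local_hat :: "real^'d \<Rightarrow> (real^'d) set \<Rightarrow> real^'d \<Rightarrow> real" where
  "local_hat z K x = (if z \<in> vertices K then ebary K z x else 0)"

text \<open>The nodal basis function at \<open>z\<close>. On the mesh the choice of the element is
  immaterial by \<open>local_hat_eq\<close>.\<close>

definition hat :: "real^'d \<Rightarrow> real^'d \<Rightarrow> real" where
  "hat z x = local_hat z (SOME K. K \<in> T \<and> x \<in> K) x"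

text \<open>Both values are the coefficient of \<open>z\<close> in the combination of the vertices of the common face.\<close>

lemma local_hat_eq:
  assumes K: "K \<in> T" "x \<in> K" and L: "L \<in> T" "x \<in> L"
  shows "local_hat z K x = local_hat z L x"
proof -
  interpret K: full_simplex "vertices K" by (rule element_simplex[OF K(1)])
  interpret L: full_simplex "vertices L" by (rule element_simplex[OF L(1)])
  have "K \<inter> L face_of convex hull (vertices K)" "K \<inter> L face_of convex hull (vertices L)"
    using faces[OF K(1) L(1)] faces'[OF K(1) L(1)] element_hull[OF K(1)] element_hull[OF L(1)] by auto
  then obtain D D' where D: "D \<subseteq> vertices K" "K \<inter> L = convex hull D"
    and D': "D' \<subseteq> vertices L" "K \<inter> L = convex hull D'"
    using face_of_convex_hull_affine_independent[OF K.indep] face_of_convex_hull_affine_independent[OF L.indep]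
    by metis
  have "\<not> affine_dependent D" "\<not> affine_dependent D'"
    using K.indep L.indep D(1) D'(1) affine_dependent_subset by blast+
  \<comment> \<open>Both vertex sets are the extreme points of the same common face.\<close>
  then have "v \<in> D \<longleftrightarrow> v \<in> D'" for v
    using extreme_point_of_convex_hull_affine_independent D(2) D'(2) by metis
  then have "D = D'" by blast
  have fin: "finite D" using D(1) K.finite_C finite_subset by blast
  have "x \<in> convex hull D" using K(2) L(2) D(2) by blast
  then obtain u where u: "sum u D = 1" "(\<Sum>v\<in>D. u v *\<^sub>R v) = x"
    unfolding convex_hull_finite[OF fin] by blast
  have "local_hat z K x = (if z \<in> D then u z else 0)"
  proof (cases "z \<in> vertices K")
    case True
    have "K.bary z x = (\<Sum>v\<in>D. u v * K.bary z v)" using K.bary_affine[OF u(1)] u(2) by simp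
    also have "\<dots> = (\<Sum>v\<in>D. if v = z then u v else 0)"
      using D(1) by (intro sum.cong) (auto simp: K.bary_vertex)
    finally show ?thesis using True fin by (simp add: local_hat_def)
  next
    case False
    then show ?thesis using D(1) by (auto simp: local_hat_def)
  qed
  moreover have "local_hat z L x = (if z \<in> D then u z else 0)"
  proof (cases "z \<in> vertices L")
    case True
    have "L.bary z x = (\<Sum>v\<in>D. u v * L.bary z v)" using L.bary_affine[OF u(1)] u(2) by simp
    also have "\<dots> = (\<Sum>v\<in>D. if v = z then u v else 0)"
      using D'(1) \<open>D = D'\<close> by (intro sum.cong) (auto simp: L.bary_vertex)
    finally show ?thesis using True fin by (simp add: local_hat_def)
  next
    case False
    then show ?thesis using D'(1) \<open>D = D'\<close> by (auto simp: local_hat_def)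
  qed
  ultimately show ?thesis by simp
qed

lemma hat_eq: "K \<in> T \<Longrightarrow> x \<in> K \<Longrightarrow> hat z x = local_hat z K x"
proof -
  assume K: "K \<in> T" "x \<in> K"
  then have "\<exists>K. K \<in> T \<and> x \<in> K" by blast
  then have S: "(SOME K. K \<in> T \<and> x \<in> K) \<in> T \<and> x \<in> (SOME K. K \<in> T \<and> x \<in> K)" by (rule someI_ex)
  show ?thesis
    unfolding hat_def by (rule local_hat_eq[OF conjunct1[OF S] conjunct2[OF S] K])
qed

lemma continuous_on_local_hat: "K \<in> T \<Longrightarrow> continuous_on S (local_hat z K)"
  unfolding local_hat_def
  using full_simplex.continuous_on_bary[OF element_simplex continuous_on_id, of K S z]
  by (cases "z \<in> vertices K") auto

lemma local_hat_poly: "K \<in> T \<Longrightarrow> local_hat z K \<in> polys 1"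
proof -
  assume K: "K \<in> T"
  interpret full_simplex "vertices K" by (rule element_simplex[OF K])
  show ?thesis
  proof (cases "z \<in> vertices K")
    case True
    then have "local_hat z K = (\<lambda>x. bgrad z \<bullet> x + (SOME b. \<forall>v\<in>vertices K. bgrad z \<bullet> v + b = (if v = z then 1 else 0)))"
      by (simp add: local_hat_def bary_def fun_eq_iff)
    then show ?thesis unfolding polys_1 by blast
  next
    case False
    then have "local_hat z K = (\<lambda>x. 0 \<bullet> x + 0)" by (simp add: local_hat_def fun_eq_iff)
    then show ?thesis unfolding polys_1 by blast
  qed
qed

lemma continuous_on_mesh:
  assumes "\<And>K. K \<in> T \<Longrightarrow> continuous_on K f"
  shows "continuous_on (closure \<Omega>) f"
proof -
  have "continuous_on (\<Union>K\<in>T. K) f"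
    by (rule continuous_on_closed_Union[OF finite_T]) (use element_compact compact_imp_closed assms in auto)
  then show ?thesis using union_T by simp
qed

lemma hat_Pcont: "hat z \<in> Pcont 1 \<Omega> T"
proof -
  have "continuous_on K (hat z)" if "K \<in> T" for K
    using continuous_on_local_hat[OF that, of K z] hat_eq[OF that] continuous_on_cong[OF refl, of K "hat z" "local_hat z K"]
    by blast
  then have "continuous_on (closure \<Omega>) (hat z)" by (rule continuous_on_mesh)
  moreover have "hat z \<in> Pdisc 1 T"
    unfolding Pdisc_def using local_hat_poly hat_eq interior_subset by blast
  ultimately show ?thesis by (simp add: Pcont_def)
qed

lemma vertex_in_element: "v \<in> vertices K \<Longrightarrow> K \<in> T \<Longrightarrow> v \<in> K"
  using element_hull hull_inc by metis

text \<open>Membership in \<open>Pcont\<close> gives an affine formula only on the open element;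
  continuity extends it to the vertices, and affine functions commute with barycentric
  combinations.\<close>

lemma Pcont_1_expansion:
  assumes w: "w \<in> Pcont 1 \<Omega> T" and K: "K \<in> T" and x: "x \<in> K"
  shows "w x = (\<Sum>v\<in>vertices K. w v * ebary K v x)"
proof -
  interpret full_simplex "vertices K" by (rule element_simplex[OF K])
  have cont: "continuous_on K w"
    using w element_subset[OF K] continuous_on_subset by (auto simp: Pcont_def)
  obtain p where p: "p \<in> polys 1" "\<And>x. x \<in> interior K \<Longrightarrow> w x = p x"
    using w K by (auto simp: Pcont_def Pdisc_def)
  obtain g b where gb: "p = (\<lambda>x. g \<bullet> x + b)" using p(1) polys_1 by blast
  have agree: "w y = g \<bullet> y + b" if y: "y \<in> K" for y
  proof -
    have "y \<in> closure (interior K)" using y element_closure_interior[OF K] by simp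
    then obtain s where s: "\<And>n. s n \<in> interior K" "s \<longlonglongrightarrow> y" unfolding closure_sequential by blast
    have "(\<lambda>n. w (s n)) \<longlonglongrightarrow> w y"
    proof (rule continuous_on_tendsto_compose[OF cont s(2) y])
      show "\<forall>\<^sub>F n in sequentially. s n \<in> K"
        using s(1) interior_subset by (intro always_eventually allI) blast
    qed
    moreover have "w (s n) = g \<bullet> s n + b" for n using p(2)[OF s(1)] gb by simp
    moreover have "(\<lambda>n. g \<bullet> s n + b) \<longlonglongrightarrow> g \<bullet> y + b" by (intro tendsto_intros s(2))
    ultimately show ?thesis using LIMSEQ_unique by simp
  qed
  have "(\<Sum>v\<in>vertices K. w v * bary v x) = (\<Sum>v\<in>vertices K. bary v x * (g \<bullet> v) + bary v x * b)"
    by (rule sum.cong) (simp_all add: agree[OF vertex_in_element[OF _ K]] algebra_simps)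
  also have "\<dots> = g \<bullet> (\<Sum>v\<in>vertices K. bary v x *\<^sub>R v) + (\<Sum>v\<in>vertices K. bary v x) * b"
    by (simp add: sum.distrib inner_sum_right sum_distrib_right)
  also have "\<dots> = w x" unfolding sum_bary bary_combination agree[OF x] by simp
  finally show ?thesis by simp
qed

definition nodes :: "(real^'d) set" where
  "nodes = (\<Union>K\<in>T. vertices K)"

lemma finite_nodes: "finite nodes"
  using finite_T finite_vertices by (auto simp: nodes_def)

lemma Pcont_1_hat_expansion:
  assumes w: "w \<in> Pcont 1 \<Omega> T" and K: "K \<in> T" and x: "x \<in> K"
  shows "w x = (\<Sum>z\<in>nodes. w z * hat z x)"
proof -
  have "(\<Sum>z\<in>nodes. w z * hat z x) = (\<Sum>z\<in>vertices K. w z * hat z x)"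
    by (rule sum.mono_neutral_right[OF finite_nodes])
       (use K in \<open>auto simp: nodes_def hat_eq[OF K x] local_hat_def\<close>)
  also have "\<dots> = (\<Sum>z\<in>vertices K. w z * ebary K z x)"
    by (rule sum.cong) (simp_all add: hat_eq[OF K x] local_hat_def)
  finally show ?thesis using Pcont_1_expansion[OF w K x] by simp
qed

lemma hat_node: "z' \<in> nodes \<Longrightarrow> hat z z' = (if z' = z then 1 else 0)"
proof -
  assume "z' \<in> nodes"
  then obtain K where K: "K \<in> T" "z' \<in> vertices K" by (auto simp: nodes_def)
  show ?thesis
    unfolding hat_eq[OF K(1) vertex_in_element[OF K(2,1)]] local_hat_def
    using full_simplex.bary_vertex[OF element_simplex[OF K(1)] K(2), of z] K(2) by auto
qed

lemma hat_nonneg: "K \<in> T \<Longrightarrow> x \<in> K \<Longrightarrow> 0 \<le> hat z x"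
proof -
  assume K: "K \<in> T" "x \<in> K"
  interpret full_simplex "vertices K" by (rule element_simplex[OF K(1)])
  have "x \<in> convex hull (vertices K)" using K element_hull by simp
  then show "0 \<le> hat z x"
    unfolding hat_eq[OF K] local_hat_def by (auto simp: mem_hull_iff)
qed

text \<open>A diagonal entry of the lumped mass matrix. By \<open>integral_hat\<close> it is also
  the integral of the hat function, so the averaging weights have total mass one.\<close>

definition node_mass :: "real^'d \<Rightarrow> real" where
  "node_mass z = 1 / (real CARD('d) + 1) * (\<Sum>K\<in>T. if z \<in> vertices K then vol K else 0)"

lemma vol_eq: "K \<in> T \<Longrightarrow> vol K = measure lborel K"
  unfolding vol_def using element_compact[of K] by (simp add: borel_compact measure_completion)

lemma node_mass_pos: "z \<in> nodes \<Longrightarrow> 0 < node_mass z"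
proof -
  assume "z \<in> nodes"
  then obtain K where K: "K \<in> T" "z \<in> vertices K" by (auto simp: nodes_def)
  have "0 < (\<Sum>K\<in>T. if z \<in> vertices K then vol K else 0)"
    by (rule sum_pos2[OF finite_T K(1)]) (use K element_measure_pos vol_eq in \<open>auto simp: less_imp_le\<close>)
  then show ?thesis by (simp add: node_mass_def add_pos_nonneg)
qed

lemma lumped_prod_nodes: "lumped_prod T v w = (\<Sum>z\<in>nodes. node_mass z * (v z * w z))"
proof -
  have "(\<Sum>K\<in>T. vol K * (\<Sum>z\<in>vertices K. v z * w z))
      = (\<Sum>K\<in>T. \<Sum>z\<in>nodes. (if z \<in> vertices K then vol K else 0) * (v z * w z))"
  proof (rule sum.cong[OF refl])
    fix K assume K: "K \<in> T"
    have "(\<Sum>z\<in>nodes. (if z \<in> vertices K then vol K else 0) * (v z * w z))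
        = (\<Sum>z\<in>vertices K. (if z \<in> vertices K then vol K else 0) * (v z * w z))"
      by (rule sum.mono_neutral_right[OF finite_nodes]) (use K in \<open>auto simp: nodes_def\<close>)
    then show "vol K * (\<Sum>z\<in>vertices K. v z * w z) = (\<Sum>z\<in>nodes. (if z \<in> vertices K then vol K else 0) * (v z * w z))"
      by (simp add: sum_distrib_left)
  qed
  also have "\<dots> = (\<Sum>z\<in>nodes. \<Sum>K\<in>T. (if z \<in> vertices K then vol K else 0) * (v z * w z))" by (rule sum.swap)
  finally show ?thesis
    unfolding lumped_prod_def node_mass_def by (simp add: sum_distrib_left sum_distrib_right mult.assoc)
qed

text \<open>Up to a null set the hat function is the sum of its restrictions to the elements, and
  each element having \<open>z\<close> as vertex contributes |K|/(d+1) by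
  \<open>integral_bary\<close>.\<close>

lemma hat_integrable: "integrable (lebesgue_on \<Omega>) (hat z)"
  and integral_hat: "(\<integral>x. hat z x \<partial>lebesgue_on \<Omega>) = node_mass z"
proof -
  define f where "f K x = indicator K x * local_hat z K x" for K x
  have fi: "integrable lborel (f K)" if K: "K \<in> T" for K
    using borel_integrable_compact[OF element_compact[OF K] continuous_on_local_hat[OF K, of K z]]
    by (simp add: f_def[abs_def])
  have fM: "integrable (lebesgue_on \<Omega>) (f K)" if K: "K \<in> T" for K
  proof -
    have "integrable lebesgue (f K)"
      using integrable_completion[OF borel_measurable_integrable[OF fi[OF K]]] fi[OF K] by blast
    then have "integrable lebesgue (\<lambda>x. indicator \<Omega> x *\<^sub>R f K x)"
      by (rule integrable_mult_indicator[OF \<Omega>_sets])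
    then show ?thesis using \<Omega>_sets by (simp add: integrable_restrict_space)
  qed
  have fint: "(\<integral>x. f K x \<partial>lebesgue_on \<Omega>) = (if z \<in> vertices K then vol K else 0) / (real CARD('d) + 1)"
    if K: "K \<in> T" for K
  proof -
    have m: "f K \<in> borel_measurable borel" using borel_measurable_integrable[OF fi[OF K]] by simp
    have "(\<integral>x. f K x \<partial>lebesgue_on \<Omega>) = (\<integral>x. f K x \<partial>lborel)"
      by (rule integral_lebesgue_on_borel[OF \<Omega>_sets m])
         (use AE_element[OF K] in eventually_elim, auto simp: f_def)
    also have "\<dots> = (if z \<in> vertices K then vol K else 0) / (real CARD('d) + 1)"
    proof (cases "z \<in> vertices K")
      case True
      then show ?thesis
        using full_simplex.integral_bary[OF element_simplex[OF K] True] element_hull[OF K] vol_eq[OF K]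
        by (simp add: f_def local_hat_def)
    qed (simp add: f_def local_hat_def)
    finally show ?thesis .
  qed
  have sumi: "integrable (lebesgue_on \<Omega>) (\<lambda>x. \<Sum>K\<in>T. f K x)" by (rule Bochner_Integration.integrable_sum[OF fM])
  have AE: "AE x in lebesgue. indicator \<Omega> x *\<^sub>R (\<Sum>K\<in>T. f K x) = indicator \<Omega> x *\<^sub>R hat z x"
    using AE_interiors
  proof eventually_elim
    case (elim x)
    have "(\<Sum>K\<in>T. f K x) = hat z x" if "x \<in> \<Omega>"
    proof -
      from that obtain K where K: "K \<in> T" "x \<in> interior K" using elim by (auto simp: interiors_def)
      then have xK: "x \<in> K" using interior_subset by blast
      have "(\<Sum>L\<in>T. f L x) = (\<Sum>L\<in>T. if L = K then f K x else 0)"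
        by (rule sum.cong) (use notin_element[OF _ K(1) _ K(2)] in \<open>auto simp: f_def\<close>)
      also have "\<dots> = f K x" using K(1) finite_T by simp
      also have "\<dots> = hat z x" using xK by (simp add: f_def hat_eq[OF K(1) xK])
      finally show ?thesis .
    qed
    then show ?case by (simp add: indicator_def)
  qed
  note cong = lebesgue_on_cong_AE[OF \<Omega>_sets \<Omega>_sets borel_measurable_integrable[OF sumi] AE]
  show "integrable (lebesgue_on \<Omega>) (hat z)" using cong(2) sumi by blast
  have "(\<integral>x. hat z x \<partial>lebesgue_on \<Omega>) = (\<integral>x. (\<Sum>K\<in>T. f K x) \<partial>lebesgue_on \<Omega>)" by (rule cong(3)[symmetric])
  also have "\<dots> = (\<Sum>K\<in>T. (\<integral>x. f K x \<partial>lebesgue_on \<Omega>))" by (rule Bochner_Integration.integral_sum[OF fM])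
  also have "\<dots> = (\<Sum>K\<in>T. (if z \<in> vertices K then vol K else 0) / (real CARD('d) + 1))"
    by (rule sum.cong[OF refl fint])
  also have "\<dots> = node_mass z" by (simp add: node_mass_def sum_divide_distrib)
  finally show "(\<integral>x. hat z x \<partial>lebesgue_on \<Omega>) = node_mass z" .
qed

lemma Pdisc_0_measurable:
  assumes "v \<in> Pdisc 0 T"
  shows "v \<in> borel_measurable (lebesgue_on \<Omega>)"
proof (rule lebesgue_on_cong_AE(1)[OF \<Omega>_sets \<Omega>_sets])
  let ?s = "\<lambda>x. \<Sum>K\<in>T. cell_value v K * indicator K x"
  show "?s \<in> borel_measurable (lebesgue_on \<Omega>)"
    by (rule borel_measurable_sum, rule borel_measurable_integrable, rule integrable_mult_right)
       (rule integral_indicator_element(2))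
  show "AE x in lebesgue. indicator \<Omega> x *\<^sub>R ?s x = indicator \<Omega> x *\<^sub>R v x"
    using AE_interiors
  proof eventually_elim
    case (elim x)
    have "?s x = v x" if "x \<in> \<Omega>"
    proof -
      from that obtain K where K: "K \<in> T" "x \<in> interior K" using elim by (auto simp: interiors_def)
      then have xK: "x \<in> K" using interior_subset by blast
      have "?s x = (\<Sum>L\<in>T. if L = K then cell_value v K else 0)"
        by (rule sum.cong) (use notin_element[OF _ K(1) _ K(2)] xK in auto)
      also have "\<dots> = cell_value v K" using K(1) finite_T by simp
      finally show ?thesis using cell_value[OF assms K] by simp
    qed
    then show ?case by (simp add: indicator_def)
  qed
qed

text \<open>The lumped mass matrix is diagonal, so that the nodal value of the projection at \<open>z\<close> is a
  weighted average of \<open>\<phi>\<close> with weight proportional to \<open>hat z\<close>.\<close>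

lemma Pi1h_bound:
  assumes \<phi>: "\<phi> \<in> Pdisc 0 T" and bound: "AE x in lebesgue_on \<Omega>. \<bar>\<phi> x\<bar> \<le> 1" and x: "x \<in> \<Omega>"
  shows "\<bar>Pi1h \<Omega> T \<phi> x\<bar> \<le> 1"
proof -
  let ?M = "lebesgue_on \<Omega>"
  have prod_m: "(\<lambda>x. \<phi> x * hat z x) \<in> borel_measurable ?M" for z
    by (intro borel_measurable_times Pdisc_0_measurable[OF \<phi>] borel_measurable_integrable[OF hat_integrable])
  have le: "AE x in ?M. \<bar>\<phi> x * hat z x\<bar> \<le> hat z x" for z
  proof -
    have "AE x in ?M. x \<in> \<Omega>" using \<Omega>_sets by (simp add: AE_restrict_space_iff)
    with bound show ?thesis
    proof eventually_elim
      case (elim x)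
      then obtain K where "K \<in> T" "x \<in> K" using union_T closure_subset by blast
      then have "0 \<le> hat z x" by (rule hat_nonneg)
      then show ?case using mult_right_mono[OF elim(1), of "hat z x"] by (simp add: abs_mult)
    qed
  qed
  have prod_i: "integrable ?M (\<lambda>x. \<phi> x * hat z x)" for z
    by (rule Bochner_Integration.integrable_bound[OF hat_integrable[of z] prod_m])
       (use le[of z] in eventually_elim, auto)
  have prod_le: "\<bar>\<integral>x. \<phi> x * hat z x \<partial>?M\<bar> \<le> node_mass z" for z
  proof -
    have "\<bar>\<integral>x. \<phi> x * hat z x \<partial>?M\<bar> \<le> (\<integral>x. \<bar>\<phi> x * hat z x\<bar> \<partial>?M)"
      by (rule integral_abs_bound)
    also have "\<dots> \<le> (\<integral>x. hat z x \<partial>?M)"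
      by (rule integral_mono_AE[OF integrable_abs[OF prod_i] hat_integrable le])
    finally show ?thesis by (simp add: integral_hat)
  qed
  \<comment> \<open>\<open>Pi1h\<close> is a choice, so a function with the defining property must
    first be exhibited; its nodal values solve the diagonal system.\<close>
  define V where "V x = (\<Sum>z\<in>nodes. (\<integral>y. \<phi> y * hat z y \<partial>?M) / node_mass z * hat z x)" for x
  have V_cont: "V \<in> Pcont 1 \<Omega> T"
  proof -
    have "continuous_on (closure \<Omega>) V"
      unfolding V_def using hat_Pcont by (intro continuous_on_sum continuous_on_mult continuous_on_const) (simp add: Pcont_def)
    moreover have "\<exists>p\<in>polys 1. \<forall>x\<in>interior K. V x = p x" if K: "K \<in> T" for K
    proof -
      have "\<exists>g b. local_hat z K = (\<lambda>x. g \<bullet> x + b)" for z using local_hat_poly[OF K, of z] polys_1 by blast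
      then obtain g b where gb: "\<And>z. local_hat z K = (\<lambda>x. g z \<bullet> x + b z)" by metis
      define a where "a z = (\<integral>y. \<phi> y * hat z y \<partial>?M) / node_mass z" for z
      have "V x = (\<Sum>z\<in>nodes. a z *\<^sub>R g z) \<bullet> x + (\<Sum>z\<in>nodes. a z * b z)" if "x \<in> interior K" for x
      proof -
        have xK: "x \<in> K" using that interior_subset by blast
        show ?thesis
          unfolding V_def hat_eq[OF K xK] gb a_def[symmetric]
          by (simp add: inner_sum_left sum.distrib distrib_left)
      qed
      then have "\<forall>x\<in>interior K. V x = (\<Sum>z\<in>nodes. a z *\<^sub>R g z) \<bullet> x + (\<Sum>z\<in>nodes. a z * b z)" by blast
      moreover have "(\<lambda>x. (\<Sum>z\<in>nodes. a z *\<^sub>R g z) \<bullet> x + (\<Sum>z\<in>nodes. a z * b z)) \<in> polys 1"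
        unfolding polys_1 by blast
      ultimately show ?thesis
        by (intro bexI[of _ "\<lambda>x. (\<Sum>z\<in>nodes. a z *\<^sub>R g z) \<bullet> x + (\<Sum>z\<in>nodes. a z * b z)"])
    qed
    ultimately show ?thesis by (simp add: Pcont_def Pdisc_def)
  qed
  have V_node: "V z = (\<integral>y. \<phi> y * hat z y \<partial>?M) / node_mass z" if "z \<in> nodes" for z
  proof -
    have "V z = (\<Sum>z'\<in>nodes. if z' = z then (\<integral>y. \<phi> y * hat z' y \<partial>?M) / node_mass z' else 0)"
      unfolding V_def by (rule sum.cong) (auto simp: hat_node[OF that])
    then show ?thesis using that finite_nodes by simp
  qed
  have "lumped_prod T V w = L2_prod \<Omega> \<phi> w" if w: "w \<in> Pcont 1 \<Omega> T" for w
  proof -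
    have "L2_prod \<Omega> \<phi> w = (\<integral>x. \<phi> x * w x \<partial>?M)" by (simp add: L2_prod_def)
    also have "\<dots> = (\<integral>x. (\<Sum>z\<in>nodes. w z * (\<phi> x * hat z x)) \<partial>?M)"
    proof (rule Bochner_Integration.integral_cong[OF refl])
      fix x assume "x \<in> space ?M"
      then obtain K where K: "K \<in> T" "x \<in> K"
        using union_T closure_subset[of \<Omega>] by (auto simp: space_restrict_space)
      show "\<phi> x * w x = (\<Sum>z\<in>nodes. w z * (\<phi> x * hat z x))"
        unfolding Pcont_1_hat_expansion[OF w K] sum_distrib_left by (rule sum.cong) simp_all
    qed
    also have "\<dots> = (\<Sum>z\<in>nodes. (\<integral>x. w z * (\<phi> x * hat z x) \<partial>?M))"
      by (rule Bochner_Integration.integral_sum) (rule integrable_mult_right, rule prod_i)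
    also have "\<dots> = (\<Sum>z\<in>nodes. node_mass z * (V z * w z))"
      using node_mass_pos by (intro sum.cong refl) (simp add: V_node less_imp_neq[THEN not_sym])
    finally show ?thesis by (simp add: lumped_prod_nodes)
  qed
  then have "\<exists>v. v \<in> Pcont 1 \<Omega> T \<and> (\<forall>w\<in>Pcont 1 \<Omega> T. lumped_prod T v w = L2_prod \<Omega> \<phi> w)"
    using V_cont by blast
  then have "Pi1h \<Omega> T \<phi> \<in> Pcont 1 \<Omega> T \<and>
      (\<forall>w\<in>Pcont 1 \<Omega> T. lumped_prod T (Pi1h \<Omega> T \<phi>) w = L2_prod \<Omega> \<phi> w)"
    unfolding Pi1h_def by (rule someI_ex)
  then have spec: "Pi1h \<Omega> T \<phi> \<in> Pcont 1 \<Omega> T"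
      "\<And>w. w \<in> Pcont 1 \<Omega> T \<Longrightarrow> lumped_prod T (Pi1h \<Omega> T \<phi>) w = L2_prod \<Omega> \<phi> w"
    by blast+
  \<comment> \<open>Testing with the hat function at \<open>z\<close> isolates this nodal value,
    whichever function the choice selects.\<close>
  have node: "\<bar>Pi1h \<Omega> T \<phi> z\<bar> \<le> 1" if z: "z \<in> nodes" for z
  proof -
    have "lumped_prod T (Pi1h \<Omega> T \<phi>) (hat z) = (\<Sum>z'\<in>nodes. if z' = z then node_mass z' * Pi1h \<Omega> T \<phi> z' else 0)"
      unfolding lumped_prod_nodes by (rule sum.cong) (auto simp: hat_node)
    also have "\<dots> = node_mass z * Pi1h \<Omega> T \<phi> z" using z finite_nodes by simp
    finally have "node_mass z * Pi1h \<Omega> T \<phi> z = (\<integral>x. \<phi> x * hat z x \<partial>?M)"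
      using spec(2)[OF hat_Pcont] by (simp add: L2_prod_def)
    then have "\<bar>node_mass z * Pi1h \<Omega> T \<phi> z\<bar> \<le> node_mass z" using prod_le[of z] by (simp only:)
    then have "node_mass z * \<bar>Pi1h \<Omega> T \<phi> z\<bar> \<le> node_mass z * 1"
      unfolding abs_mult abs_of_pos[OF node_mass_pos[OF z]] by simp
    then show ?thesis using node_mass_pos[OF z] by simp
  qed
  obtain K where K: "K \<in> T" "x \<in> K" using x union_T closure_subset by blast
  interpret full_simplex "vertices K" by (rule element_simplex[OF K(1)])
  have "\<bar>Pi1h \<Omega> T \<phi> x\<bar> \<le> (\<Sum>v\<in>vertices K. \<bar>Pi1h \<Omega> T \<phi> v * bary v x\<bar>)"
    unfolding Pcont_1_expansion[OF spec(1) K] by (rule sum_abs)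
  also have "\<dots> \<le> (\<Sum>v\<in>vertices K. bary v x)"
  proof (rule sum_mono)
    fix v assume v: "v \<in> vertices K"
    have "0 \<le> bary v x" using K v element_hull[OF K(1)] mem_hull_iff[of x] by simp
    moreover have "v \<in> nodes" using v K(1) by (auto simp: nodes_def)
    ultimately show "\<bar>Pi1h \<Omega> T \<phi> v * bary v x\<bar> \<le> bary v x"
      using mult_right_mono[OF node, of v "bary v x"] by (simp add: abs_mult)
  qed
  finally show ?thesis by (simp add: sum_bary)
qed

end

lemma rho_range_iff:
  assumes "\<rho>1 < \<rho>2"
  shows "rho \<rho>1 \<rho>2 s \<in> {\<rho>1..\<rho>2} \<longleftrightarrow> \<bar>s\<bar> \<le> 1"
proof -
  have p: "0 < rho_dif \<rho>1 \<rho>2" using assms by (simp add: rho_dif_def)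
  have "\<rho>1 = (\<rho>1 + \<rho>2) / 2 - rho_dif \<rho>1 \<rho>2 * 1" "\<rho>2 = (\<rho>1 + \<rho>2) / 2 + rho_dif \<rho>1 \<rho>2 * 1"
    by (simp_all add: rho_dif_def field_simps)
  then have "rho \<rho>1 \<rho>2 s \<in> {\<rho>1..\<rho>2} \<longleftrightarrow>
      rho_dif \<rho>1 \<rho>2 * (- 1) \<le> rho_dif \<rho>1 \<rho>2 * s \<and> rho_dif \<rho>1 \<rho>2 * s \<le> rho_dif \<rho>1 \<rho>2 * 1"
    unfolding rho_def atLeastAtMost_iff by linarith
  also have "\<dots> \<longleftrightarrow> - 1 \<le> s \<and> s \<le> 1" unfolding mult_le_cancel_left_pos[OF p] ..
  finally show ?thesis by (simp add: abs_le_iff conj_commute)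
qed

theorem corollary3p6:
  fixes \<Omega> :: "(real^'d) set" and T :: "(real^'d) set set" and nrm :: "(real^'d) set \<Rightarrow> real^'d"
    and \<rho>1 \<rho>2 lam \<epsilon> \<Delta>t \<sigma> :: real and \<eta> :: "real \<Rightarrow> real"
    and U :: "(real^'d \<Rightarrow> real^'d) set" and P :: "(real^'d \<Rightarrow> real) set"
    and um u :: "real^'d \<Rightarrow> real^'d" and \<phi>m \<mu>m p \<phi> \<mu> :: "real^'d \<Rightarrow> real"
  assumes "CARD('d) \<in> {2, 3}"
    and "polyhedral_domain \<Omega>"
    and "0 < \<rho>1" and "\<rho>1 < \<rho>2" and "lam > 0" and "\<epsilon> > 0" and "\<Delta>t > 0"
    and "continuous_on {-1..1} \<eta>" and "\<exists>C>0. \<forall>s\<in>{-1..1}. \<eta> s \<ge> C"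
    and "simplicial_mesh \<Omega> T" and "shape_regular \<sigma> T" and "orthogonal_barycenters T"
    and "edge_normals T nrm"
    and "velocity_pressure_pair \<Omega> T U P"
    and "um \<in> U" and "\<phi>m \<in> Pdisc 0 T" and "\<mu>m \<in> Pcont 1 \<Omega> T"
    and "AE x in lebesgue_on \<Omega>. rho \<rho>1 \<rho>2 (\<phi>m x) \<in> {\<rho>1..\<rho>2}"
    and "scheme_solution \<rho>1 \<rho>2 lam \<epsilon> \<Delta>t \<eta> \<Omega> T nrm U P um \<phi>m \<mu>m u p \<phi> \<mu>"
  shows "(AE x in lebesgue_on \<Omega>. rho \<rho>1 \<rho>2 (\<phi> x) \<in> {\<rho>1..\<rho>2}) \<and>
         (\<forall>x\<in>\<Omega>. rho \<rho>1 \<rho>2 (Pi1h \<Omega> T \<phi> x) \<in> {\<rho>1..\<rho>2})"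
proof -
  interpret polyhedral_mesh \<Omega> T nrm by unfold_locales fact+
  note rho = rho_range_iff[OF \<open>\<rho>1 < \<rho>2\<close>]
  have sol: "u \<in> U" "\<phi> \<in> Pdisc 0 T" "incompressibility_eq \<Omega> T P u" "phase_eq \<Delta>t \<Omega> T nrm \<phi>m u \<phi> \<mu>"
    using assms(19) by (auto simp: scheme_solution_def)
  have \<phi>m: "AE x in lebesgue_on \<Omega>. \<bar>\<phi>m x\<bar> \<le> 1" using assms(18) unfolding rho .
  have cells: "\<bar>cell_value \<phi> K\<bar> \<le> 1" if "K \<in> T" for K
    by (rule phase_bound[OF \<open>\<Delta>t > 0\<close> \<open>velocity_pressure_pair \<Omega> T U P\<close> sol(1,3) \<open>\<phi>m \<in> Pdisc 0 T\<close> \<phi>m sol(2,4) that])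
  \<comment> \<open>The phase field is free on the mesh skeleton, hence bounded almost everywhere;
    its continuous projection is bounded at every point.\<close>
  have "AE x in lebesgue. x \<in> \<Omega> \<longrightarrow> \<bar>\<phi> x\<bar> \<le> 1"
    using AE_interiors
  proof eventually_elim
    case (elim x)
    show ?case
    proof
      assume "x \<in> \<Omega>"
      then obtain K where K: "K \<in> T" "x \<in> interior K" using elim by (auto simp: interiors_def)
      then show "\<bar>\<phi> x\<bar> \<le> 1" using cells[OF K(1)] cell_value[OF sol(2) K] by simp
    qed
  qed
  then have \<phi>: "AE x in lebesgue_on \<Omega>. \<bar>\<phi> x\<bar> \<le> 1" using \<Omega>_sets by (simp add: AE_restrict_space_iff)
  then show ?thesis unfolding rho using Pi1h_bound[OF sol(2) \<phi>] by blast
qed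

end
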